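(* The space $\Xi=\mathbb{C}[e^{\xi_0},e^{-\xi_0},\xi_1,\xi_2,\dots]$, equipped with the linear map $Y(\cdot,x)\cdot=\phi_x\circ\Upsilon(\cdot,x)\cdot:\Xi\otimes\Xi\to\Xi((x))$, is a vertex algebra with vacuum vector $1\in\Xi$.
   Context: All vector spaces are over $\mathbb{C}$. The symbols $x,y,z,\xi_0,\xi_1,\xi_2,\dots$ are commuting formal variables, and $\log x$ is a further formal variable (an atomic symbol, not a series) commuting with all of them. The derivation $\frac{d}{dx}$ is extended by $\frac{d}{dx}\log x=x^{-1}$. For a formal object $w$, $e^{w}=\sum_{n\ge0}w^n/n!$ whenever this makes sense; in particular $e^{n\log x}$ is a formal power series in $\log x$ and is not equal to $x^n$. For a vector space $V$, $V[[x,x^{-1}]]$ is the space of doubly infinite formal Laurent series, $V((x))$ the space of formal Laurent series truncated from below, and $V[[x]]$ the space of formal power series. **The space.** $\Xi=\mathbb{C}[e^{\xi_0},e^{-\xi_0},\xi_1,\xi_2,\dots]$ is the commutative algebra $\mathbb{C}[e^{\xi_0},e^{-\xi_0}]\otimes\mathbb{C}[\xi_1,\xi_2,\dots]$, where the $e^{m\xi_0}$ ($m\in\mathbb{Z}$) are the formal exponential series; $\frac{\partial}{\partial\xi_0}e^{m\xi_0}=m\,e^{m\xi_0}$. **The operators.** Let $$h^{+}(x)=2\log x\,\frac{\partial}{\partial\xi_0}-2\sum_{n>0}\frac{x^{-n}}{n}\frac{\partial}{\partial\xi_n},\qquad h^{-}(x)=\sum_{m\ge0}\xi_m x^m,\qquad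 h(x)=h^{+}(x)+h^{-}(x),$$ and let $h^{(n)}(x)=\left(\frac{d}{dx}\right)^n h(x)$. Colons $:\ :$ denote normal ordering: in a product, all differential operators $\frac{\partial}{\partial\xi_i}$ are placed to the right of all multiplication operators. In particular $:e^{mh(x)}:\;=e^{mh^{-}(x)}e^{mh^{+}(x)}$ for $m\in\mathbb{Z}$. **The map $\Upsilon$.** $\Upsilon(\cdot,x)\cdot:\Xi\otimes\Xi\to\Xi((x))[e^{\log x},e^{-\log x}]$ is the unique linear map such that $\Upsilon(1,x)=1$ (the identity operator), $\Upsilon(\xi_n,x)=\frac{h^{(n)}(x)}{n!}$ for $n\ge1$, $\Upsilon(e^{m\xi_0},x)=\,:e^{mh(x)}:$ for $m\in\mathbb{Z}$, and $\Upsilon(pq,x)=\,:\Upsilon(p,x)\Upsilon(q,x):$ for all $p,q\in\Xi$. **The map $\phi_x$.** It substitutes $x$ for $e^{\log x}$: for a vector space $V$ not involving $x$ or $\log x$, $\phi_x:V[[x,x^{-1}]][e^{\log x},e^{-\log x}]\to V[[x,x^{-1}]]$ is given by $\phi_x\left(\sum_{n\in\mathbb{Z}}v_n(x)e^{n\log x}\right)=\sum_{n\in\mathbb{Z}}v_n(x)x^n$ (finite sums, $v_n(x)\in V[[x,x^{-1}]]$). **Vertex algebra.** A vertex algebra is a vector space $V$ with a linear map $V\otimes V\to V[[x,x^{-1}]]$, equivalently a linear map $Y(\cdot,x):V\to(\mathrm{End}\,V)[[x,x^{-1}]]$, and a distinguished element $\mathbf{1}\in V$, such that for all $u,v\in V$: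 (i) $Y(u,x)v\in V((x))$; (ii) (vacuum property) $Y(\mathbf{1},x)=1$, the identity; (iii) (creation property) $Y(u,x)\mathbf{1}\in V[[x]]$ and $Y(u,0)\mathbf{1}=u$; (iv) (Jacobi identity) $$z^{-1}\delta\left(\frac{x-y}{z}\right)Y(u,x)Y(v,y)-z^{-1}\delta\left(\frac{y-x}{-z}\right)Y(v,y)Y(u,x)=x^{-1}\delta\left(\frac{y+z}{x}\right)Y(Y(u,z)v,y).$$ Here $\delta(x)=\sum_{n\in\mathbb{Z}}x^n$, and a power $(a+b)^n$, $n\in\mathbb{Z}$, of a sum of two formal variables (possibly with signs) is expanded in nonnegative powers of the second listed variable $b$. *)

theory Defs
  imports
    "HOL-Analysis.Analysis"
    "HOL-Computational_Algebra.Formal_Power_Series"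
    "HOL-Library.Multiset"
    "HOL-Library.Poly_Mapping"
begin

section \<open>Vertex algebras\<close>

text \<open>
  \<open>binpow s n i j\<close> is the coefficient of \<open>p^i q^j\<close> in \<open>(p + s q)^n\<close>, \<open>n\<close> an integer, expanded in
  nonnegative powers of the second listed variable \<open>q\<close>.
\<close>

definition binpow :: "complex \<Rightarrow> int \<Rightarrow> int \<Rightarrow> int \<Rightarrow> complex" where
  "binpow s n i j =
     (if j \<ge> 0 \<and> i + j = n then ((of_int n :: complex) gchoose nat j) * s ^ nat j else 0)"

text \<open>
  Coefficients of \<open>x^a y^b z^c\<close> in the three delta functions of the Jacobi identity:
  \<open>z^-1 \<delta>((x - y)/z) = \<Sum>n. (x - y)^n z^(-n-1)\<close>,
  \<open>z^-1 \<delta>((y - x)/(-z)) = \<Sum>n. (-1)^n (y - x)^n z^(-n-1)\<close> and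
  \<open>x^-1 \<delta>((y + z)/x) = \<Sum>n. (y + z)^n x^(-n-1)\<close>, the sums being over all integers.
\<close>

definition delta_xy :: "int \<Rightarrow> int \<Rightarrow> int \<Rightarrow> complex" where
  "delta_xy a b c = binpow (-1) (- c - 1) a b"

definition delta_yx :: "int \<Rightarrow> int \<Rightarrow> int \<Rightarrow> complex" where
  "delta_yx a b c = ((-1) powi (- c - 1)) * binpow (-1) (- c - 1) b a"

definition delta_yz :: "int \<Rightarrow> int \<Rightarrow> int \<Rightarrow> complex" where
  "delta_yz a b c = binpow 1 (- a - 1) b c"

text \<open>
  The underlying vector space is a subspace \<open>V\<close> of the ambient type, and \<open>Y u i v\<close> is the
  coefficient of \<open>x^i\<close> in \<open>Y(u,x)v\<close> (not the mode \<open>u\<^sub>i v\<close>, which is the coefficient of \<open>x^(-i-1)\<close>).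
  The Jacobi identity is stated as equality of the coefficients of \<open>x^a y^b z^c\<close>, after applying both
  sides to \<open>w\<close>. \<open>Sum_any\<close> is the sum over the support; the supports occurring in the Jacobi
  identity are finite because of \<open>truncation\<close>.
\<close>

locale vertex_algebra = vector_space scale
  for scale :: "complex \<Rightarrow> 'v::ab_group_add \<Rightarrow> 'v" (infixr \<open>*s\<close> 75) +
  fixes V :: "'v set"
    and Y :: "'v \<Rightarrow> int \<Rightarrow> 'v \<Rightarrow> 'v"
    and vac :: 'v
  assumes subspace_V: "subspace V"
    and vac_in: "vac \<in> V"
    and Y_in: "u \<in> V \<Longrightarrow> v \<in> V \<Longrightarrow> Y u i v \<in> V"
    and Y_add_left: "u \<in> V \<Longrightarrow> u' \<in> V \<Longrightarrow> v \<in> V \<Longrightarrow> Y (u + u') i v = Y u i v + Y u' i v"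
    and Y_scale_left: "u \<in> V \<Longrightarrow> v \<in> V \<Longrightarrow> Y (c *s u) i v = c *s Y u i v"
    and Y_add_right: "u \<in> V \<Longrightarrow> v \<in> V \<Longrightarrow> v' \<in> V \<Longrightarrow> Y u i (v + v') = Y u i v + Y u i v'"
    and Y_scale_right: "u \<in> V \<Longrightarrow> v \<in> V \<Longrightarrow> Y u i (c *s v) = c *s Y u i v"
    and truncation: "u \<in> V \<Longrightarrow> v \<in> V \<Longrightarrow> \<exists>N. \<forall>i<N. Y u i v = 0"
    and vacuum: "v \<in> V \<Longrightarrow> Y vac i v = (if i = 0 then v else 0)"
    and creation_regular: "u \<in> V \<Longrightarrow> i < 0 \<Longrightarrow> Y u i vac = 0"
    and creation: "u \<in> V \<Longrightarrow> Y u 0 vac = u"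
    and jacobi: "u \<in> V \<Longrightarrow> v \<in> V \<Longrightarrow> w \<in> V \<Longrightarrow>
      Sum_any (\<lambda>(i, j). delta_xy (a - i) (b - j) c *s Y u i (Y v j w))
      - Sum_any (\<lambda>(i, j). delta_yx (a - i) (b - j) c *s Y v j (Y u i w))
      = Sum_any (\<lambda>(j, k). delta_yz a (b - j) (c - k) *s Y (Y u k v) j w)"


section \<open>The space \<open>\<Xi>\<close>\<close>

text \<open>
  The \<open>e^(m \<xi>\<^sub>0)\<close> are formal power series in \<open>\<xi>\<^sub>0\<close>, so everything takes place in
  \<open>\<complex>[\<xi>\<^sub>1,\<xi>\<^sub>2,\<dots>][[\<xi>\<^sub>0]]\<close>, which also contains \<open>\<xi>\<^sub>0\<close> itself. Polynomials are finitely supported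
  functions on monomials, and a monomial in the \<open>\<xi>\<^sub>n\<close> is the multiset of its indices. The index 0 is
  admitted by the type, but it is never used in a coefficient: \<open>\<xi>\<^sub>0\<close> is the power series variable.
\<close>

type_synonym amb = "(nat multiset \<Rightarrow>\<^sub>0 complex) fps"

definition ascale :: "complex \<Rightarrow> amb \<Rightarrow> amb" where
  "ascale c w = fps_const (Poly_Mapping.single {#} c) * w"

interpretation amb: vector_space ascale
proof (unfold_locales, goal_cases)
  case 1 show ?case by (simp add: ascale_def distrib_left)
next
  case 2 show ?case by (simp add: ascale_def single_add fps_const_add [symmetric] distrib_right del: fps_const_add)
next
  case (3 a b x)
  have "Poly_Mapping.single {#} a * Poly_Mapping.single {#} b
      = (Poly_Mapping.single {#} (a * b) :: nat multiset \<Rightarrow>\<^sub>0 complex)"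
    by (simp add: mult_single)
  then show ?case by (simp add: ascale_def mult.assoc [symmetric])
next
  case 4 show ?case
    by (metis ascale_def fps_const_1_eq_1 mult_1 single_one zero_multiset_def)
qed

definition xi :: "nat \<Rightarrow> amb" where
  "xi n = (if n = 0 then fps_X else fps_const (Poly_Mapping.single {#n#} 1))"

text \<open>The infinite sum converges in the \<open>\<xi>\<^sub>0\<close>-adic topology, the library's topology on \<open>fps\<close>.\<close>

definition exp_xi0 :: "int \<Rightarrow> amb" where
  "exp_xi0 m = suminf (\<lambda>k. ascale (1 / fact k) (ascale (of_int m) (xi 0) ^ k))"

definition monom_Xi :: "int \<Rightarrow> nat multiset \<Rightarrow> amb" where
  "monom_Xi m N = exp_xi0 m * (\<Prod>n\<in>#N. xi n)"

definition basis_Xi :: "amb set" where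
  "basis_Xi = {monom_Xi m N |m N. 0 \<notin># N}"

definition Xi :: "amb set" where
  "Xi = amb.span basis_Xi"

definition poly_partial ::
    "nat \<Rightarrow> (nat multiset \<Rightarrow>\<^sub>0 complex) \<Rightarrow> (nat multiset \<Rightarrow>\<^sub>0 complex)" where
  "poly_partial n p =
     (\<Sum>N\<in>Poly_Mapping.keys p.
        Poly_Mapping.single (N - {#n#}) (of_nat (count N n) * Poly_Mapping.lookup p N))"

definition partial_xi :: "nat \<Rightarrow> amb \<Rightarrow> amb" where
  "partial_xi n w = (if n = 0 then fps_deriv w else Abs_fps (\<lambda>k. poly_partial n (fps_nth w k)))"


section \<open>Operator series in \<open>x\<close> and \<open>log x\<close>\<close>

text \<open>
  \<open>A i l\<close> is the coefficient of \<open>x^i (log x)^l\<close>. Products are formed by \<open>Sum_any\<close>, the sum over the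
  support, which is finite wherever it is used on \<open>\<Xi>\<close> below.
\<close>

type_synonym opser = "int \<Rightarrow> nat \<Rightarrow> amb \<Rightarrow> amb"

definition op_one :: opser where
  "op_one i l v = (if i = 0 \<and> l = 0 then v else 0)"

definition op_scale :: "complex \<Rightarrow> opser \<Rightarrow> opser" where
  "op_scale c A i l v = ascale c (A i l v)"

definition op_mult :: "opser \<Rightarrow> opser \<Rightarrow> opser" where
  "op_mult A B i l v = Sum_any (\<lambda>j. \<Sum>k\<le>l. A (i - j) (l - k) (B j k v))"

text \<open>
  \<open>d/dx\<close>, with \<open>d/dx log x = x^-1\<close>: the monomials contributing to \<open>x^i (log x)^l\<close> are
  \<open>x^(i+1) (log x)^l\<close> and \<open>x^(i+1) (log x)^(l+1)\<close>.
\<close>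

definition op_deriv :: "opser \<Rightarrow> opser" where
  "op_deriv A i l v =
     ascale (of_int (i + 1)) (A (i + 1) l v) + ascale (of_nat (l + 1)) (A (i + 1) (l + 1) v)"

text \<open>
  \<open>e^A = \<Sum>n. A^n / n!\<close>, coefficientwise. For a coefficient of \<open>e^(m h^-)\<close> the sum is infinite and
  converges \<open>\<xi>\<^sub>0\<close>-adically; for \<open>e^(m h^+)\<close> almost all terms vanish.
\<close>

definition op_exp :: "opser \<Rightarrow> opser" where
  "op_exp A i l v = suminf (\<lambda>n. ascale (1 / fact n) ((op_mult A ^^ n) op_one i l v))"

definition h_plus :: opser where
  "h_plus i l v =
     (if i = 0 \<and> l = 1 then ascale 2 (partial_xi 0 v)
      else if i < 0 \<and> l = 0 then ascale (- 2 / of_nat (nat (- i))) (partial_xi (nat (- i)) v)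
      else 0)"

definition h_minus :: opser where
  "h_minus i l v = (if i \<ge> 0 \<and> l = 0 then xi (nat i) * v else 0)"


section \<open>Normal ordering and the map \<open>\<Upsilon>\<close>\<close>

text \<open>
  A list of pairs \<open>(M, D)\<close>, where \<open>M\<close> is a series of multiplication operators and \<open>D\<close> a series of
  differential operators with constant coefficients, stands for the normally ordered sum of the
  products \<open>M D\<close>. In the normally ordered product of two such sums, the factors \<open>D\<close> of the first
  are moved to the right of the factors \<open>M'\<close> of the second.
\<close>

type_synonym nord = "(opser \<times> opser) list"

definition nord_op :: "nord \<Rightarrow> opser" where
  "nord_op A i l v = (\<Sum>(M, D)\<leftarrow>A. op_mult M D i l v)"

definition nord_mult :: "nord \<Rightarrow> nord \<Rightarrow> nord" where
  "nord_mult A B = [(op_mult M M', op_mult D D'). (M, D) \<leftarrow> A, (M', D') \<leftarrow> B]"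

text \<open>\<open>h^(n)(x) / n!\<close>, where \<open>h = h^- + h^+\<close>\<close>

definition nord_h :: "nat \<Rightarrow> nord" where
  "nord_h n =
     [(op_scale (1 / fact n) ((op_deriv ^^ n) h_minus), op_one),
      (op_one, op_scale (1 / fact n) ((op_deriv ^^ n) h_plus))]"

text \<open>\<open>:e^(m h(x)): = e^(m h^-(x)) e^(m h^+(x))\<close>\<close>

definition nord_exp :: "int \<Rightarrow> nord" where
  "nord_exp m = [(op_exp (op_scale (of_int m) h_minus), op_exp (op_scale (of_int m) h_plus))]"

text \<open>
  \<open>\<Upsilon>(e^(m \<xi>\<^sub>0) \<Prod>n\<in>N. \<xi>\<^sub>n, x)\<close>. Since factors commute under the normal ordering, the order in which the
  elements of \<open>N\<close> are listed is irrelevant.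
\<close>

definition Upsilon_monom :: "int \<Rightarrow> nat multiset \<Rightarrow> opser" where
  "Upsilon_monom m N =
     nord_op (foldr nord_mult (map nord_h (sorted_list_of_multiset N)) (nord_exp m))"

text \<open>
  Linear extension from the basis \<open>basis_Xi\<close>: \<open>amb.representation basis_Xi p b\<close> is the coefficient
  of the basis vector \<open>b\<close> in \<open>p\<close>.
\<close>

definition Upsilon :: "amb \<Rightarrow> opser" where
  "Upsilon p i l v =
     (\<Sum>(m, N) | 0 \<notin># N \<and> amb.representation basis_Xi p (monom_Xi m N) \<noteq> 0.
        ascale (amb.representation basis_Xi p (monom_Xi m N)) (Upsilon_monom m N i l v))"


section \<open>The map \<open>\<phi>\<^sub>x\<close>\<close>

text \<open>
  A family \<open>f\<close> of vectors, \<open>f n i\<close> being the coefficient of \<open>x^i\<close> in \<open>f\<^sub>n(x)\<close>, is mapped to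
  \<open>\<Sum>n. f\<^sub>n(x) e^(n log x)\<close>, where \<open>e^(n log x)\<close> is the power series \<open>\<Sum>l. n^l (log x)^l / l!\<close>.
\<close>

definition log_exp_sum :: "(int \<Rightarrow> int \<Rightarrow> amb) \<Rightarrow> int \<Rightarrow> nat \<Rightarrow> amb" where
  "log_exp_sum f i l = (\<Sum>n | f n \<noteq> (\<lambda>_. 0). ascale (of_int n ^ l / fact l) (f n i))"

text \<open>
  The power series \<open>e^(n log x)\<close> for distinct \<open>n\<close> are linearly independent, so the family \<open>f\<close> is
  determined by the series.
\<close>

definition phi_x :: "(int \<Rightarrow> nat \<Rightarrow> amb) \<Rightarrow> int \<Rightarrow> amb" where
  "phi_x g =
     (let f = (THE f. finite {n. f n \<noteq> (\<lambda>_. 0)} \<and> log_exp_sum f = g)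
      in (\<lambda>i. \<Sum>n | f n \<noteq> (\<lambda>_. 0). f n (i - n)))"

definition Y_Xi :: "amb \<Rightarrow> int \<Rightarrow> amb \<Rightarrow> amb" where
  "Y_Xi u i v = phi_x (\<lambda>j l. Upsilon u j l v) i"

end

theory Submission
  imports Defs "HOL-Computational_Algebra.Formal_Laurent_Series"
begin

text \<open>
  Write \<open>h\<^sub>n = h^(n)/n! = h\<^sub>n^- + h\<^sub>n^+\<close>. The definition of \<open>\<Upsilon>\<close> amounts to the recursion
  \<open>Y(\<xi>\<^sub>n u,x) = h\<^sub>n^-(x) Y(u,x) + Y(u,x) h\<^sub>n^+(x)\<close> for \<open>n \<ge> 1\<close>, together with the action of \<open>Y(e^(m \<xi>\<^sub>0),x)\<close>,
  which commutes with multiplication by \<open>\<xi>\<^sub>k\<close> up to adding the scalar \<open>-2m x^(-k)/k\<close>. By induction one gets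
  the commutators of \<open>Y(v,y)\<close> with \<open>\<xi>\<^sub>m\<close> and with \<open>\<partial>/\<partial>\<xi>\<^sub>k\<close>. Hence each of \<open>Y(u,x)Y(v,y)w\<close>, \<open>Y(v,y)Y(u,x)w\<close> and
  \<open>Y(Y(u,z)v,y)w\<close> with one argument multiplied by some \<open>\<xi>\<^sub>n\<close> is a combination of the same expressions for simpler
  arguments, and the three coefficients are the expansions, in the three domains of the Jacobi
  identity, of one function of \<open>x\<close> and \<open>y\<close>: a Laurent series in \<open>x\<close>, one in \<open>y\<close>, or a power of
  \<open>x - y\<close>. The Jacobi identity is preserved by multiplication with such functions. This reduces it
  to \<open>u = e^(m \<xi>\<^sub>0)\<close>, \<open>v = e^(q \<xi>\<^sub>0)\<close>, \<open>w = e^(r \<xi>\<^sub>0)\<close>, where a linear differential equation shows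
  that the three expressions are the expansions of
  \<open>e^(m h^-(x)) e^(q h^-(y)) x^(2mr) y^(2qr) (x-y)^(2mq) e^(r \<xi>\<^sub>0)\<close>, and thus to the identity between
  the three delta functions themselves.
\<close>

text \<open>Every scalar function in the proof comes from one contraction. Applied to h^-(y), the
  operator h^+(x) gives 2 log x - 2 (y/x) - 2 (y/x)^2/2 - ..., the expansion of 2 log (x - y). Its
  derivatives of order n in x and j in y, divided by n! j!, are \<open>h_coeff n j\<close> times (x
  - y)^(-n-j), and its exponential yields the factor (x - y)^(2mq). The exponent is even, so (x -
  y)^(2mq) = (y - x)^(2mq) and no sign has to be corrected. The obstacle is that the three
  expressions lie in three different rings of iterated Laurent series and can never be equated with
  one another. Only a relation between the members of a triple can be carried through an induction.
  Sums over all d/dxi_k are infinite as operators and finite only on a given vector, whence the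
  bounds \<open>K\<close> in the statements. The logarithm disappears on eigenvectors of d/dxi_0:
  there log x occurs only in e^(2mq log x), and phi_x becomes the shift by x^(2mq).\<close>

notation fls_nth (infixl "$$" 75)

section \<open>Laurent series\<close>

text \<open>Any finite set containing the support may replace the interval given by the subdegrees.
  This freedom lets several products share one index set, so that their coefficients can be compared
  termwise.\<close>

lemma fls_times_nth_sum:
  fixes f g :: "'a::comm_ring_1 fls"
  assumes "finite S" "\<And>m. f $$ m \<noteq> 0 \<Longrightarrow> g $$ (n - m) \<noteq> 0 \<Longrightarrow> m \<in> S"
  shows "(f * g) $$ n = (\<Sum>m\<in>S. f $$ m * g $$ (n - m))"
proof -
  let ?I = "{fls_subdegree f..n - fls_subdegree g}"
  have "(f * g) $$ n = (\<Sum>m\<in>?I. f $$ m * g $$ (n - m))"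
    by (rule fls_times_nth(2))
  also have "\<dots> = (\<Sum>m\<in>?I \<inter> S. f $$ m * g $$ (n - m))"
    using assms(2) by (intro sum.mono_neutral_right) force+
  also have "\<dots> = (\<Sum>m\<in>S. f $$ m * g $$ (n - m))"
  proof (rule sum.mono_neutral_left)
    show "\<forall>m\<in>S - ?I \<inter> S. f $$ m * g $$ (n - m) = 0"
    proof
      fix m assume "m \<in> S - ?I \<inter> S"
      hence "m < fls_subdegree f \<or> n - m < fls_subdegree g" by auto
      thus "f $$ m * g $$ (n - m) = 0" by auto
    qed
  qed (use assms in auto)
  finally show ?thesis .
qed

text \<open>Suited to expansions in nonnegative powers of the outer variable: \<open>T\<close> is
  any index from which the second factor no longer contributes.\<close>

lemma fls_times_nth_nat:
  fixes f g :: "'a::comm_ring_1 fls"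
  assumes "\<And>m. m < 0 \<Longrightarrow> f $$ m = 0" "\<And>u. u \<ge> T \<Longrightarrow> g $$ (n - int u) = 0"
  shows "(f * g) $$ n = (\<Sum>u<T. f $$ int u * g $$ (n - int u))"
proof -
  have "(f * g) $$ n = (\<Sum>m\<in>int ` {..<T}. f $$ m * g $$ (n - m))"
  proof (rule fls_times_nth_sum)
    fix m assume "f $$ m \<noteq> 0" "g $$ (n - m) \<noteq> 0"
    hence "m \<ge> 0" using assms(1)[of m] by force
    moreover have "nat m < T"
    proof (rule ccontr)
      assume "\<not> nat m < T"
      with assms(2)[of "nat m"] \<open>m \<ge> 0\<close> \<open>g $$ (n - m) \<noteq> 0\<close> show False by simp
    qed
    ultimately show "m \<in> int ` {..<T}" by (intro image_eqI[of _ _ "nat m"]) auto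
  qed auto
  also have "\<dots> = (\<Sum>u<T. f $$ int u * g $$ (n - int u))"
    by (subst sum.reindex) auto
  finally show ?thesis .
qed

lemma fls_times_nth_atMost:
  fixes f g :: "'a::comm_ring_1 fls"
  assumes "\<And>m. m < 0 \<Longrightarrow> f $$ m = 0" "\<And>m. m < 0 \<Longrightarrow> g $$ m = 0"
  shows "(f * g) $$ int t = (\<Sum>u\<le>t. f $$ int u * g $$ int (t - u))"
  using fls_times_nth_nat[of f "Suc t" g "int t"] assms
  by (simp add: lessThan_Suc_atMost of_nat_diff)

lemma fls_times_nth_eq_0:
  fixes f g :: "'a::comm_ring_1 fls"
  assumes "\<And>m. m < M \<Longrightarrow> f $$ m = 0" "\<And>m. m < N \<Longrightarrow> g $$ m = 0" "n < M + N"
  shows "(f * g) $$ n = 0"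
proof -
  have "m \<in> {}" if "f $$ m \<noteq> 0" "g $$ (n - m) \<noteq> 0" for m
    using assms(1)[of m] assms(2)[of "n - m"] assms(3) that by force
  from fls_times_nth_sum[of "{}" f g n, OF _ this] show ?thesis by simp
qed

lemma fls_sum_nth: "(\<Sum>a\<in>A. f a) $$ n = (\<Sum>a\<in>A. f a $$ n)"
  for f :: "'b \<Rightarrow> 'a::comm_monoid_add fls"
  by (induction A rule: infinite_finite_induct) auto

lemma fls_const_sum: "fls_const (\<Sum>a\<in>A. f a) = (\<Sum>a\<in>A. fls_const (f a))"
  for f :: "'b \<Rightarrow> 'a::comm_ring_1"
  by (rule fls_eqI) (auto simp: fls_sum_nth)

section \<open>Iterated Laurent series\<close>

definition fls2 :: "(int \<Rightarrow> int \<Rightarrow> 'a::zero) \<Rightarrow> 'a fls fls" where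
  "fls2 f = Abs_fls (\<lambda>t. Abs_fls (f t))"

text \<open>The outer exponents are bounded below uniformly, the inner ones only for each fixed
  outer exponent. This asymmetry is why the two expansions of (x - y)^(-1) belong to different
  rings.\<close>

lemma fls2_nth:
  assumes "\<And>t i. t < N \<Longrightarrow> f t i = 0" "\<And>t. \<exists>M. \<forall>i<M. f t i = 0"
  shows "fls2 f $$ t $$ i = f t i"
proof -
  have "Abs_fls (f t) = 0" if "t < N" for t
  proof -
    have "f t = (\<lambda>_. 0)" using assms(1)[OF that] by auto
    thus ?thesis by (simp add: zero_fls_def)
  qed
  hence "fls2 f $$ t = Abs_fls (f t)"
    unfolding fls2_def by (intro nth_Abs_fls_ex_lower_bound) auto
  thus ?thesis using assms(2)[of t] by (simp add: nth_Abs_fls_ex_lower_bound)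
qed

text \<open>
  In an iterated Laurent series, \<open>fls_outer f\<close> is \<open>f\<close> in the outer variable and \<open>fls_const f\<close> is \<open>f\<close> in
  the inner variable.
\<close>

definition fls_outer :: "'a::comm_ring_1 fls \<Rightarrow> 'a fls fls" where
  "fls_outer f = Abs_fls (\<lambda>n. fls_const (f $$ n))"

lemma fls_outer_nth [simp]: "fls_outer f $$ n = fls_const (f $$ n)"
  unfolding fls_outer_def
proof (rule nth_Abs_fls_ex_lower_bound)
  obtain N where "\<forall>n<N. f $$ n = 0" by (rule fls_nth_vanishes_belowE)
  thus "\<exists>N. \<forall>n<N. fls_const (f $$ n) = 0" by auto
qed

lemma fls_outer_const [simp]: "fls_outer (fls_const c) = fls_const (fls_const c)"
  by (rule fls_eqI) auto

lemma fls_outer_mult: "fls_outer (f * g) = fls_outer f * fls_outer g"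
proof (rule fls_eqI)
  fix n
  let ?S = "{fls_subdegree f..n - fls_subdegree g}"
  have *: "m \<in> ?S" if "f $$ m \<noteq> 0" "g $$ (n - m) \<noteq> 0" for m
    using that fls_subdegree_leI[of f m] fls_subdegree_leI[of g "n - m"] by simp
  have "(f * g) $$ n = (\<Sum>m\<in>?S. f $$ m * g $$ (n - m))"
    by (rule fls_times_nth_sum[OF _ *]) auto
  moreover have "(fls_outer f * fls_outer g) $$ n =
      (\<Sum>m\<in>?S. fls_outer f $$ m * fls_outer g $$ (n - m))"
    by (rule fls_times_nth_sum) (use * in auto)
  ultimately show "fls_outer (f * g) $$ n = (fls_outer f * fls_outer g) $$ n"
    by (simp add: fls_const_sum)
qed

definition fls_Xp :: "int \<Rightarrow> 'a::comm_ring_1 fls" where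
  "fls_Xp r = fls_X_intpow r"

lemma fls_Xp_nth [simp]: "fls_Xp r $$ n = (if n = r then 1 else 0)"
  by (auto simp: fls_Xp_def)

lemma fls_Xp_times_nth [simp]: "(fls_Xp r * f) $$ n = f $$ (n - r)"
  by (simp add: fls_Xp_def fls_X_intpow_times_conv_shift)

lemma fls_times_Xp_nth [simp]: "(f * fls_Xp r) $$ n = f $$ (n - r)"
  by (simp add: fls_Xp_def fls_X_intpow_times_conv_shift)

lemma fls_Xp_0 [simp]: "fls_Xp 0 = 1"
  by (simp add: fls_Xp_def)

lemma fls_Xp_add: "fls_Xp (r + r') = fls_Xp r * fls_Xp r'"
  by (rule fls_eqI) auto

lemma fls_outer_Xp_times_nth [simp]: "(fls_outer (fls_Xp r) * F) $$ n = F $$ (n - r)"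
proof -
  have "fls_outer (fls_Xp r) = (fls_Xp r :: 'a fls fls)"
    by (rule fls_eqI) auto
  thus ?thesis by simp
qed

section \<open>Binomial series and the Jacobi identity for formal series\<close>

text \<open>The identity of the three delta functions, coefficient by coefficient. For c >= 0 the
  power of x - y is negative, and its two expansions differ by the right-hand side. For c < 0 the
  power is a polynomial, so the two expansions agree, while the right-hand side has no negative
  powers of z.\<close>

lemma binpow_delta_identity:
  assumes "a + b = -c - 1"
  shows "binpow (-1) (-c-1) a b - (-1) powi (-c-1) * binpow (-1) (-c-1) b a = binpow 1 (-a-1) b c"
proof (cases "c \<ge> 0")
  case c: True
  then obtain k where k: "c = int k" by (metis nonneg_int_cases)
  have sgn: "(-1) powi (- int k - 1) = - ((-1) ^ k :: complex)"
    by (cases "even k") (auto simp: power_int_def nat_add_distrib)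
  \<comment> \<open>Upper negation: the coefficients of (1 - q)^(-k-1) are the binomials m + k over
    k.\<close>
  have neg: "((- of_nat k - 1 :: complex) gchoose m) * (-1) ^ m = of_nat ((m + k) choose k)" for m
  proof -
    have "((- of_nat k - 1 :: complex) gchoose m) = (-1) ^ m * (of_nat (m + k) gchoose m)"
      by (subst gbinomial_negated_upper) (simp add: algebra_simps)
    moreover have "(of_nat (m + k) gchoose m) = (of_nat ((m + k) choose k) :: complex)"
      by (metis add_diff_cancel_left' binomial_gbinomial binomial_symmetric le_add1)
    ultimately show ?thesis
      by (simp add: mult_ac flip: power_mult_distrib)
  qed
  \<comment> \<open>For a negative power of x - y the first expansion has only terms with b >= 0,
    the second only terms with a >= 0, and a + b < 0 excludes both at once.\<close>
  consider "b \<ge> 0" | "b < 0" "a \<ge> 0" | "b < 0" "a < 0" by linarith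
  thus ?thesis
  proof cases
    case 1
    then obtain m where m: "b = int m" by (metis nonneg_int_cases)
    have a: "a = - int m - int k - 1" using assms by (simp add: k m)
    have "(of_nat m + of_nat k :: complex) gchoose k = of_nat ((m + k) choose k)"
      by (simp add: binomial_gbinomial)
    thus ?thesis using neg[of m] by (simp add: binpow_def k m a)
  next
    case 2
    then obtain m where m: "a = int m" by (metis nonneg_int_cases)
    have b: "b = - int m - int k - 1" using assms by (simp add: k m)
    have "(- of_nat m - 1 :: complex) gchoose k = (-1) ^ k * of_nat ((m + k) choose k)"
      by (subst gbinomial_negated_upper) (simp add: binomial_gbinomial algebra_simps)
    thus ?thesis using neg[of m] 2 by (simp add: binpow_def k m b sgn)
  next
    case 3
    \<comment> \<open>The left-hand side has no such term. On the right the upper entry -a-1 = b + c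
      is a natural number below c, so its binomial vanishes.\<close>
    have "(of_int (-a-1) :: complex) gchoose k = of_nat (nat (-a-1) choose k)"
      using 3 by (simp add: binomial_gbinomial)
    moreover have "nat (-a-1) < k" using 3 assms k by linarith
    ultimately show ?thesis using 3 by (simp add: binpow_def k)
  qed
next
  case False
  define n where "n = nat (-c-1)"
  have n: "-c-1 = int n" using False by (simp add: n_def)
  have z: "(of_nat n :: complex) gchoose m = 0" if "m > n" for m
    using that by (simp flip: binomial_gbinomial)
  \<comment> \<open>In a polynomial of degree n a negative exponent forces the other one above n,
    where the binomial is zero; only the last case has nonzero terms.\<close>
  consider "a < 0" "b < 0" | "a < 0" "b \<ge> 0" | "a \<ge> 0" "b < 0" | "a \<ge> 0" "b \<ge> 0" by linarith
  thus ?thesis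
  proof cases
    case 4
    then obtain i j where ij: "a = int i" "b = int j" by (metis nonneg_int_cases)
    have "n = i + j" using assms n ij by simp
    moreover have "((i + j) choose i) = ((i + j) choose j)"
      by (metis binomial_symmetric diff_add_inverse le_add1)
    moreover have "(-1) ^ (i + j) * (-1) ^ i = ((-1) ^ j :: complex)"
      by (simp add: power_add mult_ac flip: power_mult_distrib)
    ultimately show ?thesis using False
      unfolding n by (auto simp: binpow_def ij binomial_gbinomial [symmetric] mult_ac simp flip: of_nat_add)
  qed (use False assms n in \<open>auto simp: binpow_def intro!: z\<close>)
qed

text \<open>The structure map of a commutative algebra over the complex numbers is all that the
  formal calculus below has to know of its coefficient ring.\<close>

locale complex_algebra =
  fixes emb :: "complex \<Rightarrow> 'a::comm_ring_1"
  assumes emb_add: "emb (c + d) = emb c + emb d"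
    and emb_mult: "emb (c * d) = emb c * emb d"
    and emb_1 [simp]: "emb 1 = 1"
begin

lemma emb_0 [simp]: "emb 0 = 0"
  using emb_add[of 0 0] by simp

lemma emb_minus: "emb (- c) = - emb c"
  using emb_add[of c "- c"] by (simp add: eq_neg_iff_add_eq_0 add.commute)

lemma emb_diff: "emb (c - d) = emb c - emb d"
  using emb_add[of c "- d"] by (simp add: emb_minus)

lemma emb_sum: "emb (\<Sum>a\<in>A. f a) = (\<Sum>a\<in>A. emb (f a))"
  by (induction A rule: infinite_finite_induct) (auto simp: emb_add)

lemma emb_of_nat: "emb (of_nat n) = of_nat n"
  by (induction n) (auto simp: emb_add)

lemma emb_of_int: "emb (of_int n) = of_int n"
  by (cases n rule: int_cases2) (auto simp: emb_minus emb_of_nat)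

text \<open>This is (p + s q)^r with p the inner and q the outer variable.\<close>

definition binser :: "complex \<Rightarrow> int \<Rightarrow> 'a fls fls" where
  "binser s r = fls2 (\<lambda>t i. emb (binpow s r i t))"

lemma binser_nth: "binser s r $$ t $$ i = emb (binpow s r i t)"
  unfolding binser_def
  by (rule fls2_nth[of 0]) (auto simp: binpow_def intro!: exI[of _ "r - _"])

lemma binser_nth_neg: "t < 0 \<Longrightarrow> binser s r $$ t = 0"
  by (rule fls_eqI) (simp add: binser_nth binpow_def)

lemma binser_nth_nat:
  "binser s r $$ int t = fls_const (emb ((of_int r gchoose t) * s ^ t)) * fls_Xp (r - int t)"
  by (rule fls_eqI) (auto simp: binser_nth binpow_def)

lemma binser_0 [simp]: "binser s 0 = 1"
proof (rule fls_eqI, rule fls_eqI)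
  fix t i :: int
  show "binser s 0 $$ t $$ i = 1 $$ t $$ i"
    by (cases "nat t") (auto simp: binser_nth binpow_def gbinomial_0)
qed

text \<open>Vandermonde's identity for binomials with arbitrary integer upper entry. It makes all
  powers invertible, so that a factor (x - y)^r can be absorbed into a delta function.\<close>

lemma binser_add: "binser s (r + r') = binser s r * binser s r'"
proof (rule fls_eqI)
  fix t :: int
  show "binser s (r + r') $$ t = (binser s r * binser s r') $$ t"
  proof (cases "t < 0")
    case True
    have "(binser s r * binser s r') $$ t = 0"
      by (rule fls_times_nth_eq_0[of 0 _ 0]) (use True in \<open>auto simp: binser_nth_neg\<close>)
    with True show ?thesis by (simp add: binser_nth_neg)
  next
    case False
    then obtain k where k: "t = int k" by (metis nonneg_int_cases not_less)
    have "(binser s r * binser s r') $$ t =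
        (\<Sum>u\<le>k. binser s r $$ int u * binser s r' $$ int (k - u))"
      unfolding k by (rule fls_times_nth_atMost) (auto simp: binser_nth_neg)
    also have "\<dots> = (\<Sum>u\<le>k. fls_const (emb ((of_int r gchoose u) * (of_int r' gchoose (k - u)) * s ^ k))
        * fls_Xp (r + r' - int k))"
    proof (rule sum.cong)
      fix u assume u: "u \<in> {..k}"
      hence "fls_Xp (r + r' - int k) =
          (fls_Xp (r - int u) * fls_Xp (r' - int (k - u)) :: 'a fls)"
        by (subst fls_Xp_add [symmetric]) (simp add: of_nat_diff algebra_simps)
      moreover have "s ^ k = s ^ u * s ^ (k - u)" using u by (simp flip: power_add)
      ultimately show "binser s r $$ int u * binser s r' $$ int (k - u) =
          fls_const (emb ((of_int r gchoose u) * (of_int r' gchoose (k - u)) * s ^ k))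
          * fls_Xp (r + r' - int k)"
        by (simp add: binser_nth_nat emb_mult mult_ac flip: fls_const_mult_const)
    qed simp
    also have "\<dots> = fls_const (emb ((\<Sum>u\<le>k. (of_int r gchoose u) * (of_int r' gchoose (k - u))) * s ^ k))
        * fls_Xp (r + r' - int k)"
      by (simp add: sum_distrib_right emb_sum fls_const_sum)
    also have "(\<Sum>u\<le>k. (of_int r gchoose u) * (of_int r' gchoose (k - u))) =
        (of_int (r + r') gchoose k :: complex)"
      using gbinomial_Vandermonde[of "of_int r" "of_int r'" k] by (simp add: atMost_atLeast0)
    finally show ?thesis by (simp add: k binser_nth_nat)
  qed
qed

text \<open>The substitution of \<open>y + z\<close> for \<open>x\<close>, expanded in nonnegative powers of \<open>z\<close>.\<close>

definition fls_sub :: "'a fls \<Rightarrow> 'a fls fls" where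
  "fls_sub f = fls2 (\<lambda>t i. if t \<ge> 0 then emb (of_int (i + t) gchoose nat t) * f $$ (i + t) else 0)"

lemma fls_sub_nth:
  "fls_sub f $$ t $$ i = (if t \<ge> 0 then emb (of_int (i + t) gchoose nat t) * f $$ (i + t) else 0)"
  unfolding fls_sub_def
proof (rule fls2_nth[of 0])
  fix t :: int
  obtain N where N: "\<forall>n<N. f $$ n = 0" by (rule fls_nth_vanishes_belowE)
  show "\<exists>M. \<forall>i<M. (if t \<ge> 0 then emb (of_int (i + t) gchoose nat t) * f $$ (i + t) else 0) = 0"
    by (rule exI[of _ "N - t"]) (use N in auto)
qed auto

lemma fls_sub_nth_neg: "t < 0 \<Longrightarrow> fls_sub f $$ t = 0"
  by (rule fls_eqI) (simp add: fls_sub_nth)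

lemma fls_sub_Xp: "fls_sub (fls_Xp r) = binser 1 r"
  by (rule fls_eqI, rule fls_eqI) (auto simp: fls_sub_nth binser_nth binpow_def)

text \<open>For monomials this is (y + z)^(a+b) = (y + z)^a (y + z)^b, hence Vandermonde's identity
  again; for series the sum over the exponents a of f has to be moved outside.\<close>

lemma fls_sub_mult: "fls_sub (f * g) = fls_sub f * fls_sub g"
proof (rule fls_eqI)
  fix t :: int
  show "fls_sub (f * g) $$ t = (fls_sub f * fls_sub g) $$ t"
  proof (cases "t < 0")
    case True
    have "(fls_sub f * fls_sub g) $$ t = 0"
      by (rule fls_times_nth_eq_0[of 0 _ 0]) (use True in \<open>auto simp: fls_sub_nth_neg\<close>)
    with True show ?thesis by (simp add: fls_sub_nth_neg)
  next
    case False
    then obtain k where k: "t = int k" by (metis nonneg_int_cases not_less)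
    have "(fls_sub f * fls_sub g) $$ int k = (\<Sum>s\<le>k. fls_sub f $$ int s * fls_sub g $$ int (k - s))"
      by (rule fls_times_nth_atMost) (auto simp: fls_sub_nth_neg)
    also have "\<dots> = fls_sub (f * g) $$ int k"
    proof (rule fls_eqI)
      fix i
      \<comment> \<open>\<open>S\<close> is independent of the power s of z taken from the first
        factor, which permits the interchange of the sums over s and a.\<close>
      define S where "S = {fls_subdegree f..i + int k - fls_subdegree g}"
      have S: "a \<in> S" if "f $$ a \<noteq> 0" "g $$ (i + int k - a) \<noteq> 0" for a
        using fls_subdegree_leI[OF that(1)] fls_subdegree_leI[OF that(2)] by (simp add: S_def)
      have "(fls_sub f $$ int s * fls_sub g $$ int (k - s)) $$ i =
          (\<Sum>a\<in>S. emb ((of_int a gchoose s) * (of_int (i + int k - a) gchoose (k - s))) * (f $$ a * g $$ (i + int k - a)))"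
        if s: "s \<le> k" for s
      proof -
        have "(fls_sub f $$ int s * fls_sub g $$ int (k - s)) $$ i =
            (\<Sum>b\<in>(\<lambda>a. a - int s) ` S. fls_sub f $$ int s $$ b * fls_sub g $$ int (k - s) $$ (i - b))"
        proof (rule fls_times_nth_sum)
          fix b assume "fls_sub f $$ int s $$ b \<noteq> 0" "fls_sub g $$ int (k - s) $$ (i - b) \<noteq> 0"
          hence "f $$ (b + int s) \<noteq> 0" "g $$ (i + int k - (b + int s)) \<noteq> 0"
            using s by (auto simp: fls_sub_nth of_nat_diff algebra_simps)
          hence "b + int s \<in> S" by (rule S)
          thus "b \<in> (\<lambda>a. a - int s) ` S" by (intro image_eqI[of _ _ "b + int s"]) auto
        qed (simp add: S_def)
        also have "\<dots> = (\<Sum>a\<in>S. fls_sub f $$ int s $$ (a - int s) * fls_sub g $$ int (k - s) $$ (i - (a - int s)))"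
          by (subst sum.reindex) (auto intro!: inj_onI)
        also have "\<dots> = (\<Sum>a\<in>S. emb ((of_int a gchoose s) * (of_int (i + int k - a) gchoose (k - s))) * (f $$ a * g $$ (i + int k - a)))"
        proof (rule sum.cong)
          fix a
          have e: "i - (a - int s) + int (k - s) = i + int k - a" using s by simp
          show "fls_sub f $$ int s $$ (a - int s) * fls_sub g $$ int (k - s) $$ (i - (a - int s)) =
            emb ((of_int a gchoose s) * (of_int (i + int k - a) gchoose (k - s))) * (f $$ a * g $$ (i + int k - a))"
            unfolding fls_sub_nth e by (simp add: emb_mult mult_ac del: of_nat_diff of_int_diff of_int_add)
        qed simp
        finally show ?thesis .
      qed
      hence "(\<Sum>s\<le>k. fls_sub f $$ int s * fls_sub g $$ int (k - s)) $$ i =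
          (\<Sum>s\<le>k. \<Sum>a\<in>S. emb ((of_int a gchoose s) * (of_int (i + int k - a) gchoose (k - s))) * (f $$ a * g $$ (i + int k - a)))"
        by (simp add: fls_sum_nth)
      also have "\<dots> = (\<Sum>a\<in>S. emb (\<Sum>s\<le>k. (of_int a gchoose s) * (of_int (i + int k - a) gchoose (k - s))) * (f $$ a * g $$ (i + int k - a)))"
        by (subst sum.swap) (simp add: emb_sum sum_distrib_right)
      also have "\<dots> = (\<Sum>a\<in>S. emb (of_int (i + int k) gchoose k) * (f $$ a * g $$ (i + int k - a)))"
      proof (rule sum.cong)
        fix a
        have "(\<Sum>s\<le>k. (of_int a gchoose s) * (of_int (i + int k - a) gchoose (k - s))) = (of_int (i + int k) gchoose k :: complex)"
          using gbinomial_Vandermonde[of "of_int a" "of_int (i + int k - a)" k] by (simp add: atMost_atLeast0)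
        thus "emb (\<Sum>s\<le>k. (of_int a gchoose s) * (of_int (i + int k - a) gchoose (k - s))) * (f $$ a * g $$ (i + int k - a)) =
            emb (of_int (i + int k) gchoose k) * (f $$ a * g $$ (i + int k - a))"
          by (simp only:)
      qed simp
      also have "\<dots> = emb (of_int (i + int k) gchoose k) * (f * g) $$ (i + int k)"
        using fls_times_nth_sum[of S f g "i + int k"] S by (simp add: sum_distrib_left S_def)
      finally show "(\<Sum>s\<le>k. fls_sub f $$ int s * fls_sub g $$ int (k - s)) $$ i = fls_sub (f * g) $$ int k $$ i"
        by (simp add: fls_sub_nth)
    qed
    finally show ?thesis by (simp add: k)
  qed
qed

lemma binser_times_fls_sub: "binser 1 r * fls_sub f = fls_sub (fls_Xp r * f)"
  by (simp add: fls_sub_mult fls_sub_Xp)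

text \<open>
  \<open>jacobi_triple A B C\<close> is the Jacobi identity with \<open>Y(u,x)Y(v,y)w\<close>, \<open>Y(v,y)Y(u,x)w\<close> and \<open>Y(Y(u,z)v,y)w\<close>
  replaced by \<open>A\<close>, \<open>B\<close> and \<open>C\<close>. The inner and the outer variable of the iterated Laurent series are
  \<open>x\<close> and \<open>y\<close> for \<open>A\<close>, \<open>y\<close> and \<open>x\<close> for \<open>B\<close>, \<open>y\<close> and \<open>z\<close> for \<open>C\<close>. Thus \<open>(x - y)^r\<close> is represented by
  \<open>binser (-1) r\<close>, \<open>(-1)^r binser (-1) r\<close> and \<open>z^r\<close>.
\<close>

definition sgn_pow :: "int \<Rightarrow> 'a fls fls" where
  "sgn_pow r = fls_const (fls_const (emb ((-1) powi r)))"

lemma sgn_pow_add: "sgn_pow (r + r') = sgn_pow r * sgn_pow r'"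
  by (simp add: sgn_pow_def power_int_add emb_mult)

definition jacobi_triple :: "'a fls fls \<Rightarrow> 'a fls fls \<Rightarrow> 'a fls fls \<Rightarrow> bool" where
  "jacobi_triple A B C \<longleftrightarrow> (\<forall>a b c.
     (binser (-1) (-c-1) * A) $$ b $$ a - (sgn_pow (-c-1) * (binser (-1) (-c-1) * B)) $$ a $$ b
     = (binser 1 (-a-1) * C) $$ c $$ b)"

lemma jacobi_triple_0 [simp]: "jacobi_triple 0 0 0"
  by (simp add: jacobi_triple_def)

lemma jacobi_triple_add:
  "jacobi_triple A B C \<Longrightarrow> jacobi_triple A' B' C' \<Longrightarrow> jacobi_triple (A + A') (B + B') (C + C')"
  unfolding jacobi_triple_def by (simp add: distrib_left add_diff_add)

lemma jacobi_triple_sum: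
  "(\<And>k. k \<in> S \<Longrightarrow> jacobi_triple (A k) (B k) (C k)) \<Longrightarrow>
    jacobi_triple (\<Sum>k\<in>S. A k) (\<Sum>k\<in>S. B k) (\<Sum>k\<in>S. C k)"
  by (induction S rule: infinite_finite_induct) (auto intro: jacobi_triple_add)

text \<open>A factor (x - y)^r changes the exponent -c-1 in the two delta functions on the left to
  -(c-r)-1, and z^r shifts c to c - r on the right: the new identity at c is the old one at c -
  r.\<close>

lemma jacobi_triple_xy:
  assumes "jacobi_triple A B C"
  shows "jacobi_triple (binser (-1) r * A) (sgn_pow r * binser (-1) r * B) (fls_Xp r * C)"
  unfolding jacobi_triple_def
proof (intro allI)
  fix a b c
  have *: "binser (-1) (-c-1) * binser (-1) r = binser (-1) (-(c-r)-1)"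
    "sgn_pow (-c-1) * sgn_pow r = sgn_pow (-(c-r)-1)"
    by (simp_all flip: binser_add sgn_pow_add add: algebra_simps)
  have "binser (-1) (-c-1) * (binser (-1) r * A) = binser (-1) (-(c-r)-1) * A"
    by (simp only: mult.assoc [symmetric] *)
  moreover have "sgn_pow (-c-1) * (binser (-1) (-c-1) * (sgn_pow r * binser (-1) r * B)) =
      sgn_pow (-(c-r)-1) * (binser (-1) (-(c-r)-1) * B)"
    unfolding * [symmetric] by (simp only: mult_ac)
  moreover have "(binser 1 (-a-1) * (fls_Xp r * C)) $$ c $$ b = (binser 1 (-a-1) * C) $$ (c - r) $$ b"
    by (simp add: mult.left_commute[of _ "fls_Xp r"])
  ultimately show "(binser (-1) (-c-1) * (binser (-1) r * A)) $$ b $$ a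
      - (sgn_pow (-c-1) * (binser (-1) (-c-1) * (sgn_pow r * binser (-1) r * B))) $$ a $$ b
     = (binser 1 (-a-1) * (fls_Xp r * C)) $$ c $$ b"
    using assms unfolding jacobi_triple_def by (simp only:)
qed

lemma fls_const_times_nth_sum:
  fixes F :: "'a fls fls"
  assumes "finite S" "\<And>m. f $$ m \<noteq> 0 \<Longrightarrow> F $$ n $$ (k - m) \<noteq> 0 \<Longrightarrow> m \<in> S"
  shows "(fls_const f * F) $$ n $$ k = (\<Sum>m\<in>S. f $$ m * F $$ n $$ (k - m))"
  using fls_times_nth_sum[OF assms] by simp

lemma fls_outer_times_nth_sum:
  fixes F :: "'a fls fls"
  assumes "finite S" "\<And>m. f $$ m \<noteq> 0 \<Longrightarrow> F $$ (n - m) \<noteq> 0 \<Longrightarrow> m \<in> S"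
  shows "(fls_outer f * F) $$ n $$ k = (\<Sum>m\<in>S. f $$ m * F $$ (n - m) $$ k)"
proof -
  have "(fls_outer f * F) $$ n = (\<Sum>m\<in>S. fls_const (f $$ m) * F $$ (n - m))"
    using fls_times_nth_sum[of S "fls_outer f" F n] assms by simp
  thus ?thesis by (simp add: fls_sum_nth)
qed

text \<open>The variable y is present in all three rings, as outer variable in the first and as
  inner variable in the other two. Multiplication by a series in y combines finitely many instances
  of the identity with shifted b.\<close>

lemma jacobi_triple_y:
  assumes "jacobi_triple A B C"
  shows "jacobi_triple (fls_outer f * A) (fls_const f * B) (fls_const f * C)"
  unfolding jacobi_triple_def
proof (intro allI)
  fix a b c
  let ?A = "binser (-1) (-c-1) * A" and ?B = "sgn_pow (-c-1) * (binser (-1) (-c-1) * B)"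
  let ?C = "binser 1 (-a-1) * C"
  have J: "?A $$ n $$ a - ?B $$ a $$ n = ?C $$ c $$ n" for n
    using assms unfolding jacobi_triple_def by blast
  \<comment> \<open>One index set for all three products, so that the hypothesis can be applied to
    each summand.\<close>
  define S where "S = {fls_subdegree f..b - fls_subdegree ?A} \<union> {fls_subdegree f..b - fls_subdegree (?B $$ a)}
    \<union> {fls_subdegree f..b - fls_subdegree (?C $$ c)}"
  have S: "finite S" by (simp add: S_def)
  have "(fls_outer f * ?A) $$ b $$ a = (\<Sum>m\<in>S. f $$ m * ?A $$ (b - m) $$ a)"
  proof (rule fls_outer_times_nth_sum[OF S])
    fix m assume "f $$ m \<noteq> 0" "?A $$ (b - m) \<noteq> 0"
    thus "m \<in> S"
      using fls_subdegree_leI[of f m] fls_subdegree_leI[of ?A "b - m"] by (simp add: S_def)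
  qed
  moreover have "(fls_const f * ?B) $$ a $$ b = (\<Sum>m\<in>S. f $$ m * ?B $$ a $$ (b - m))"
  proof (rule fls_const_times_nth_sum[OF S])
    fix m assume "f $$ m \<noteq> 0" "?B $$ a $$ (b - m) \<noteq> 0"
    thus "m \<in> S"
      using fls_subdegree_leI[of f m] fls_subdegree_leI[of "?B $$ a" "b - m"] by (simp add: S_def)
  qed
  moreover have "(fls_const f * ?C) $$ c $$ b = (\<Sum>m\<in>S. f $$ m * ?C $$ c $$ (b - m))"
  proof (rule fls_const_times_nth_sum[OF S])
    fix m assume "f $$ m \<noteq> 0" "?C $$ c $$ (b - m) \<noteq> 0"
    thus "m \<in> S"
      using fls_subdegree_leI[of f m] fls_subdegree_leI[of "?C $$ c" "b - m"] by (simp add: S_def)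
  qed
  ultimately have "(fls_outer f * ?A) $$ b $$ a - (fls_const f * ?B) $$ a $$ b = (fls_const f * ?C) $$ c $$ b"
    by (simp add: J flip: sum_subtractf right_diff_distrib)
  thus "(binser (-1) (-c-1) * (fls_outer f * A)) $$ b $$ a
      - (sgn_pow (-c-1) * (binser (-1) (-c-1) * (fls_const f * B))) $$ a $$ b
     = (binser 1 (-a-1) * (fls_const f * C)) $$ c $$ b"
    by (simp only: mult.left_commute[of _ "fls_const f"] mult.left_commute[of _ "fls_outer f"])
qed

text \<open>The starting point for all other triples: the relation between the delta functions
  themselves.\<close>

lemma jacobi_triple_1: "jacobi_triple 1 1 1"
  unfolding jacobi_triple_def
proof (intro allI)
  fix a b c :: int
  let ?n = "-c-1"
  have sgn: "(sgn_pow r * binser (-1) r) $$ a $$ b = emb ((-1) powi r * binpow (-1) r b a)" for r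
    by (simp add: sgn_pow_def binser_nth emb_mult)
  have "binpow (-1) ?n a b - (-1) powi ?n * binpow (-1) ?n b a = binpow 1 (-a-1) b c"
  proof (cases "a + b = ?n")
    case False
    thus ?thesis by (auto simp: binpow_def)
  next
    case True
    thus ?thesis by (rule binpow_delta_identity)
  qed
  thus "(binser (-1) ?n * 1) $$ b $$ a - (sgn_pow ?n * (binser (-1) ?n * 1)) $$ a $$ b
      = (binser 1 (-a-1) * 1) $$ c $$ b"
    by (simp add: sgn binser_nth flip: emb_diff del: emb_diff)
qed

lemma binser_times_nth:
  fixes C :: "'a fls fls"
  assumes "\<And>j. j < N \<Longrightarrow> C $$ j = 0" "\<And>u. u \<ge> T \<Longrightarrow> c - int u < N"
  shows "(binser s r * C) $$ c $$ b =
    (\<Sum>u<T. emb ((of_int r gchoose u) * s ^ u) * C $$ (c - int u) $$ (b - r + int u))"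
  using assms
  by (subst fls_times_nth_nat[of _ T])
    (auto simp: binser_nth_neg binser_nth_nat fls_sum_nth mult.assoc algebra_simps)

text \<open>In the third ring x has to be expressed as y + z: shifting a by m changes the exponent
  -a-1 of y + z in the delta function by m. Summed against the coefficients of f, these powers of y
  + z form \<open>fls_sub f\<close>.\<close>

lemma jacobi_triple_x:
  assumes "jacobi_triple A B C"
  shows "jacobi_triple (fls_const f * A) (fls_outer f * B) (fls_sub f * C)"
  unfolding jacobi_triple_def
proof (intro allI)
  fix a b c
  let ?A = "binser (-1) (-c-1) * A" and ?B = "sgn_pow (-c-1) * (binser (-1) (-c-1) * B)"
  let ?C = "\<lambda>a. binser 1 (-a-1) * C"
  have J: "?A $$ b $$ n - ?B $$ n $$ b = ?C n $$ c $$ b" for n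
    using assms unfolding jacobi_triple_def by blast
  \<comment> \<open>\<open>T\<close> bounds the powers of z that contribute. Only finitely many
    coefficients of C are then involved, and \<open>L\<close> below bounds their powers of y, which
    leaves finitely many exponents m of f.\<close>
  define T where "T = nat (c - fls_subdegree C + 1)"
  have T: "c - int u < fls_subdegree C" if "u \<ge> T" for u
    using that by (simp add: T_def)
  \<comment> \<open>With the factor (y + z)^(-a-1) absorbed into the substituted series, the
    right-hand side is \<open>fls_sub H * C\<close>.\<close>
  define H where "H = fls_Xp (-a-1) * f"
  define L where "L = Min (insert 0 ((\<lambda>u. fls_subdegree (C $$ (c - int u))) ` {..<T}))"
  have L: "L \<le> fls_subdegree (C $$ (c - int u))" if "u < T" for u
    unfolding L_def by (rule Min_le) (use that in auto)
  define S where "S = {fls_subdegree f..a - fls_subdegree (?A $$ b)} \<union> {fls_subdegree f..a - fls_subdegree ?B}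
    \<union> {fls_subdegree f..b + int T + a + 1 - L}"
  have S: "finite S" by (simp add: S_def)
  have "(fls_const f * ?A) $$ b $$ a = (\<Sum>m\<in>S. f $$ m * ?A $$ b $$ (a - m))"
  proof (rule fls_const_times_nth_sum[OF S])
    fix m assume "f $$ m \<noteq> 0" "?A $$ b $$ (a - m) \<noteq> 0"
    thus "m \<in> S"
      using fls_subdegree_leI[of f m] fls_subdegree_leI[of "?A $$ b" "a - m"] by (simp add: S_def)
  qed
  moreover have "(fls_outer f * ?B) $$ a $$ b = (\<Sum>m\<in>S. f $$ m * ?B $$ (a - m) $$ b)"
  proof (rule fls_outer_times_nth_sum[OF S])
    fix m assume "f $$ m \<noteq> 0" "?B $$ (a - m) \<noteq> 0"
    thus "m \<in> S"
      using fls_subdegree_leI[of f m] fls_subdegree_leI[of ?B "a - m"] by (simp add: S_def)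
  qed
  moreover have "(binser 1 (-a-1) * (fls_sub f * C)) $$ c $$ b = (\<Sum>m\<in>S. f $$ m * ?C (a - m) $$ c $$ b)"
  proof -
    have "(fls_sub H * C) $$ c = (\<Sum>u<T. fls_sub H $$ int u * C $$ (c - int u))"
      by (rule fls_times_nth_nat) (use T in \<open>auto simp: fls_sub_nth_neg\<close>)
    hence "(fls_sub H * C) $$ c $$ b = (\<Sum>u<T. (fls_sub H $$ int u * C $$ (c - int u)) $$ b)"
      by (simp add: fls_sum_nth)
    also have "\<dots> = (\<Sum>u<T. \<Sum>m\<in>S. f $$ m *
        (emb (of_int (m - a - 1) gchoose u) * C $$ (c - int u) $$ (b - (m - a - 1) + int u)))"
    proof (rule sum.cong)
      fix u assume u: "u \<in> {..<T}"
      have "(fls_sub H $$ int u * C $$ (c - int u)) $$ b =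
        (\<Sum>i\<in>(\<lambda>m. m - a - 1 - int u) ` S. fls_sub H $$ int u $$ i * C $$ (c - int u) $$ (b - i))"
      proof (rule fls_times_nth_sum)
        fix i assume "fls_sub H $$ int u $$ i \<noteq> 0" "C $$ (c - int u) $$ (b - i) \<noteq> 0"
        hence "f $$ (i + int u + a + 1) \<noteq> 0" "fls_subdegree (C $$ (c - int u)) \<le> b - i"
          using fls_subdegree_leI[of "C $$ (c - int u)" "b - i"]
          by (auto simp: fls_sub_nth H_def algebra_simps)
        hence "i + int u + a + 1 \<in> S"
          using L[of u] u fls_subdegree_leI[of f "i + int u + a + 1"] by (auto simp: S_def)
        thus "i \<in> (\<lambda>m. m - a - 1 - int u) ` S"
          by (intro image_eqI[of _ _ "i + int u + a + 1"]) auto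
      qed (use S in auto)
      also have "\<dots> = (\<Sum>m\<in>S. fls_sub H $$ int u $$ (m - a - 1 - int u) * C $$ (c - int u) $$ (b - (m - a - 1 - int u)))"
        by (subst sum.reindex) (auto intro!: inj_onI)
      finally show "(fls_sub H $$ int u * C $$ (c - int u)) $$ b = (\<Sum>m\<in>S. f $$ m *
        (emb (of_int (m - a - 1) gchoose u) * C $$ (c - int u) $$ (b - (m - a - 1) + int u)))"
        by (simp add: fls_sub_nth H_def mult_ac algebra_simps)
    qed simp
    also have "\<dots> = (\<Sum>m\<in>S. f $$ m * (\<Sum>u<T.
        emb (of_int (m - a - 1) gchoose u) * C $$ (c - int u) $$ (b - (m - a - 1) + int u)))"
      unfolding sum_distrib_left by (rule sum.swap)
    also have "\<dots> = (\<Sum>m\<in>S. f $$ m * ?C (a - m) $$ c $$ b)"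
    proof (rule sum.cong)
      fix m
      have "?C (a - m) $$ c $$ b = (\<Sum>u<T. emb ((of_int (-(a-m)-1) gchoose u) * 1 ^ u) *
          C $$ (c - int u) $$ (b - (-(a-m)-1) + int u))"
        by (rule binser_times_nth[where N = "fls_subdegree C"]) (use T in auto)
      thus "f $$ m * (\<Sum>u<T. emb (of_int (m - a - 1) gchoose u) * C $$ (c - int u) $$ (b - (m - a - 1) + int u))
          = f $$ m * ?C (a - m) $$ c $$ b"
        by (simp add: algebra_simps)
    qed simp
    finally show ?thesis
      by (simp add: H_def binser_times_fls_sub flip: mult.assoc)
  qed
  ultimately have "(fls_const f * ?A) $$ b $$ a - (fls_outer f * ?B) $$ a $$ b =
      (binser 1 (-a-1) * (fls_sub f * C)) $$ c $$ b"
    by (simp add: J flip: sum_subtractf right_diff_distrib)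
  thus "(binser (-1) (-c-1) * (fls_const f * A)) $$ b $$ a
      - (sgn_pow (-c-1) * (binser (-1) (-c-1) * (fls_outer f * B))) $$ a $$ b
     = (binser 1 (-a-1) * (fls_sub f * C)) $$ c $$ b"
    by (simp only: mult.left_commute[of _ "fls_const f"] mult.left_commute[of _ "fls_outer f"])
qed

lemma jacobi_triple_const:
  "jacobi_triple A B C \<Longrightarrow> jacobi_triple (fls_const (fls_const p) * A) (fls_const (fls_const p) * B) (fls_const (fls_const p) * C)"
  using jacobi_triple_y[of A B C "fls_const p"] by simp

section \<open>Derivatives in the outer variable\<close>

lemma of_int_fls: "(of_int z :: 'a fls) = fls_const (emb (of_int z))"
  by (simp add: emb_of_int fls_of_int)

text \<open>Absorption of binomials; the factor s arises because s multiplies the outer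
  variable.\<close>

lemma fls_deriv_binser: "fls_deriv (binser s r) = fls_const (fls_const (emb (s * of_int r))) * binser s (r - 1)"
proof (rule fls_eqI, rule fls_eqI)
  fix t i :: int
  consider "t < -1" | "t = -1" | "t \<ge> 0" by linarith
  thus "fls_deriv (binser s r) $$ t $$ i = (fls_const (fls_const (emb (s * of_int r))) * binser s (r - 1)) $$ t $$ i"
  proof cases
    case 3
    then obtain k where k: "t = int k" by (metis nonneg_int_cases)
    have "of_int (int k + 1) * ((of_int r gchoose Suc k) * s ^ Suc k) =
        s * of_int r * ((of_int (r - 1) gchoose k) * s ^ k)"
      using gbinomial_absorption[of k "of_int r :: complex"] by (simp add: mult_ac add.commute)
    hence "emb (of_int (int k + 1)) * emb ((of_int r gchoose Suc k) * s ^ Suc k) =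
        emb (s * of_int r) * emb ((of_int (r - 1) gchoose k) * s ^ k)"
      by (simp only: emb_mult [symmetric])
    thus ?thesis
      by (simp add: k of_int_fls binser_nth binpow_def nat_add_distrib del: of_int_add of_int_diff power_Suc)
  qed (simp_all add: binser_nth_neg)
qed

lemma fls_deriv_outer: "fls_deriv (fls_outer f) = fls_outer (fls_deriv f)"
  by (rule fls_eqI) (simp add: fls_of_int del: of_int_add)

lemma fls_deriv_fls_sub: "fls_deriv (fls_sub f) = fls_sub (fls_deriv f)"
proof (rule fls_eqI, rule fls_eqI)
  fix t i :: int
  consider "t < -1" | "t = -1" | "t \<ge> 0" by linarith
  thus "fls_deriv (fls_sub f) $$ t $$ i = fls_sub (fls_deriv f) $$ t $$ i"
  proof cases
    case 3
    then obtain k where k: "t = int k" by (metis nonneg_int_cases)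
    have "of_int (int k + 1) * (of_int (i + int k + 1) gchoose Suc k) =
        (of_int (i + int k) gchoose k) * (of_int (i + int k + 1) :: complex)"
      using gbinomial_absorption[of k "of_int (i + int k + 1) :: complex"]
      by (simp add: mult.commute add.commute[of 1 "of_nat k"])
    hence "emb (of_int (int k + 1)) * emb (of_int (i + int k + 1) gchoose Suc k) =
        emb (of_int (i + int k) gchoose k) * of_int (i + int k + 1)"
      by (simp only: emb_mult [symmetric] emb_of_int [symmetric])
    thus ?thesis
      by (simp add: k of_int_fls fls_sub_nth nat_add_distrib add.assoc mult.assoc [symmetric] del: of_int_add)
  qed (simp_all add: fls_sub_nth_neg)
qed

text \<open>Connects the products in the ring with the sums over supports in which the Jacobi
  identity is stated. Two forms are given, as the first and third of those sums list the inner
  exponent first and the second one lists the outer exponent first.\<close>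

lemma binser_times_Sum_any:
  fixes F :: "'a fls fls"
  shows "(fls_const (fls_const (emb q)) * (binser s r * F)) $$ b $$ a =
      Sum_any (\<lambda>(i, j). emb (q * binpow s r (a - i) (b - j)) * F $$ j $$ i)"
    and "(fls_const (fls_const (emb q)) * (binser s r * F)) $$ b $$ a =
      Sum_any (\<lambda>(j, i). emb (q * binpow s r (a - i) (b - j)) * F $$ j $$ i)"
proof -
  obtain N where N: "\<forall>n<N. F $$ n = 0" by (rule fls_nth_vanishes_belowE)
  define T where "T = nat (b - N + 1)"
  have T: "b - int u < N" if "u \<ge> T" for u using that by (simp add: T_def)
  have eq: "(fls_const (fls_const (emb q)) * (binser s r * F)) $$ b $$ a =
      (\<Sum>u<T. emb q * (emb ((of_int r gchoose u) * s ^ u) * F $$ (b - int u) $$ (a - r + int u)))"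
    using binser_times_nth[of N F T b s r a] N T by (simp add: sum_distrib_left)
  let ?p = "\<lambda>u. (a - r + int u, b - int u)"
  \<comment> \<open>The support lies on a line of constant i + j, and the truncation of F in the
    outer variable leaves at most \<open>T\<close> points of it.\<close>
  have supp: "\<exists>u<T. i = a - r + int u \<and> j = b - int u"
    if "emb (q * binpow s r (a - i) (b - j)) * F $$ j $$ i \<noteq> 0" for i j
  proof -
    have "binpow s r (a - i) (b - j) \<noteq> 0" "F $$ j \<noteq> 0" using that by auto
    hence "b - j \<ge> 0" "a - i + (b - j) = r" "j \<ge> N" using N by (auto simp: binpow_def not_less split: if_splits)
    thus ?thesis by (intro exI[of _ "nat (b - j)"]) (auto simp: T_def)
  qed
  have "Sum_any (\<lambda>(i, j). emb (q * binpow s r (a - i) (b - j)) * F $$ j $$ i) =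
      (\<Sum>(i, j)\<in>?p ` {..<T}. emb (q * binpow s r (a - i) (b - j)) * F $$ j $$ i)"
    by (rule Sum_any.expand_superset) (use supp in \<open>auto simp: image_iff\<close>)
  also have "\<dots> = (\<Sum>u<T. emb q * (emb ((of_int r gchoose u) * s ^ u) * F $$ (b - int u) $$ (a - r + int u)))"
    by (subst sum.reindex) (auto intro!: inj_onI sum.cong simp: binpow_def emb_mult mult.assoc)
  finally show "(fls_const (fls_const (emb q)) * (binser s r * F)) $$ b $$ a =
      Sum_any (\<lambda>(i, j). emb (q * binpow s r (a - i) (b - j)) * F $$ j $$ i)"
    using eq by simp
  let ?p' = "\<lambda>u. (b - int u, a - r + int u)"
  have "Sum_any (\<lambda>(j, i). emb (q * binpow s r (a - i) (b - j)) * F $$ j $$ i) =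
      (\<Sum>(j, i)\<in>?p' ` {..<T}. emb (q * binpow s r (a - i) (b - j)) * F $$ j $$ i)"
    by (rule Sum_any.expand_superset) (use supp in \<open>auto simp: image_iff\<close>)
  also have "\<dots> = (\<Sum>u<T. emb q * (emb ((of_int r gchoose u) * s ^ u) * F $$ (b - int u) $$ (a - r + int u)))"
    by (subst sum.reindex) (auto intro!: inj_onI sum.cong simp: binpow_def emb_mult mult.assoc)
  finally show "(fls_const (fls_const (emb q)) * (binser s r * F)) $$ b $$ a =
      Sum_any (\<lambda>(j, i). emb (q * binpow s r (a - i) (b - j)) * F $$ j $$ i)"
    using eq by simp
qed

end

section \<open>The algebra \<open>\<Xi>\<close>\<close>

definition cst :: "complex \<Rightarrow> amb" where
  "cst c = fps_const (Poly_Mapping.single {#} c)"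

abbreviation cst1 :: "complex \<Rightarrow> amb fls" where
  "cst1 c \<equiv> fls_const (cst c)"

abbreviation cst2 :: "complex \<Rightarrow> amb fls fls" where
  "cst2 c \<equiv> fls_const (fls_const (cst c))"

interpretation cst: complex_algebra cst
proof
  show "cst (c + d) = cst c + cst d" for c d
    by (simp add: cst_def single_add)
  show "cst (c * d) = cst c * cst d" for c d
    by (simp add: cst_def mult_single)
  show "cst 1 = 1"
    by (metis cst_def fps_const_1_eq_1 single_one zero_multiset_def)
qed

lemma ascale_cst: "ascale c w = cst c * w"
  by (simp add: ascale_def cst_def)

lemma cst_mult_inverse: "c \<noteq> 0 \<Longrightarrow> cst (1 / c) * (cst c * w) = w"
  by (simp add: mult.assoc [symmetric] flip: cst.emb_mult)

lemma cst_mult_eq_0: "c \<noteq> 0 \<Longrightarrow> cst c * w = 0 \<Longrightarrow> w = 0"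
  using cst_mult_inverse[of c w] by simp

text \<open>Linear independence of the power sequences of distinct integers, with coefficients in
  \<open>amb\<close>. It serves twice: for the exponentials in xi_0 and for those in log x.\<close>

lemma vandermonde_cst:
  assumes "finite S" "\<And>l. (\<Sum>n\<in>S. cst (of_int n ^ l) * f n) = 0" "n \<in> S"
  shows "f n = 0"
  using assms
proof (induction S arbitrary: f n)
  case (insert s S)
  have *: "f k = 0" if k: "k \<in> S" for k
  proof -
    \<comment> \<open>Subtracting s times the relation at l from the relation at l + 1 eliminates s
      and multiplies the other unknowns by k - s.\<close>
    have "cst (of_int k - of_int s) * f k = 0"
    proof (rule insert.IH[where f = "\<lambda>k. cst (of_int k - of_int s) * f k", OF _ k])
      fix l
      have "(\<Sum>k\<in>S. cst (of_int k ^ l) * (cst (of_int k - of_int s) * f k)) =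
          (\<Sum>k\<in>insert s S. cst (of_int k ^ l) * (cst (of_int k - of_int s) * f k))"
        using insert.hyps by simp
      also have "\<dots> = (\<Sum>k\<in>insert s S. cst (of_int k ^ Suc l) * f k)
          - cst (of_int s) * (\<Sum>k\<in>insert s S. cst (of_int k ^ l) * f k)"
        unfolding sum_distrib_left sum_subtractf [symmetric]
        by (rule sum.cong) (simp_all add: cst.emb_diff cst.emb_mult algebra_simps)
      also have "\<dots> = 0" by (simp only: insert.prems) simp
      finally show "(\<Sum>k\<in>S. cst (of_int k ^ l) * (cst (of_int k - of_int s) * f k)) = 0" .
    qed
    moreover have "complex_of_int k - of_int s \<noteq> 0" using k insert.hyps by auto
    ultimately show ?thesis using cst_mult_eq_0 by blast
  qed
  moreover have "f s = 0"
    using insert.prems(1)[of 0] insert.hyps * by simp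
  ultimately show ?case using insert.prems(2) by auto
qed simp

section \<open>The exponentials in xi_0 and the basis of monomials\<close>

definition exp_fps :: "int \<Rightarrow> amb" where
  "exp_fps m = Abs_fps (\<lambda>k. Poly_Mapping.single {#} (of_int m ^ k / fact k))"

lemma exp_fps_sums: "(\<lambda>k. ascale (1 / fact k) (ascale (of_int m) (xi 0) ^ k)) sums exp_fps m"
proof -
  have "ascale (1 / fact k) (ascale (of_int m) (xi 0) ^ k) = fps_const (fps_nth (exp_fps m) k) * fps_X ^ k" for k
  proof -
    have "cst (of_int m) ^ k = cst (of_int m ^ k)"
      by (induction k) (simp_all add: cst.emb_mult)
    hence "ascale (1 / fact k) (ascale (of_int m) (xi 0) ^ k) = cst (of_int m ^ k / fact k) * fps_X ^ k"
      by (simp add: ascale_cst xi_def power_mult_distrib mult.assoc [symmetric] flip: cst.emb_mult)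
    thus ?thesis by (simp add: cst_def exp_fps_def)
  qed
  thus ?thesis using fps_notation[of "exp_fps m"] by (simp add: sums_def_le atMost_atLeast0)
qed

lemma exp_xi0_eq: "exp_xi0 m = exp_fps m"
  unfolding exp_xi0_def by (rule sums_unique [symmetric, OF exp_fps_sums])

lemma exp_xi0_sums: "(\<lambda>k. ascale (1 / fact k) (ascale (of_int m) (xi 0) ^ k)) sums exp_xi0 m"
  using exp_fps_sums by (simp add: exp_xi0_eq)

lemma exp_xi0_nth: "fps_nth (exp_xi0 m) k = Poly_Mapping.single {#} (of_int m ^ k / fact k)"
  by (simp add: exp_xi0_eq exp_fps_def)

lemma single_empty_sum: "Poly_Mapping.single {#} (\<Sum>i\<in>S. f i) = (\<Sum>i\<in>S. Poly_Mapping.single {#} (f i))"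
  by (induction S rule: infinite_finite_induct) (auto simp: single_add)

lemma exp_xi0_add: "exp_xi0 (m + n) = exp_xi0 m * exp_xi0 n"
proof (rule fps_ext)
  fix k
  have "(of_int (m + n) :: complex) ^ k / fact k =
      (\<Sum>i\<le>k. of_nat (k choose i) * of_int m ^ i * of_int n ^ (k - i) / fact k)"
    by (simp add: binomial_ring sum_divide_distrib)
  also have "\<dots> = (\<Sum>i\<le>k. of_int m ^ i / fact i * (of_int n ^ (k - i) / fact (k - i)))"
    by (rule sum.cong) (auto simp: binomial_fact field_simps)
  finally show "fps_nth (exp_xi0 (m + n)) k = fps_nth (exp_xi0 m * exp_xi0 n) k"
    by (simp add: exp_xi0_nth fps_mult_nth mult_single single_empty_sum atMost_atLeast0)
qed

lemma exp_xi0_0 [simp]: "exp_xi0 0 = 1"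
  by (rule fps_ext) (auto simp: exp_xi0_nth power_0_left simp flip: zero_multiset_def)

lemma monom_Xi_empty [simp]: "monom_Xi m {#} = exp_xi0 m"
  by (simp add: monom_Xi_def)

lemma monom_Xi_add_mset: "monom_Xi m (add_mset n N) = xi n * monom_Xi m N"
  by (simp add: monom_Xi_def mult_ac)

lemma monom_Xi_nth:
  "0 \<notin># N \<Longrightarrow> fps_nth (monom_Xi m N) k = Poly_Mapping.single N (of_int m ^ k / fact k)"
proof (induction N)
  case (add n N)
  thus ?case by (simp add: monom_Xi_add_mset xi_def mult_single)
qed (simp add: exp_xi0_nth)

lemma monom_Xi_inj:
  assumes "0 \<notin># N" "0 \<notin># N'" "monom_Xi m N = monom_Xi m' N'"
  shows "m = m' \<and> N = N'"
proof -
  have *: "Poly_Mapping.single N (of_int m ^ k / fact k) = (Poly_Mapping.single N' (of_int m' ^ k / fact k) :: _ \<Rightarrow>\<^sub>0 complex)" for k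
    using assms by (metis monom_Xi_nth)
  have "N = N'" using arg_cong[OF *[of 0], of "\<lambda>p. Poly_Mapping.lookup p N"]
    by (auto simp: lookup_single when_def split: if_splits)
  with *[of 1] show ?thesis by (auto dest: arg_cong[of _ _ "\<lambda>p. Poly_Mapping.lookup p N"])
qed

text \<open>For a fixed monomial in the xi_n, the coefficients of xi_0^l in a linear relation are,
  up to l!, power sums over the exponents m, so \<open>vandermonde_cst\<close> applies. Independence
  is what makes coordinates with respect to the basis, and with them \<open>Upsilon\<close>,
  linear.\<close>

lemma independent_basis_Xi: "\<not> amb.dependent basis_Xi"
proof
  assume "amb.dependent basis_Xi"
  then obtain t u where t: "finite t" "t \<subseteq> basis_Xi" and 0: "(\<Sum>v\<in>t. ascale (u v) v) = 0"
    and v: "\<exists>v\<in>t. u v \<noteq> 0"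
    unfolding amb.dependent_explicit by blast
  define F where "F = {(m, N). 0 \<notin># N \<and> monom_Xi m N \<in> t}"
  have inj: "inj_on (\<lambda>(m, N). monom_Xi m N) F"
    using monom_Xi_inj by (auto simp: F_def inj_on_def)
  have img: "(\<lambda>(m, N). monom_Xi m N) ` F = t"
    using t(2) by (auto simp: F_def basis_Xi_def image_iff)
  have fin: "finite F" using inj img t(1) finite_imageD by blast
  have u0: "u (monom_Xi m N) = 0" if mN: "(m, N) \<in> F" for m N
  proof -
    define S where "S = {m. (m, N) \<in> F}"
    have finS: "finite S"
      by (rule finite_subset[of _ "fst ` F"]) (use fin in \<open>force simp: S_def\<close>)+
    have "cst (u (monom_Xi m N)) = 0"
    proof (rule vandermonde_cst[where f = "\<lambda>m. cst (u (monom_Xi m N))", OF finS])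
      fix l
      have "0 = (\<Sum>(m, N)\<in>F. ascale (u (monom_Xi m N)) (monom_Xi m N))"
        using 0 sum.reindex[OF inj, of "\<lambda>v. ascale (u v) v"] img by (simp add: case_prod_beta)
      hence "0 = Poly_Mapping.lookup (fps_nth (\<Sum>(m, N)\<in>F. ascale (u (monom_Xi m N)) (monom_Xi m N)) l) N"
        by simp
      also have "\<dots> = (\<Sum>(m, N')\<in>F. u (monom_Xi m N') * (of_int m ^ l / fact l when N' = N))"
        unfolding fps_sum_nth lookup_sum
      proof (rule sum.cong)
        fix x assume "x \<in> F"
        then obtain m N' where x: "x = (m, N')" "0 \<notin># N'" by (auto simp: F_def)
        thus "Poly_Mapping.lookup (fps_nth (case x of (m, N) \<Rightarrow> ascale (u (monom_Xi m N)) (monom_Xi m N)) l) N =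
          (case x of (m, N') \<Rightarrow> u (monom_Xi m N') * (of_int m ^ l / fact l when N' = N))"
          by (simp add: ascale_def monom_Xi_nth mult_single lookup_single mult_when)
      qed simp
      also have "\<dots> = (\<Sum>(m, N')\<in>(\<lambda>m. (m, N)) ` S. u (monom_Xi m N') * (of_int m ^ l / fact l when N' = N))"
        by (rule sum.mono_neutral_right) (use fin in \<open>auto simp: S_def when_def\<close>)
      also have "\<dots> = (\<Sum>m\<in>S. u (monom_Xi m N) * (of_int m ^ l / fact l))"
        by (subst sum.reindex) (auto intro!: inj_onI)
      finally have "fact l * (\<Sum>m\<in>S. u (monom_Xi m N) * (of_int m ^ l / fact l)) = 0" by simp
      hence "(\<Sum>m\<in>S. of_int m ^ l * u (monom_Xi m N)) = 0"
        by (simp add: sum_distrib_left mult_ac)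
      thus "(\<Sum>m\<in>S. cst (of_int m ^ l) * cst (u (monom_Xi m N))) = 0"
        by (simp flip: cst.emb_mult cst.emb_sum)
    qed (use mN in \<open>simp add: S_def\<close>)
    thus ?thesis unfolding cst_def by (metis fps_const_eq_0_iff lookup_single_eq lookup_zero)
  qed
  thus False using v img by auto
qed

lemma basis_Xi_subset: "basis_Xi \<subseteq> Xi"
  unfolding Xi_def by (rule amb.span_superset)

lemma Xi_add: "v \<in> Xi \<Longrightarrow> w \<in> Xi \<Longrightarrow> v + w \<in> Xi"
  by (simp add: Xi_def amb.span_add)

lemma Xi_0 [simp]: "0 \<in> Xi"
  by (simp add: Xi_def amb.span_zero)

lemma Xi_cst_mult: "v \<in> Xi \<Longrightarrow> cst c * v \<in> Xi"
  using amb.span_scale[of v basis_Xi c] by (simp add: Xi_def ascale_cst)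

lemma Xi_sum: "(\<And>a. a \<in> A \<Longrightarrow> f a \<in> Xi) \<Longrightarrow> (\<Sum>a\<in>A. f a) \<in> Xi"
  by (simp add: Xi_def amb.span_sum)

lemma monom_Xi_in_Xi: "0 \<notin># N \<Longrightarrow> monom_Xi m N \<in> Xi"
  using basis_Xi_subset by (auto simp: basis_Xi_def)

lemma exp_xi0_in_Xi: "exp_xi0 m \<in> Xi"
  using monom_Xi_in_Xi[of "{#}" m] by simp

lemma Xi_induct [consumes 1, case_names monom add scale]:
  assumes v: "v \<in> Xi"
    and monom: "\<And>m N. 0 \<notin># N \<Longrightarrow> P (monom_Xi m N)"
    and add: "\<And>v w. v \<in> Xi \<Longrightarrow> w \<in> Xi \<Longrightarrow> P v \<Longrightarrow> P w \<Longrightarrow> P (v + w)"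
    and scale: "\<And>c v. v \<in> Xi \<Longrightarrow> P v \<Longrightarrow> P (cst c * v)"
  shows "P v"
proof -
  have "v \<in> amb.span basis_Xi" using v by (simp add: Xi_def)
  hence "v \<in> Xi \<and> P v"
  proof (induction rule: amb.span_induct_alt)
    case base
    show ?case using scale[OF exp_xi0_in_Xi[of 0], of 0] monom[of "{#}" 0] by simp
  next
    case (step c x y)
    thus ?case
      using monom_Xi_in_Xi by (auto simp: ascale_cst basis_Xi_def intro!: add scale monom Xi_add Xi_cst_mult)
  qed
  thus ?thesis ..
qed

text \<open>Follows the recursion for vertex operators, one factor xi_n at a time.
  \<open>Xi_induct\<close>, in contrast, starts from whole monomials, which have a definite
  charge.\<close>

lemma Xi_induct_gen [consumes 1, case_names exp xi add scale]:
  assumes v: "v \<in> Xi"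
    and exp: "\<And>m. P (exp_xi0 m)"
    and xi: "\<And>n v. n \<ge> 1 \<Longrightarrow> v \<in> Xi \<Longrightarrow> P v \<Longrightarrow> P (xi n * v)"
    and add: "\<And>v w. v \<in> Xi \<Longrightarrow> w \<in> Xi \<Longrightarrow> P v \<Longrightarrow> P w \<Longrightarrow> P (v + w)"
    and scale: "\<And>c v. v \<in> Xi \<Longrightarrow> P v \<Longrightarrow> P (cst c * v)"
  shows "P v"
  using v
proof (induction rule: Xi_induct)
  case (monom m N)
  thus ?case
  proof (induction N)
    case (add n N)
    thus ?case by (auto simp: monom_Xi_add_mset Suc_le_eq intro!: xi monom_Xi_in_Xi)
  qed (simp add: exp)
qed (use add scale in auto)

lemma Xi_xi_mult:
  assumes "v \<in> Xi" "n \<ge> 1"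
  shows "xi n * v \<in> Xi"
  using assms(1)
proof (induction v rule: Xi_induct)
  case (monom m N)
  thus ?case using monom_Xi_in_Xi[of "add_mset n N" m] assms(2) by (simp add: monom_Xi_add_mset)
next
  case (add v w)
  thus ?case by (simp add: distrib_left Xi_add)
next
  case (scale c v)
  thus ?case by (simp add: mult.left_commute[of "xi n"] Xi_cst_mult)
qed

lemma Xi_exp_mult: "v \<in> Xi \<Longrightarrow> exp_xi0 m * v \<in> Xi"
  by (induction v rule: Xi_induct_gen)
    (simp_all add: distrib_left mult.left_commute[of "exp_xi0 m"] Xi_add Xi_cst_mult Xi_xi_mult
      exp_xi0_in_Xi flip: exp_xi0_add)

lemma Xi_mult: "v \<in> Xi \<Longrightarrow> w \<in> Xi \<Longrightarrow> v * w \<in> Xi"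
  by (induction v rule: Xi_induct_gen)
    (simp_all add: distrib_right mult.assoc Xi_add Xi_cst_mult Xi_xi_mult Xi_exp_mult)

lemma one_in_Xi [simp]: "1 \<in> Xi"
  using exp_xi0_in_Xi[of 0] by simp

lemma cst_in_Xi [simp]: "cst c \<in> Xi"
  using Xi_cst_mult[OF one_in_Xi] by simp

lemma xi_in_Xi: "n \<ge> 1 \<Longrightarrow> xi n \<in> Xi"
  using Xi_xi_mult[OF one_in_Xi] by simp

subsection \<open>Partial derivatives\<close>

text \<open>The monomial M can arise only from \<open>add_mset n M\<close>. This coefficient formula
  reduces the rules for partial derivatives to comparisons of coefficients.\<close>

lemma lookup_poly_partial:
  "Poly_Mapping.lookup (poly_partial n p) M = of_nat (Suc (count M n)) * Poly_Mapping.lookup p (add_mset n M)"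
proof -
  have "Poly_Mapping.lookup (poly_partial n p) M = (\<Sum>N\<in>Poly_Mapping.keys p.
      if N = add_mset n M then of_nat (Suc (count M n)) * Poly_Mapping.lookup p N else 0)"
    unfolding poly_partial_def lookup_sum
  proof (rule sum.cong)
    fix N
    have "N - {#n#} = M \<and> n \<in># N \<longleftrightarrow> N = add_mset n M" by auto
    moreover have "count N n = 0" if "n \<notin># N" using that by (simp add: not_in_iff)
    ultimately show "Poly_Mapping.lookup (Poly_Mapping.single (N - {#n#}) (of_nat (count N n) * Poly_Mapping.lookup p N)) M =
        (if N = add_mset n M then of_nat (Suc (count M n)) * Poly_Mapping.lookup p N else 0)"
      by (cases "n \<in># N") (auto simp: lookup_single when_def)
  qed simp
  also have "\<dots> = of_nat (Suc (count M n)) * Poly_Mapping.lookup p (add_mset n M)"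
    by (auto simp: sum.delta' not_in_keys_iff_lookup_eq_zero simp del: of_nat_Suc)
  finally show ?thesis .
qed

lemma poly_partial_add: "poly_partial n (p + q) = poly_partial n p + poly_partial n q"
  by (rule poly_mapping_eqI) (simp add: lookup_poly_partial lookup_add distrib_left del: of_nat_Suc)

lemma poly_partial_0 [simp]: "poly_partial n 0 = 0"
  by (simp add: poly_partial_def)

lemma poly_partial_sum: "poly_partial n (\<Sum>a\<in>A. f a) = (\<Sum>a\<in>A. poly_partial n (f a))"
  by (induction A rule: infinite_finite_induct) (auto simp: poly_partial_add)

lemma lookup_single_mult:
  fixes p :: "nat multiset \<Rightarrow>\<^sub>0 complex"
  shows "Poly_Mapping.lookup (Poly_Mapping.single K c * p) M =
    (if K \<subseteq># M then c * Poly_Mapping.lookup p (M - K) else 0)"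
proof -
  have *: "M = K + q \<longleftrightarrow> K \<subseteq># M \<and> q = M - K" for q
    by (auto simp: subset_mset.add_diff_inverse)
  have "Poly_Mapping.lookup (Poly_Mapping.single K c * p) M =
      (\<Sum>l. (c * (\<Sum>q. Poly_Mapping.lookup p q when M = l + q) when l = K))"
    unfolding lookup_mult by (rule arg_cong[of _ _ Sum_any]) (auto simp: lookup_single when_def)
  also have "\<dots> = c * (\<Sum>q. ((Poly_Mapping.lookup p q when K \<subseteq># M) when q = M - K))"
    unfolding when_when * [symmetric] by simp
  also have "\<dots> = c * (Poly_Mapping.lookup p (M - K) when K \<subseteq># M)"
    by simp
  finally show ?thesis by (simp add: when_def)
qed

lemma poly_partial_const: "poly_partial n (Poly_Mapping.single {#} c * p) = Poly_Mapping.single {#} c * poly_partial n p"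
  by (rule poly_mapping_eqI) (simp add: lookup_poly_partial lookup_single_mult)

lemma poly_partial_var:
  "poly_partial k (Poly_Mapping.single {#n#} 1 * p) =
    (if k = n then p else 0) + Poly_Mapping.single {#n#} 1 * poly_partial k p"
proof (rule poly_mapping_eqI)
  fix M
  show "Poly_Mapping.lookup (poly_partial k (Poly_Mapping.single {#n#} 1 * p)) M =
      Poly_Mapping.lookup ((if k = n then p else 0) + Poly_Mapping.single {#n#} 1 * poly_partial k p) M"
  proof (cases "n \<in># M")
    case True
    then obtain M' where "M = add_mset n M'" by (metis multi_member_split)
    thus ?thesis
      by (auto simp: lookup_poly_partial lookup_single_mult lookup_add add_mset_commute)
        (simp_all add: distrib_right add.commute add_mset_commute)
  next
    case False
    hence "count M n = 0" by (simp add: not_in_iff)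
    with False show ?thesis
      by (cases "k = n") (simp_all add: lookup_poly_partial lookup_single_mult lookup_add)
  qed
qed

lemma poly_partial_commute: "poly_partial j (poly_partial k p) = poly_partial k (poly_partial j p)"
  by (cases "j = k") (auto intro!: poly_mapping_eqI simp: lookup_poly_partial add_mset_commute)

lemma fps_nth_partial_xi: "k \<ge> 1 \<Longrightarrow> fps_nth (partial_xi k w) j = poly_partial k (fps_nth w j)"
  by (simp add: partial_xi_def)

lemma partial_xi_0: "partial_xi 0 w = fps_deriv w"
  by (simp add: partial_xi_def)

lemma partial_xi_add: "partial_xi k (v + w) = partial_xi k v + partial_xi k w"
  by (cases "k = 0") (auto simp: partial_xi_0 fps_nth_partial_xi poly_partial_add intro!: fps_ext)

lemma partial_xi_zero [simp]: "partial_xi k 0 = 0"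
  by (cases "k = 0") (auto simp: partial_xi_0 fps_nth_partial_xi intro!: fps_ext)

lemma partial_xi_sum: "partial_xi k (\<Sum>a\<in>A. f a) = (\<Sum>a\<in>A. partial_xi k (f a))"
  by (induction A rule: infinite_finite_induct) (auto simp: partial_xi_add)

lemma partial_xi_cst: "partial_xi k (cst c * w) = cst c * partial_xi k w"
proof (cases "k = 0")
  case False
  thus ?thesis
    by (intro fps_ext) (simp add: fps_nth_partial_xi cst_def poly_partial_const)
qed (simp add: partial_xi_0 cst_def)

lemma poly_partial_of_nat: "poly_partial k (of_nat n * p) = of_nat n * poly_partial k p"
  by (induction n) (simp_all add: distrib_right poly_partial_add)

lemma partial_xi_commute: "partial_xi j (partial_xi k w) = partial_xi k (partial_xi j w)"
  by (cases "j = 0"; cases "k = 0")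
    (auto simp: partial_xi_0 fps_nth_partial_xi poly_partial_of_nat poly_partial_commute[of j k]
      simp del: of_nat_Suc of_nat_add intro!: fps_ext)

lemma partial_xi_xi_mult:
  assumes "n \<ge> 1"
  shows "partial_xi k (xi n * w) = (if k = n then w else 0) + xi n * partial_xi k w"
proof (cases "k = 0")
  case False
  thus ?thesis using assms
    by (intro fps_ext) (simp add: fps_nth_partial_xi xi_def poly_partial_var)
qed (use assms in \<open>simp add: partial_xi_0 xi_def\<close>)

lemma fps_deriv_exp_xi0: "fps_deriv (exp_xi0 m) = cst (of_int m) * exp_xi0 m"
proof (rule fps_ext)
  fix k
  have "of_nat (Suc k) * Poly_Mapping.single {#} c = (Poly_Mapping.single {#} (of_nat (Suc k) * c) :: nat multiset \<Rightarrow>\<^sub>0 complex)" for c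
    by (metis mult_single add.right_neutral single_of_nat zero_multiset_def)
  thus "fps_nth (fps_deriv (exp_xi0 m)) k = fps_nth (cst (of_int m) * exp_xi0 m) k"
    by (simp add: exp_xi0_nth cst_def mult_single field_simps del: of_nat_Suc single_of_int)
qed

lemma partial_xi_exp_mult:
  "partial_xi k (exp_xi0 m * w) = (if k = 0 then cst (of_int m) * exp_xi0 m * w else 0) + exp_xi0 m * partial_xi k w"
proof (cases "k = 0")
  case False
  thus ?thesis
    by (intro fps_ext) (simp add: fps_nth_partial_xi fps_mult_nth exp_xi0_nth poly_partial_sum poly_partial_const)
qed (simp add: partial_xi_0 fps_deriv_exp_xi0)

lemma partial_xi_one [simp]: "partial_xi k 1 = 0"
proof (cases "k = 0")
  case False
  have "poly_partial k (1 :: nat multiset \<Rightarrow>\<^sub>0 complex) = 0"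
    by (simp add: poly_partial_def)
  with False show ?thesis
    by (intro fps_ext) (simp add: fps_nth_partial_xi)
qed (simp add: partial_xi_0)

lemma partial_xi_exp: "partial_xi k (exp_xi0 m) = (if k = 0 then cst (of_int m) * exp_xi0 m else 0)"
  using partial_xi_exp_mult[of k m 1] by simp

text \<open>The Leibniz rule is known for the generators as left factor and spreads over
  \<open>Xi\<close> by induction, the right factor being arbitrary.\<close>

lemma partial_xi_mult:
  assumes "v \<in> Xi"
  shows "partial_xi k (v * w) = partial_xi k v * w + v * partial_xi k w"
  using assms
proof (induction v rule: Xi_induct_gen)
  case (exp m)
  show ?case by (simp add: partial_xi_exp_mult partial_xi_exp)
next
  case (xi n v)
  thus ?case by (simp add: partial_xi_xi_mult mult.assoc distrib_left distrib_right)
next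
  case (add v w)
  thus ?case by (simp add: distrib_right partial_xi_add)
next
  case (scale c v)
  thus ?case by (simp add: mult.assoc partial_xi_cst distrib_left)
qed

lemma partial_xi_in_Xi: "v \<in> Xi \<Longrightarrow> partial_xi k v \<in> Xi"
  by (induction v rule: Xi_induct_gen)
    (auto simp: partial_xi_exp partial_xi_xi_mult partial_xi_add partial_xi_cst mult.assoc
      intro!: Xi_add Xi_cst_mult Xi_xi_mult exp_xi0_in_Xi)

text \<open>A vector involves only finitely many of the variables. All bounds \<open>K\<close> on
  sums over derivatives have their origin here.\<close>

lemma partial_xi_eventually_0:
  assumes "v \<in> Xi"
  shows "\<exists>K. \<forall>k\<ge>K. partial_xi k v = 0"
  using assms
proof (induction v rule: Xi_induct_gen)
  case (exp m)
  show ?case by (rule exI[of _ 1]) (simp add: partial_xi_exp)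
next
  case (xi n v)
  then obtain K where "\<forall>k\<ge>K. partial_xi k v = 0" by blast
  thus ?case using xi by (intro exI[of _ "max K (Suc n)"]) (auto simp: partial_xi_xi_mult)
next
  case (add v w)
  then obtain K L where "\<forall>k\<ge>K. partial_xi k v = 0" "\<forall>k\<ge>L. partial_xi k w = 0" by blast
  thus ?case by (intro exI[of _ "max K L"]) (auto simp: partial_xi_add)
next
  case (scale c v)
  then obtain K where "\<forall>k\<ge>K. partial_xi k v = 0" by blast
  thus ?case by (intro exI[of _ K]) (simp add: partial_xi_cst)
qed

section \<open>The operator series in the definition of \<open>\<Upsilon>\<close>\<close>

text \<open>Convergence of power series spelled out as eventual constancy of every coefficient, so
  that the closure rules become finite arguments.\<close>

definition adic_sums :: "(nat \<Rightarrow> 'a::comm_ring_1 fps) \<Rightarrow> 'a fps \<Rightarrow> bool" where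
  "adic_sums f s \<longleftrightarrow> (\<forall>k. \<forall>\<^sub>F N in sequentially. fps_nth (\<Sum>n<N. f n) k = fps_nth s k)"

lemma adic_sums_iff_sums: "adic_sums f s \<longleftrightarrow> f sums s"
  by (simp add: adic_sums_def sums_def tendsto_fps_iff)

lemma adic_sums_mult:
  assumes "adic_sums f s"
  shows "adic_sums (\<lambda>n. c * f n) (c * s)"
  unfolding adic_sums_def
proof
  fix k
  have "\<forall>\<^sub>F N in sequentially. \<forall>i\<in>{..k}. fps_nth (\<Sum>n<N. f n) i = fps_nth s i"
    using assms by (intro eventually_ball_finite) (auto simp: adic_sums_def)
  thus "\<forall>\<^sub>F N in sequentially. fps_nth (\<Sum>n<N. c * f n) k = fps_nth (c * s) k"
    by eventually_elim (simp add: fps_mult_nth flip: sum_distrib_left)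
qed

lemma adic_sums_add: "adic_sums f s \<Longrightarrow> adic_sums g t \<Longrightarrow> adic_sums (\<lambda>n. f n + g n) (s + t)"
  unfolding adic_sums_def
proof (intro allI)
  fix k
  assume "\<forall>k. \<forall>\<^sub>F N in sequentially. fps_nth (\<Sum>n<N. f n) k = fps_nth s k"
    "\<forall>k. \<forall>\<^sub>F N in sequentially. fps_nth (\<Sum>n<N. g n) k = fps_nth t k"
  hence "\<forall>\<^sub>F N in sequentially. fps_nth (\<Sum>n<N. f n) k = fps_nth s k"
    "\<forall>\<^sub>F N in sequentially. fps_nth (\<Sum>n<N. g n) k = fps_nth t k" by blast+
  thus "\<forall>\<^sub>F N in sequentially. fps_nth (\<Sum>n<N. f n + g n) k = fps_nth (s + t) k"
    by eventually_elim (simp add: sum.distrib)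
qed

lemma adic_sums_sum:
  "(\<And>a. a \<in> A \<Longrightarrow> adic_sums (f a) (s a)) \<Longrightarrow> adic_sums (\<lambda>n. \<Sum>a\<in>A. f a n) (\<Sum>a\<in>A. s a)"
proof (induction A rule: infinite_finite_induct)
  case (insert x F)
  thus ?case by (simp add: adic_sums_add)
qed (simp_all add: adic_sums_def)

lemma adic_sums_Suc:
  assumes "adic_sums (\<lambda>n. f (Suc n)) s" "f 0 = 0"
  shows "adic_sums f s"
  unfolding adic_sums_def
proof
  fix k
  have "(\<Sum>n<Suc N. f n) = (\<Sum>n<N. f (Suc n))" for N
    using assms(2) by (simp add: sum.lessThan_Suc_shift del: sum.lessThan_Suc)
  hence "\<forall>\<^sub>F N in sequentially. fps_nth (\<Sum>n<Suc N. f n) k = fps_nth s k"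
    using assms(1) by (simp add: adic_sums_def del: sum.lessThan_Suc)
  thus "\<forall>\<^sub>F N in sequentially. fps_nth (\<Sum>n<N. f n) k = fps_nth s k"
    by (rule eventually_sequentially_Suc[THEN iffD1])
qed

subsection \<open>Multiplication operators\<close>

definition mult_op :: "amb fls \<Rightarrow> opser" where
  "mult_op f i l v = (if l = 0 then f $$ i * v else 0)"

lemma op_one_eq: "op_one = mult_op 1"
  by (intro ext) (auto simp: op_one_def mult_op_def)

lemma op_scale_mult_op: "op_scale c (mult_op f) = mult_op (cst1 c * f)"
  by (intro ext) (auto simp: op_scale_def mult_op_def ascale_cst mult.assoc)

lemma op_mult_mult_op_left:
  "op_mult (mult_op f) D i l v = Sum_any (\<lambda>j. f $$ (i - j) * D j l v)"
proof -
  have "(\<Sum>k\<le>l. mult_op f (i - j) (l - k) (D j k v)) = f $$ (i - j) * D j l v" for j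
  proof -
    have "(\<Sum>k\<le>l. mult_op f (i - j) (l - k) (D j k v)) = (\<Sum>k\<in>{l}. mult_op f (i - j) (l - k) (D j k v))"
      by (rule sum.mono_neutral_right) (auto simp: mult_op_def)
    thus ?thesis by (simp add: mult_op_def)
  qed
  thus ?thesis by (simp add: op_mult_def)
qed

text \<open>Replaces composition of operator series by multiplication in the ring of Laurent series,
  as soon as the values of the right factor form such a series.\<close>

lemma op_mult_series:
  assumes "\<And>i. F $$ i = D i l v"
  shows "op_mult (mult_op f) D i l v = (f * F) $$ i"
proof -
  let ?S = "{fls_subdegree F..i - fls_subdegree f}"
  have S: "j \<in> ?S" if "f $$ (i - j) \<noteq> 0" "F $$ j \<noteq> 0" for j
    using fls_subdegree_leI[OF that(1)] fls_subdegree_leI[OF that(2)] by simp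
  have "op_mult (mult_op f) D i l v = Sum_any (\<lambda>j. f $$ (i - j) * F $$ j)"
    by (simp add: op_mult_mult_op_left assms)
  also have "\<dots> = (\<Sum>j\<in>?S. F $$ j * f $$ (i - j))"
  proof (subst Sum_any.expand_superset[of ?S])
    show "{j. f $$ (i - j) * F $$ j \<noteq> 0} \<subseteq> ?S"
    proof
      fix j assume "j \<in> {j. f $$ (i - j) * F $$ j \<noteq> 0}"
      hence "f $$ (i - j) \<noteq> 0" "F $$ j \<noteq> 0" by auto
      thus "j \<in> ?S" by (rule S)
    qed
  qed (simp_all add: mult.commute)
  also have "\<dots> = (F * f) $$ i"
    by (rule fls_times_nth_sum [symmetric]) (use S in auto)
  finally show ?thesis by (simp add: mult.commute)
qed

lemma op_mult_mult_op: "op_mult (mult_op f) (mult_op g) = mult_op (f * g)"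
proof (intro ext)
  fix i l v
  show "op_mult (mult_op f) (mult_op g) i l v = mult_op (f * g) i l v"
  proof (cases "l = 0")
    case True
    have "op_mult (mult_op f) (mult_op g) i l v = (f * (g * fls_const v)) $$ i"
      by (rule op_mult_series) (simp add: mult_op_def True)
    thus ?thesis by (simp add: mult_op_def True flip: mult.assoc)
  next
    case False
    thus ?thesis by (simp add: op_mult_mult_op_left) (simp add: mult_op_def)
  qed
qed

lemma op_mult_one: "op_mult op_one D = D"
proof (intro ext)
  fix i l v
  have "op_mult op_one D i l v = Sum_any (\<lambda>j. 1 $$ (i - j) * D j l v)"
    by (simp add: op_one_eq op_mult_mult_op_left)
  also have "\<dots> = (\<Sum>j\<in>{i}. 1 $$ (i - j) * D j l v)"
    by (rule Sum_any.expand_superset) auto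
  finally show "op_mult op_one D i l v = D i l v" by simp
qed

text \<open>The series \<open>(d/dx)^n h^-(x) / n!\<close>\<close>

definition h_series :: "nat \<Rightarrow> amb fls" where
  "h_series n = Abs_fls (\<lambda>i. if i \<ge> 0 then cst (of_nat ((nat i + n) choose n)) * xi (nat i + n) else 0)"

lemma h_series_nth:
  "h_series n $$ i = (if i \<ge> 0 then cst (of_nat ((nat i + n) choose n)) * xi (nat i + n) else 0)"
  unfolding h_series_def by (rule nth_Abs_fls_lower_bound[of 0]) auto

lemma op_deriv_h_minus:
  "(op_deriv ^^ n) h_minus i l v =
    (if i \<ge> 0 \<and> l = 0 then cst (of_nat (fact (nat i + n)) / of_nat (fact (nat i))) * xi (nat i + n) * v else 0)"
proof (induction n arbitrary: i l v)
  case 0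
  show ?case by (simp add: h_minus_def)
next
  case (Suc n)
  have step: "(op_deriv ^^ Suc n) h_minus i l v = cst (of_int (i + 1)) * (op_deriv ^^ n) h_minus (i + 1) l v
      + cst (of_nat (l + 1)) * (op_deriv ^^ n) h_minus (i + 1) (l + 1) v"
    by (simp only: funpow.simps o_apply ascale_cst) (simp only: op_deriv_def ascale_cst)
  consider "i \<ge> 0" "l = 0" | "i = -1" "l = 0" | "i < -1" | "l \<noteq> 0" by linarith
  thus ?case
  proof cases
    case 1
    have *: "nat (i + 1) = Suc (nat i)" using 1 by simp
    have "of_int (i + 1) * (of_nat (fact (Suc (nat i) + n)) / of_nat (fact (Suc (nat i)))) =
        (of_nat (fact (nat i + Suc n)) / of_nat (fact (nat i)) :: complex)"
    proof -
      have "(of_int (i + 1) :: complex) = of_nat (Suc (nat i))" using 1 by simp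
      moreover have "of_nat (fact (Suc (nat i))) = (of_nat (Suc (nat i)) * of_nat (fact (nat i)) :: complex)"
        by (simp only: fact_Suc of_nat_mult of_nat_id)
      ultimately show ?thesis by (simp add: field_simps del: of_nat_Suc of_int_add fact_Suc)
    qed
    thus ?thesis using 1
      unfolding step Suc * by (simp add: mult.assoc [symmetric] del: of_int_add fact_Suc flip: cst.emb_mult)
  next
    case 2
    \<comment> \<open>The factor i + 1 = 0 in front of the constant term keeps x^(-1) from
      appearing.\<close>
    thus ?thesis unfolding step Suc by simp
  next
    case 3
    thus ?thesis unfolding step Suc by simp
  next
    case 4
    thus ?thesis unfolding step Suc by simp
  qed
qed

lemma nord_h_minus: "op_scale (1 / fact n) ((op_deriv ^^ n) h_minus) = mult_op (h_series n)"
proof (intro ext)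
  fix i l v
  have "1 / fact n * (of_nat (fact (nat i + n)) / of_nat (fact (nat i))) = (of_nat ((nat i + n) choose n) :: complex)"
    by (simp add: binomial_fact)
  thus "op_scale (1 / fact n) ((op_deriv ^^ n) h_minus) i l v = mult_op (h_series n) i l v"
    by (simp add: op_scale_def op_deriv_h_minus mult_op_def h_series_nth ascale_cst mult.assoc [symmetric]
        flip: cst.emb_mult del: times_divide_eq_left times_divide_eq_right)
qed

text \<open>The coefficients of E = e^(m h^-(x)), solved from E' = m (h^-)' E with E(0) = e^(m
  xi_0). Only the initial value contains xi_0, so all coefficients visibly lie in
  \<open>Xi\<close>.\<close>

fun exp_h_coeff :: "int \<Rightarrow> nat \<Rightarrow> amb" where
  "exp_h_coeff m 0 = exp_xi0 m"
| "exp_h_coeff m (Suc i) =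
    cst (of_int m / of_nat (Suc i)) * (\<Sum>j\<le>i. cst (of_nat (Suc j)) * xi (Suc j) * exp_h_coeff m (i - j))"

definition exp_h_series :: "int \<Rightarrow> amb fls" where
  "exp_h_series m = Abs_fls (\<lambda>i. if i \<ge> 0 then exp_h_coeff m (nat i) else 0)"

lemma exp_h_series_nth:
  "exp_h_series m $$ i = (if i \<ge> 0 then exp_h_coeff m (nat i) else 0)"
  unfolding exp_h_series_def by (rule nth_Abs_fls_lower_bound[of 0]) auto

lemma of_int_amb: "(of_int k :: amb) = cst (of_int k)"
  by (simp add: cst.emb_of_int)

lemma of_nat_amb: "(of_nat k :: amb) = cst (of_nat k)"
  by (simp add: cst.emb_of_nat)

lemma fls_deriv_exp_h_series:
  "fls_deriv (exp_h_series m) = cst1 (of_int m) * h_series 1 * exp_h_series m"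
proof (rule fls_eqI)
  fix i :: int
  consider "i < -1" | "i = -1" | "i \<ge> 0" by linarith
  thus "fls_deriv (exp_h_series m) $$ i = (cst1 (of_int m) * h_series 1 * exp_h_series m) $$ i"
  proof cases
    case 3
    then obtain k where k: "i = int k" by (metis nonneg_int_cases)
    have "(h_series 1 * exp_h_series m) $$ int k = (\<Sum>u\<le>k. h_series 1 $$ int u * exp_h_series m $$ int (k - u))"
      by (rule fls_times_nth_atMost) (auto simp: h_series_nth exp_h_series_nth)
    moreover have "cst (of_nat (Suc k)) * (cst (of_int m / of_nat (Suc k)) * X) = cst (of_int m) * X" for X
      by (simp add: mult.assoc [symmetric] flip: cst.emb_mult del: of_nat_Suc)
    moreover have "h_series 1 $$ int u = cst (of_nat (Suc u)) * xi (Suc u)" for u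
      by (simp add: h_series_nth nat_add_distrib)
    moreover have "exp_h_series m $$ int u = exp_h_coeff m u" for u
      by (simp add: exp_h_series_nth)
    moreover have "fls_deriv (exp_h_series m) $$ int k = cst (of_nat (Suc k)) * exp_h_coeff m (Suc k)"
      by (simp add: of_int_amb exp_h_series_nth nat_add_distrib add.commute del: exp_h_coeff.simps)
    ultimately show ?thesis
      by (simp add: k mult.assoc del: of_nat_Suc of_nat_diff fls_deriv_nth)
  next
    case 1
    have "(h_series 1 * exp_h_series m) $$ i = 0"
      by (rule fls_times_nth_eq_0[of 0 _ 0]) (use 1 in \<open>auto simp: h_series_nth exp_h_series_nth\<close>)
    thus ?thesis using 1 by (simp add: mult.assoc exp_h_series_nth)
  next
    case 2
    have "(h_series 1 * exp_h_series m) $$ i = 0"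
      by (rule fls_times_nth_eq_0[of 0 _ 0]) (use 2 in \<open>auto simp: h_series_nth exp_h_series_nth\<close>)
    thus ?thesis using 2 by (simp add: mult.assoc)
  qed
qed

lemma fls_power_nth_neg: "(\<And>i. i < 0 \<Longrightarrow> f $$ i = 0) \<Longrightarrow> i < 0 \<Longrightarrow> (f ^ n) $$ i = 0"
  for f :: "'a::comm_ring_1 fls"
proof (induction n arbitrary: i)
  case (Suc n)
  show ?case unfolding power_Suc by (rule fls_times_nth_eq_0[of 0 _ 0]) (use Suc in auto)
qed simp

lemma fls_power_nth_0: "(\<And>i. i < 0 \<Longrightarrow> f $$ i = 0) \<Longrightarrow> (f ^ n) $$ 0 = (f $$ 0) ^ n"
  for f :: "'a::comm_ring_1 fls"
proof (induction n)
  case (Suc n)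
  have "(f * f ^ n) $$ int 0 = (\<Sum>u\<le>0. f $$ int u * (f ^ n) $$ int (0 - u))"
    by (rule fls_times_nth_atMost) (use Suc.prems fls_power_nth_neg[of f] in auto)
  thus ?case using Suc by simp
qed simp

lemma exp_xi0_adic_sums: "adic_sums (\<lambda>n. cst (1 / fact n) * (cst (of_int m) * xi 0) ^ n) (exp_xi0 m)"
  using exp_xi0_sums[of m] by (simp add: adic_sums_iff_sums ascale_cst)

text \<open>Identifies the recursive coefficients with the exponential series. The equation
  (f^(n+1))' = (n+1) f' f^n expresses the coefficient of x^(k+1) in the term of index n + 1 by lower
  coefficients in the term of index n; a genuinely infinite sum remains only at x^0.\<close>

lemma exp_h_coeff_adic_sums:
  defines "f \<equiv> \<lambda>m. cst1 (of_int m) * h_series 0"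
  shows "adic_sums (\<lambda>n. cst (1 / fact n) * (f m ^ n) $$ int i) (exp_h_coeff m i)"
proof (induction i rule: less_induct)
  case (less i)
  have neg: "f m $$ j = 0" if "j < 0" for j using that by (simp add: f_def h_series_nth)
  show ?case
  proof (cases i)
    case 0
    have "(f m ^ n) $$ 0 = (cst (of_int m) * xi 0) ^ n" for n
      by (subst fls_power_nth_0[OF neg]) (simp_all add: f_def h_series_nth)
    thus ?thesis using exp_xi0_adic_sums[of m] by (simp add: 0)
  next
    case (Suc k)
    have deriv: "fls_deriv (f m) $$ int j = cst (of_int m) * (cst (of_nat (Suc j)) * xi (Suc j))" for j
      by (simp add: f_def h_series_nth of_int_amb mult_ac nat_add_distrib algebra_simps)
    have "cst (1 / fact (Suc n)) * (f m ^ Suc n) $$ int (Suc k) =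
      cst (of_int m / of_nat (Suc k)) * (\<Sum>j\<le>k. cst (of_nat (Suc j)) * xi (Suc j) *
          (cst (1 / fact n) * (f m ^ n) $$ int (k - j)))" for n
    proof -
      have "cst (of_nat (Suc k)) * (f m ^ Suc n) $$ int (Suc k) = fls_deriv (f m ^ Suc n) $$ int k"
        by (simp only: fls_deriv_nth of_int_amb) (simp add: add.commute del: power_Suc)
      also have "fls_deriv (f m ^ Suc n) = of_nat (Suc n) * (fls_deriv (f m) * f m ^ n)"
        by (simp only: fls_deriv_power) (simp add: mult_ac)
      also have "\<dots> $$ int k = cst (of_nat (Suc n)) * (fls_deriv (f m) * f m ^ n) $$ int k"
        by (metis fls_mult_const_nth(1) fls_of_nat of_nat_amb)
      also have "(fls_deriv (f m) * f m ^ n) $$ int k = (\<Sum>u\<le>k. fls_deriv (f m) $$ int u * (f m ^ n) $$ int (k - u))"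
      proof (rule fls_times_nth_atMost)
        fix j :: int assume "j < 0"
        thus "fls_deriv (f m) $$ j = 0" using neg by (cases "j = -1") auto
      qed (use neg fls_power_nth_neg[of "f m"] in auto)
      finally have *: "cst (of_nat (Suc k)) * (f m ^ Suc n) $$ int (Suc k) = cst (of_nat (Suc n)) *
          (\<Sum>u\<le>k. cst (of_int m) * (cst (of_nat (Suc u)) * xi (Suc u)) * (f m ^ n) $$ int (k - u))"
        by (simp only: deriv)
      have "cst (1 / fact (Suc n)) * (f m ^ Suc n) $$ int (Suc k) =
          cst (1 / fact (Suc n) * (1 / of_nat (Suc k))) * (cst (of_nat (Suc k)) * (f m ^ Suc n) $$ int (Suc k))"
        by (simp add: mult.assoc [symmetric] flip: cst.emb_mult del: of_nat_Suc fact_Suc)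
      also have "\<dots> = cst (1 / fact (Suc n) * (1 / of_nat (Suc k)) * of_nat (Suc n) * of_int m) *
          (\<Sum>u\<le>k. cst (of_nat (Suc u)) * xi (Suc u) * (f m ^ n) $$ int (k - u))"
        by (simp only: * cst.emb_mult sum_distrib_left mult_ac)
      also have "1 / fact (Suc n) * (1 / of_nat (Suc k)) * of_nat (Suc n) * of_int m =
          (of_int m / of_nat (Suc k) * (1 / fact n) :: complex)"
        by (simp add: field_simps del: of_nat_Suc)
      finally show ?thesis
        by (simp only: cst.emb_mult sum_distrib_left mult_ac)
    qed
    moreover have "adic_sums (\<lambda>n. cst (of_int m / of_nat (Suc k)) * (\<Sum>j\<le>k. cst (of_nat (Suc j)) * xi (Suc j) *
          (cst (1 / fact n) * (f m ^ n) $$ int (k - j)))) (exp_h_coeff m (Suc k))"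
      unfolding exp_h_coeff.simps by (rule adic_sums_mult, rule adic_sums_sum, rule adic_sums_mult, rule less.IH) (simp add: Suc)
    ultimately have "adic_sums (\<lambda>n. cst (1 / fact (Suc n)) * (f m ^ Suc n) $$ int (Suc k)) (exp_h_coeff m (Suc k))"
      by (simp only:)
    \<comment> \<open>The term n = 0 is the constant 1, which has no coefficient at x^(k+1).\<close>
    thus ?thesis unfolding Suc by (rule adic_sums_Suc) simp
  qed
qed

lemma op_exp_h_minus: "op_exp (op_scale (of_int m) h_minus) = mult_op (exp_h_series m)"
proof (intro ext)
  fix i l v
  let ?f = "cst1 (of_int m) * h_series 0"
  have h: "h_minus = mult_op (h_series 0)"
    by (intro ext) (auto simp: h_minus_def mult_op_def h_series_nth)
  have pow: "(op_mult (mult_op ?f) ^^ n) op_one = mult_op (?f ^ n)" for n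
    by (induction n) (simp_all add: op_mult_mult_op op_one_eq)
  have "op_exp (op_scale (of_int m) h_minus) i l v = suminf (\<lambda>n. ascale (1 / fact n) (mult_op (?f ^ n) i l v))"
    by (simp add: op_exp_def h op_scale_mult_op pow)
  also have "\<dots> = mult_op (exp_h_series m) i l v"
  proof (cases "l = 0 \<and> i \<ge> 0")
    case True
    then obtain k where k: "i = int k" by (metis nonneg_int_cases)
    have "adic_sums (\<lambda>n. v * (cst (1 / fact n) * (?f ^ n) $$ int k)) (v * exp_h_coeff m k)"
      by (rule adic_sums_mult[OF exp_h_coeff_adic_sums])
    hence "(\<lambda>n. ascale (1 / fact n) (mult_op (?f ^ n) i l v)) sums (v * exp_h_coeff m k)"
      using True by (simp add: adic_sums_iff_sums mult_op_def ascale_cst k mult_ac)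
    thus ?thesis using True by (simp add: sums_iff mult_op_def exp_h_series_nth k mult_ac)
  next
    case False
    have "mult_op (?f ^ n) i l v = 0" for n
      using False fls_power_nth_neg[of ?f i n] by (auto simp: mult_op_def h_series_nth)
    thus ?thesis using False by (auto simp: mult_op_def exp_h_series_nth ascale_cst)
  qed
  finally show "op_exp (op_scale (of_int m) h_minus) i l v = mult_op (exp_h_series m) i l v" .
qed

subsection \<open>Differential operators\<close>

definition h_plus_power :: "int \<Rightarrow> nat \<Rightarrow> opser" where
  "h_plus_power m n = (op_mult (op_scale (of_int m) h_plus) ^^ n) op_one"

text \<open>Since B has no positive powers of x, the factor x^(-r) can reach x^i only for r <= -i,
  and the infinite sum in h^+ becomes finite in every coefficient.\<close>

lemma op_mult_h_plus:
  assumes "\<And>j k v. j > 0 \<Longrightarrow> B j k v = 0"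
  shows "op_mult (op_scale c h_plus) B i l v =
    (if l > 0 then cst (2 * c) * partial_xi 0 (B i (l - 1) v) else 0) +
    (\<Sum>r=1..nat (-i). cst (- 2 * c / of_nat r) * partial_xi r (B (i + int r) l v))"
proof -
  let ?f = "\<lambda>j. (if j = i \<and> l > 0 then cst (2 * c) * partial_xi 0 (B i (l - 1) v) else 0) +
      (if j > i then cst (- 2 * c / of_nat (nat (j - i))) * partial_xi (nat (j - i)) (B j l v) else 0)"
  have inner: "(\<Sum>k\<le>l. op_scale c h_plus (i - j) (l - k) (B j k v)) = ?f j" for j
  proof -
    consider "j < i" | "j = i" | "j > i" by linarith
    thus ?thesis
    proof cases
      case 1
      thus ?thesis by (simp add: op_scale_def h_plus_def ascale_cst)
    next
      case 2
      show ?thesis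
      proof (cases "l > 0")
        case True
        have "(\<Sum>k\<le>l. op_scale c h_plus (i - j) (l - k) (B j k v)) =
            (\<Sum>k\<in>{l - 1}. op_scale c h_plus (i - j) (l - k) (B j k v))"
          using True 2
          by (intro sum.mono_neutral_right) (auto simp: op_scale_def h_plus_def ascale_cst)
        thus ?thesis using True 2
          by (simp add: op_scale_def h_plus_def ascale_cst mult.assoc [symmetric] mult.commute flip: cst.emb_mult)
      next
        case False
        thus ?thesis using 2 by (simp add: op_scale_def h_plus_def ascale_cst)
      qed
    next
      case 3
      have "(\<Sum>k\<le>l. op_scale c h_plus (i - j) (l - k) (B j k v)) =
          (\<Sum>k\<in>{l}. op_scale c h_plus (i - j) (l - k) (B j k v))"
        using 3
        by (intro sum.mono_neutral_right) (auto simp: op_scale_def h_plus_def ascale_cst)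
      thus ?thesis using 3
        by (simp add: op_scale_def h_plus_def ascale_cst mult.assoc [symmetric] mult.commute flip: cst.emb_mult)
    qed
  qed
  have "op_mult (op_scale c h_plus) B i l v = Sum_any ?f"
    by (simp only: op_mult_def inner)
  also have "\<dots> = (\<Sum>j\<in>{i..max i 0}. ?f j)"
  proof (rule Sum_any.expand_superset)
    show "{j. ?f j \<noteq> 0} \<subseteq> {i..max i 0}"
    proof
      fix j assume "j \<in> {j. ?f j \<noteq> 0}"
      hence f: "?f j \<noteq> 0" by simp
      have "j \<ge> i"
      proof (rule ccontr)
        assume "\<not> j \<ge> i"
        with f show False by simp
      qed
      moreover have "j \<le> max i 0"
      proof (rule ccontr)
        assume "\<not> j \<le> max i 0"
        hence "B j l v = 0" "j \<noteq> i" using assms by auto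
        with f show False by (cases "i < j") simp_all
      qed
      ultimately show "j \<in> {i..max i 0}" by simp
    qed
  qed simp
  also have "\<dots> = (\<Sum>j\<in>{i..max i 0}. if j = i \<and> l > 0 then cst (2 * c) * partial_xi 0 (B i (l - 1) v) else 0) +
      (\<Sum>j\<in>{i..max i 0}. if j > i then cst (- 2 * c / of_nat (nat (j - i))) * partial_xi (nat (j - i)) (B j l v) else 0)"
    by (rule sum.distrib)
  also have "(\<Sum>j\<in>{i..max i 0}. if j = i \<and> l > 0 then cst (2 * c) * partial_xi 0 (B i (l - 1) v) else 0) =
      (if l > 0 then cst (2 * c) * partial_xi 0 (B i (l - 1) v) else 0)"
    by (cases "l > 0") (simp_all add: sum.delta)
  also have "(\<Sum>j\<in>{i..max i 0}. if j > i then cst (- 2 * c / of_nat (nat (j - i))) * partial_xi (nat (j - i)) (B j l v) else 0) =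
      (\<Sum>j\<in>(\<lambda>r. i + int r) ` {1..nat (-i)}. cst (- 2 * c / of_nat (nat (j - i))) * partial_xi (nat (j - i)) (B j l v))"
  proof (rule sum.mono_neutral_cong_right)
    show "\<forall>j\<in>{i..max i 0} - (\<lambda>r. i + int r) ` {1..nat (-i)}. (if j > i then
        cst (- 2 * c / of_nat (nat (j - i))) * partial_xi (nat (j - i)) (B j l v) else 0) = 0"
    proof
      fix j assume j: "j \<in> {i..max i 0} - (\<lambda>r. i + int r) ` {1..nat (-i)}"
      have "\<not> j > i"
      proof
        assume "j > i"
        with j have "j = i + int (nat (j - i))" "nat (j - i) \<in> {1..nat (-i)}" by auto
        with j show False by blast
      qed
      thus "(if j > i then cst (- 2 * c / of_nat (nat (j - i))) * partial_xi (nat (j - i)) (B j l v) else 0) = 0"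
        by simp
    qed
  qed auto
  also have "\<dots> = (\<Sum>r=1..nat (-i). cst (- 2 * c / of_nat r) * partial_xi r (B (i + int r) l v))"
    by (subst sum.reindex) (auto intro!: inj_onI)
  finally show ?thesis .
qed

lemma h_plus_power_pos: "j > 0 \<Longrightarrow> h_plus_power m n j k v = 0"
proof (induction n arbitrary: j k v)
  case 0
  thus ?case by (simp add: h_plus_power_def op_one_def)
next
  case (Suc n)
  have "h_plus_power m (Suc n) = op_mult (op_scale (of_int m) h_plus) (h_plus_power m n)"
    by (simp add: h_plus_power_def)
  thus ?case using Suc by (simp add: op_mult_h_plus)
qed

lemma h_plus_power_0: "h_plus_power m 0 i l v = (if i = 0 \<and> l = 0 then v else 0)"
  by (simp add: h_plus_power_def op_one_def)

lemma h_plus_power_Suc: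
  "h_plus_power m (Suc n) i l v =
    (if l > 0 then cst (2 * of_int m) * partial_xi 0 (h_plus_power m n i (l - 1) v) else 0) +
    (\<Sum>r=1..nat (-i). cst (- 2 * of_int m / of_nat r) * partial_xi r (h_plus_power m n (i + int r) l v))"
proof -
  have "h_plus_power m (Suc n) = op_mult (op_scale (of_int m) h_plus) (h_plus_power m n)"
    by (simp add: h_plus_power_def)
  thus ?thesis by (simp add: op_mult_h_plus h_plus_power_pos)
qed

text \<open>Each factor h^+ contributes log x or a negative power of x, and so raises l - i by at
  least one. Hence every coefficient of the exponential is a finite sum.\<close>

lemma h_plus_power_eq_0: "int n > int l - i \<Longrightarrow> h_plus_power m n i l v = 0"
proof (induction n arbitrary: i l)
  case 0
  thus ?case by (auto simp: h_plus_power_0)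
next
  case (Suc n)
  have "h_plus_power m n (i + int r) l v = 0" if "r \<ge> 1" for r
    using Suc.prems that by (intro Suc.IH) simp
  moreover have "h_plus_power m n i (l - 1) v = 0" if "l > 0"
    using Suc.prems that by (intro Suc.IH) simp
  ultimately show ?case by (simp add: h_plus_power_Suc)
qed

lemma h_plus_power_add: "h_plus_power m n i l (v + w) = h_plus_power m n i l v + h_plus_power m n i l w"
proof (induction n arbitrary: i l)
  case (Suc n)
  show ?case by (simp add: h_plus_power_Suc Suc partial_xi_add distrib_left sum.distrib)
qed (simp add: h_plus_power_0)

lemma h_plus_power_cst: "h_plus_power m n i l (cst c * v) = cst c * h_plus_power m n i l v"
proof (induction n arbitrary: i l)
  case (Suc n)
  show ?case
    by (simp add: h_plus_power_Suc Suc partial_xi_cst distrib_left sum_distrib_left mult.left_commute[of _ "cst c"])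
qed (simp add: h_plus_power_0)

lemma h_plus_power_partial: "h_plus_power m n i l (partial_xi k v) = partial_xi k (h_plus_power m n i l v)"
proof (induction n arbitrary: i l)
  case (Suc n)
  show ?case
    by (simp add: h_plus_power_Suc Suc partial_xi_add partial_xi_sum partial_xi_cst partial_xi_commute[of k])
qed (simp add: h_plus_power_0)

text \<open>The commutator of m h^+(x) with xi_k is the scalar -2m x^(-k)/k, which commutes with
  everything; moving xi_k through n + 1 factors therefore produces it n + 1 times. The index
  \<open>i + int k\<close> encodes the factor x^(-k).\<close>

lemma h_plus_power_xi:
  assumes "k \<ge> 1"
  shows "h_plus_power m (Suc n) i l (xi k * v) = xi k * h_plus_power m (Suc n) i l v
    - cst (2 * of_int m * of_nat (Suc n) / of_nat k) * h_plus_power m n (i + int k) l v"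
proof (induction n arbitrary: i l)
  case 0
  have "(\<Sum>r=1..nat (-i). cst (- 2 * of_int m / of_nat r) *
      partial_xi r (if i + int r = 0 \<and> l = 0 then xi k * v else 0)) =
      (\<Sum>r=1..nat (-i). cst (- 2 * of_int m / of_nat r) * (if i + int r = 0 \<and> l = 0 \<and> r = k then v else 0)
      + xi k * (cst (- 2 * of_int m / of_nat r) * partial_xi r (if i + int r = 0 \<and> l = 0 then v else 0)))"
    by (rule sum.cong) (auto simp: partial_xi_xi_mult[OF assms] distrib_left mult.left_commute)
  also have "\<dots> = (if i + int k = 0 \<and> l = 0 then cst (- 2 * of_int m / of_nat k) * v else 0)
      + xi k * (\<Sum>r=1..nat (-i). cst (- 2 * of_int m / of_nat r) * partial_xi r (if i + int r = 0 \<and> l = 0 then v else 0))"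
  proof -
    have "(\<Sum>r=1..nat (-i). cst (- 2 * of_int m / of_nat r) * (if i + int r = 0 \<and> l = 0 \<and> r = k then v else 0)) =
        (\<Sum>r=1..nat (-i). if r = k then (if i + int k = 0 \<and> l = 0 then cst (- 2 * of_int m / of_nat k) * v else 0) else 0)"
      by (rule sum.cong) auto
    also have "\<dots> = (if i + int k = 0 \<and> l = 0 then cst (- 2 * of_int m / of_nat k) * v else 0)"
      using assms by (auto simp: sum.delta)
    finally show ?thesis by (simp add: sum.distrib sum_distrib_left)
  qed
  finally show ?case
    using assms by (auto simp: h_plus_power_Suc h_plus_power_0 partial_xi_xi_mult cst.emb_minus distrib_left mult.left_commute)
next
  case (Suc n)
  let ?h = "h_plus_power m"
  let ?c = "cst (2 * of_int m * of_nat (Suc n) / of_nat k)"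
  let ?d = "\<lambda>r. cst (- 2 * of_int m / of_nat r)"
  have A: "(if l > 0 then cst (2 * of_int m) * partial_xi 0 (?h (Suc n) i (l - 1) (xi k * v)) else 0) =
    xi k * (if l > 0 then cst (2 * of_int m) * partial_xi 0 (?h (Suc n) i (l - 1) v) else 0)
    - ?c * (if l > 0 then cst (2 * of_int m) * partial_xi 0 (?h n (i + int k) (l - 1) v) else 0)"
  proof -
    have diff: "partial_xi 0 (a - cst c * b) = partial_xi 0 a - cst c * partial_xi 0 b" for a b c
      using partial_xi_add[of 0 "a - cst c * b" "cst c * b"] by (simp add: partial_xi_cst eq_diff_eq)
    show ?thesis
      using assms by (simp add: Suc diff partial_xi_xi_mult right_diff_distrib mult.left_commute del: of_nat_Suc)
  qed
  have diff: "partial_xi r (a - cst c * b) = partial_xi r a - cst c * partial_xi r b" for a b c r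
    using partial_xi_add[of r "a - cst c * b" "cst c * b"] by (simp add: partial_xi_cst eq_diff_eq)
  have "(\<Sum>r=1..nat (-i). ?d r * partial_xi r (?h (Suc n) (i + int r) l (xi k * v))) =
    (\<Sum>r=1..nat (-i). (if r = k then ?d k * ?h (Suc n) (i + int k) l v else 0)
      + xi k * (?d r * partial_xi r (?h (Suc n) (i + int r) l v))
      - ?c * (?d r * partial_xi r (?h n (i + int k + int r) l v)))"
    by (rule sum.cong)
      (auto simp: Suc diff partial_xi_xi_mult[OF assms] right_diff_distrib distrib_left mult.left_commute add_ac
        simp del: of_nat_Suc)
  also have "\<dots> = (\<Sum>r=1..nat (-i). if r = k then ?d k * ?h (Suc n) (i + int k) l v else 0)
      + xi k * (\<Sum>r=1..nat (-i). ?d r * partial_xi r (?h (Suc n) (i + int r) l v))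
      - ?c * (\<Sum>r=1..nat (-i). ?d r * partial_xi r (?h n (i + int k + int r) l v))"
    by (simp only: sum_subtractf sum.distrib sum_distrib_left)
  \<comment> \<open>If k lies beyond the range of r, then i + k > 0 and the right-hand side vanishes
    as well.\<close>
  also have "(\<Sum>r=1..nat (-i). if r = k then ?d k * ?h (Suc n) (i + int k) l v else 0) =
      ?d k * ?h (Suc n) (i + int k) l v"
    using assms by (auto simp: sum.delta h_plus_power_pos)
  also have "(\<Sum>r=1..nat (-i). ?d r * partial_xi r (?h n (i + int k + int r) l v)) =
      (\<Sum>r=1..nat (-(i + int k)). ?d r * partial_xi r (?h n (i + int k + int r) l v))"
    by (rule sum.mono_neutral_right) (auto simp: h_plus_power_pos)
  finally have B: "(\<Sum>r=1..nat (-i). ?d r * partial_xi r (?h (Suc n) (i + int r) l (xi k * v))) =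
      ?d k * ?h (Suc n) (i + int k) l v
      + xi k * (\<Sum>r=1..nat (-i). ?d r * partial_xi r (?h (Suc n) (i + int r) l v))
      - ?c * (\<Sum>r=1..nat (-(i + int k)). ?d r * partial_xi r (?h n (i + int k + int r) l v))" .
  have C: "?d k * X - ?c * X = - (cst (2 * of_int m * of_nat (Suc (Suc n)) / of_nat k) * X)" for X
  proof -
    have "- 2 * of_int m / of_nat k - 2 * of_int m * of_nat (Suc n) / of_nat k =
        - (2 * of_int m * of_nat (Suc (Suc n)) / of_nat k :: complex)"
      using assms by (simp add: field_simps)
    hence "?d k - ?c = - cst (2 * of_int m * of_nat (Suc (Suc n)) / of_nat k)"
      by (metis cst.emb_diff cst.emb_minus)
    thus ?thesis by (simp only: left_diff_distrib [symmetric]) (simp del: of_nat_Suc)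
  qed
  have "?h (Suc (Suc n)) i l (xi k * v) = xi k * ?h (Suc (Suc n)) i l v
      + ?d k * ?h (Suc n) (i + int k) l v - ?c * ?h (Suc n) (i + int k) l v"
    unfolding h_plus_power_Suc[of m "Suc n"] A B h_plus_power_Suc[of m n "i + int k" l v]
    by (simp only: distrib_left algebra_simps)
  thus ?case using C[of "?h (Suc n) (i + int k) l v"] by (simp add: add_diff_eq [symmetric] del: of_nat_Suc)
qed

text \<open>On e^(q xi_0) every d/dxi_r with r >= 1 is zero and d/dxi_0 is q, so m h^+(x) acts as
  the multiple 2mq log x.\<close>

lemma h_plus_power_exp:
  "h_plus_power m n i l (exp_xi0 q) = (if i = 0 \<and> l = n then cst ((2 * of_int m * of_int q) ^ n) * exp_xi0 q else 0)"
proof (induction n arbitrary: i l)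
  case 0
  show ?case by (auto simp: h_plus_power_0)
next
  case (Suc n)
  have "(\<Sum>r=1..nat (-i). cst (- 2 * of_int m / of_nat r) * partial_xi r (h_plus_power m n (i + int r) l (exp_xi0 q))) = 0"
    by (rule sum.neutral) (auto simp: Suc partial_xi_cst partial_xi_exp)
  moreover have "cst (2 * of_int m) * (cst ((2 * of_int m * of_int q) ^ n) * (cst (of_int q) * X)) =
      cst ((2 * of_int m * of_int q) ^ Suc n) * X" for X
    by (simp add: mult.assoc [symmetric] flip: cst.emb_mult) (simp add: mult_ac)
  ultimately show ?case
    by (auto simp: h_plus_power_Suc Suc partial_xi_cst partial_xi_exp simp del: power_Suc)
qed

section \<open>The operator series e^(m h^+(x))\<close>

definition exp_h_plus :: "int \<Rightarrow> opser" where
  "exp_h_plus m = op_exp (op_scale (of_int m) h_plus)"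

lemma exp_h_plus_eq:
  assumes "int N > int l - i"
  shows "exp_h_plus m i l v = (\<Sum>n<N. cst (1 / fact n) * h_plus_power m n i l v)"
proof -
  have "exp_h_plus m i l v = suminf (\<lambda>n. cst (1 / fact n) * h_plus_power m n i l v)"
    by (simp add: exp_h_plus_def op_exp_def ascale_cst h_plus_power_def)
  also have "\<dots> = (\<Sum>n<N. cst (1 / fact n) * h_plus_power m n i l v)"
    using assms by (intro suminf_finite) (auto simp: h_plus_power_eq_0)
  finally show ?thesis .
qed

lemma exp_h_plus_pos: "i > 0 \<Longrightarrow> exp_h_plus m i l v = 0"
  using exp_h_plus_eq[of l i "Suc l" m v] by (simp add: h_plus_power_pos)

lemma exp_h_plus_add: "exp_h_plus m i l (v + w) = exp_h_plus m i l v + exp_h_plus m i l w"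
  using exp_h_plus_eq[of l i "nat (int l - i + 1)" m]
  by (simp add: h_plus_power_add distrib_left sum.distrib)

lemma exp_h_plus_cst: "exp_h_plus m i l (cst c * v) = cst c * exp_h_plus m i l v"
  using exp_h_plus_eq[of l i "nat (int l - i + 1)" m]
  by (simp add: h_plus_power_cst sum_distrib_left mult.left_commute[of _ "cst c"])

lemma exp_h_plus_partial: "exp_h_plus m i l (partial_xi k v) = partial_xi k (exp_h_plus m i l v)"
  using exp_h_plus_eq[of l i "nat (int l - i + 1)" m]
  by (simp add: h_plus_power_partial partial_xi_sum partial_xi_cst)

lemma exp_h_plus_exp:
  "exp_h_plus m i l (exp_xi0 q) = (if i = 0 then cst ((2 * of_int m * of_int q) ^ l / fact l) * exp_xi0 q else 0)"
proof -
  let ?N = "nat (\<bar>int l - i\<bar> + int l + 1)"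
  have "exp_h_plus m i l (exp_xi0 q) = (\<Sum>n<?N. cst (1 / fact n) * h_plus_power m n i l (exp_xi0 q))"
    by (rule exp_h_plus_eq) auto
  also have "\<dots> = (\<Sum>n<?N. if n = l then (if i = 0 then cst ((2 * of_int m * of_int q) ^ l / fact l) * exp_xi0 q else 0) else 0)"
    by (rule sum.cong) (auto simp: h_plus_power_exp mult.assoc [symmetric] simp flip: cst.emb_mult)
  also have "\<dots> = (if i = 0 then cst ((2 * of_int m * of_int q) ^ l / fact l) * exp_xi0 q else 0)"
    by (auto simp: sum.delta)
  finally show ?thesis .
qed

text \<open>Dividing \<open>h_plus_power_xi\<close> by (n+1)! turns the n + 1 contractions into one
  contraction times the previous term of the exponential series.\<close>

lemma exp_h_plus_xi:
  assumes "k \<ge> 1"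
  shows "exp_h_plus m i l (xi k * v) = xi k * exp_h_plus m i l v
    - cst (2 * of_int m / of_nat k) * exp_h_plus m (i + int k) l v"
proof -
  let ?N = "nat (\<bar>int l - i\<bar> + int k + int l + 1)"
  let ?h = "h_plus_power m"
  have "exp_h_plus m i l (xi k * v) = (\<Sum>n<Suc ?N. cst (1 / fact n) * ?h n i l (xi k * v))"
    by (rule exp_h_plus_eq) auto
  also have "\<dots> = ?h 0 i l (xi k * v) + (\<Sum>n<?N. cst (1 / fact (Suc n)) * ?h (Suc n) i l (xi k * v))"
    by (subst sum.lessThan_Suc_shift) simp
  also have "?h 0 i l (xi k * v) = xi k * ?h 0 i l v"
    by (simp add: h_plus_power_0)
  also have "(\<Sum>n<?N. cst (1 / fact (Suc n)) * ?h (Suc n) i l (xi k * v)) =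
      (\<Sum>n<?N. xi k * (cst (1 / fact (Suc n)) * ?h (Suc n) i l v)
        - cst (2 * of_int m / of_nat k) * (cst (1 / fact n) * ?h n (i + int k) l v))"
  proof (rule sum.cong)
    fix n
    have "1 / fact (Suc n) * (2 * of_int m * of_nat (Suc n) / of_nat k) =
        (2 * of_int m / of_nat k * (1 / fact n) :: complex)"
      using assms by (simp add: field_simps del: of_nat_Suc)
    hence "cst (1 / fact (Suc n)) * cst (2 * of_int m * of_nat (Suc n) / of_nat k) =
        cst (2 * of_int m / of_nat k) * cst (1 / fact n)"
      by (metis cst.emb_mult)
    hence "cst (1 / fact (Suc n)) * (cst (2 * of_int m * of_nat (Suc n) / of_nat k) * X) =
        cst (2 * of_int m / of_nat k) * (cst (1 / fact n) * X)" for X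
      by (simp only: mult.assoc [symmetric])
    thus "cst (1 / fact (Suc n)) * ?h (Suc n) i l (xi k * v) =
        xi k * (cst (1 / fact (Suc n)) * ?h (Suc n) i l v)
        - cst (2 * of_int m / of_nat k) * (cst (1 / fact n) * ?h n (i + int k) l v)"
      by (simp only: h_plus_power_xi[OF assms] right_diff_distrib mult.left_commute[of "xi k"])
  qed simp
  also have "xi k * ?h 0 i l v + \<dots> =
      xi k * (?h 0 i l v + (\<Sum>n<?N. cst (1 / fact (Suc n)) * ?h (Suc n) i l v))
      - cst (2 * of_int m / of_nat k) * (\<Sum>n<?N. cst (1 / fact n) * ?h n (i + int k) l v)"
    by (simp only: sum_subtractf sum_distrib_left distrib_left add_diff_eq)
  also have "?h 0 i l v + (\<Sum>n<?N. cst (1 / fact (Suc n)) * ?h (Suc n) i l v) =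
      (\<Sum>n<Suc ?N. cst (1 / fact n) * ?h n i l v)"
    by (subst sum.lessThan_Suc_shift) simp
  also have "\<dots> = exp_h_plus m i l v"
    by (rule exp_h_plus_eq [symmetric]) auto
  also have "(\<Sum>n<?N. cst (1 / fact n) * ?h n (i + int k) l v) = exp_h_plus m (i + int k) l v"
    by (rule exp_h_plus_eq [symmetric]) auto
  finally show ?thesis .
qed

lemma exp_h_plus_lower_bound: "v \<in> Xi \<Longrightarrow> \<exists>J. \<forall>i<J. \<forall>l. exp_h_plus m i l v = 0"
proof (induction v rule: Xi_induct_gen)
  case (exp q)
  show ?case by (rule exI[of _ 0]) (simp add: exp_h_plus_exp)
next
  case (xi n v)
  then obtain J where "\<forall>i<J. \<forall>l. exp_h_plus m i l v = 0" by blast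
  thus ?case using xi by (intro exI[of _ "J - int n"]) (simp add: exp_h_plus_xi)
next
  case (add v w)
  then obtain I J where "\<forall>i<I. \<forall>l. exp_h_plus m i l v = 0" "\<forall>i<J. \<forall>l. exp_h_plus m i l w = 0" by blast
  thus ?case by (intro exI[of _ "min I J"]) (simp add: exp_h_plus_add)
next
  case (scale c v)
  then obtain J where "\<forall>i<J. \<forall>l. exp_h_plus m i l v = 0" by blast
  thus ?case by (intro exI[of _ J]) (simp add: exp_h_plus_cst)
qed

text \<open>
  Series of differential operators with constant coefficients, as they occur on the right of a
  normally ordered product.
\<close>

definition diff_op :: "opser \<Rightarrow> bool" where
  "diff_op D \<longleftrightarrow> (\<forall>i>0. \<forall>l v. D i l v = 0) \<and> (\<forall>i l v w. D i l (v + w) = D i l v + D i l w) \<and>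
     (\<forall>i l c v. D i l (cst c * v) = cst c * D i l v) \<and>
     (\<forall>i l k v. D i l (partial_xi k v) = partial_xi k (D i l v)) \<and>
     (\<forall>v\<in>Xi. \<exists>J. \<forall>i<J. \<forall>l. D i l v = 0)"

lemma diff_op_exp_h_plus: "diff_op (exp_h_plus m)"
  by (simp add: diff_op_def exp_h_plus_pos exp_h_plus_add exp_h_plus_cst exp_h_plus_partial exp_h_plus_lower_bound)

lemma diff_op_0: "diff_op D \<Longrightarrow> D i l 0 = 0"
  unfolding diff_op_def by (metis cst.emb_0 mult_zero_left)

definition op_series :: "opser \<Rightarrow> nat \<Rightarrow> amb \<Rightarrow> amb fls" where
  "op_series D l v = Abs_fls (\<lambda>i. D i l v)"

lemma op_series_nth:
  assumes "diff_op D" "v \<in> Xi"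
  shows "op_series D l v $$ i = D i l v"
proof -
  obtain J where "\<forall>i<J. \<forall>l. D i l v = 0"
    using assms unfolding diff_op_def by blast
  thus ?thesis unfolding op_series_def by (intro nth_Abs_fls_lower_bound[of J]) auto
qed

text \<open>
  The coefficient of \<open>x^(-n-k) \<partial>/\<partial>\<xi>\<^sub>k\<close> in \<open>(d/dx)^n h^+(x) / n!\<close>; a junk value for \<open>n = k = 0\<close>, where this
  coefficient is \<open>2 log x\<close>.
\<close>

definition h_coeff :: "nat \<Rightarrow> nat \<Rightarrow> complex" where
  "h_coeff n k = 2 * (-1) ^ Suc n * fact (n + k - 1) / (fact n * fact k)"

abbreviation h_term :: "nat \<Rightarrow> nat \<Rightarrow> amb fls" where
  "h_term n k \<equiv> cst1 (h_coeff n k) * fls_Xp (- int n - int k)"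

text \<open>One derivative removes the logarithm: 2 log x becomes 2 x^(-1), which fits the general
  pattern at k = 0. This is why the formula starts at n = 1.\<close>

lemma op_deriv_h_plus:
  assumes "n \<ge> 1"
  shows "(op_deriv ^^ n) h_plus i l v = (if l = 0 \<and> i \<le> - int n
    then cst (fact n * h_coeff n (nat (- i - int n))) * partial_xi (nat (- i - int n)) v else 0)"
  using assms
proof (induction n arbitrary: i l v rule: nat_induct_at_least)
  case base
  have h: "h_coeff 1 k = 2" for k by (simp add: h_coeff_def)
  have "of_int (i + 1) * (- 2 / of_nat (nat (- (i + 1)))) = (2 :: complex)" if "i < -1"
  proof -
    have "(of_nat (nat (- (i + 1))) :: complex) = - of_int (i + 1)" using that by simp
    moreover have "(of_int (i + 1) :: complex) \<noteq> 0" using that by (simp del: of_int_add)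
    ultimately show ?thesis by (simp add: field_simps del: of_int_add)
  qed
  hence *: "cst (of_int (i + 1)) * (cst (- 2 / of_nat (nat (- (i + 1)))) * w) = cst 2 * w" if "i < -1" for w
    using that by (simp add: mult.assoc [symmetric] flip: cst.emb_mult)
  have step: "op_deriv h_plus i l v = cst (of_int (i + 1)) * h_plus (i + 1) l v + cst (of_nat (l + 1)) * h_plus (i + 1) (l + 1) v"
    by (simp only: op_deriv_def ascale_cst)
  consider "i < -1" | "i = -1" | "i > -1" by linarith
  thus ?case
  proof cases
    case 1
    have "nat (- (i + 1)) = nat (- i - 1)" by simp
    thus ?thesis using 1 unfolding funpow.simps One_nat_def o_apply id_apply step
      using *[OF 1, of "partial_xi (nat (- i - 1)) v"]
      by (simp add: h [unfolded One_nat_def] h_plus_def ascale_cst del: of_nat_nat)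
  next
    case 2
    thus ?thesis unfolding funpow.simps One_nat_def o_apply id_apply step by (simp add: h [unfolded One_nat_def] h_plus_def ascale_cst)
  next
    case 3
    thus ?thesis unfolding funpow.simps One_nat_def o_apply id_apply step by (simp add: h [unfolded One_nat_def] h_plus_def ascale_cst)
  qed
next
  case (Suc n)
  have step: "(op_deriv ^^ Suc n) h_plus i l v = cst (of_int (i + 1)) * (op_deriv ^^ n) h_plus (i + 1) l v
      + cst (of_nat (l + 1)) * (op_deriv ^^ n) h_plus (i + 1) (l + 1) v"
    by (simp only: funpow.simps o_apply ascale_cst) (simp only: op_deriv_def ascale_cst)
  show ?case
  proof (cases "l = 0 \<and> i \<le> - int (Suc n)")
    case True
    define k where "k = nat (- i - int (Suc n))"
    have i: "i = - int (Suc n + k)" using True by (simp add: k_def)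
    have k: "nat (- (i + 1) - int n) = k" by (simp add: k_def)
    obtain n' where n': "n = Suc n'" using Suc.hyps by (cases n) auto
    have "of_int (i + 1) * (fact n * h_coeff n k) = (fact (Suc n) * h_coeff (Suc n) k :: complex)"
      by (simp add: i h_coeff_def n' field_simps del: of_nat_Suc) (simp add: algebra_simps)
    hence "cst (of_int (i + 1)) * (cst (fact n * h_coeff n k) * partial_xi k v) = cst (fact (Suc n) * h_coeff (Suc n) k) * partial_xi k v"
      by (simp only: mult.assoc [symmetric] flip: cst.emb_mult)
    thus ?thesis using True unfolding step Suc.IH k by (simp add: k_def del: fact_Suc of_int_add)
  next
    case False
    thus ?thesis unfolding step Suc.IH by auto
  qed
qed

definition diff_h :: "nat \<Rightarrow> opser" where
  "diff_h n = op_scale (1 / fact n) ((op_deriv ^^ n) h_plus)"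

lemma diff_h_eq:
  "n \<ge> 1 \<Longrightarrow> diff_h n i l v = (if l = 0 \<and> i \<le> - int n
    then cst (h_coeff n (nat (- i - int n))) * partial_xi (nat (- i - int n)) v else 0)"
  by (simp add: diff_h_def op_scale_def op_deriv_h_plus ascale_cst mult.assoc [symmetric] flip: cst.emb_mult)

lemma op_mult_diff_h:
  assumes n: "n \<ge> 1" and D: "\<And>j l v. j > 0 \<Longrightarrow> D j l v = 0" and K: "i + int n + int K > 0"
  shows "op_mult (diff_h n) D i l v = (\<Sum>k<K. cst (h_coeff n k) * partial_xi k (D (i + int n + int k) l v))"
proof -
  let ?f = "\<lambda>j. diff_h n (i - j) 0 (D j l v)"
  have inner: "(\<Sum>k\<le>l. diff_h n (i - j) (l - k) (D j k v)) = ?f j" for j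
  proof -
    have "(\<Sum>k\<le>l. diff_h n (i - j) (l - k) (D j k v)) = (\<Sum>k\<in>{l}. diff_h n (i - j) (l - k) (D j k v))"
      by (rule sum.mono_neutral_right) (auto simp: diff_h_eq[OF n])
    thus ?thesis by simp
  qed
  have "op_mult (diff_h n) D i l v = Sum_any ?f"
    by (simp only: op_mult_def inner)
  also have "\<dots> = (\<Sum>j\<in>(\<lambda>k. i + int n + int k) ` {..<K}. ?f j)"
  proof (rule Sum_any.expand_superset)
    show "{j. ?f j \<noteq> 0} \<subseteq> (\<lambda>k. i + int n + int k) ` {..<K}"
    proof
      fix j assume "j \<in> {j. ?f j \<noteq> 0}"
      hence f: "?f j \<noteq> 0" by simp
      hence "D j l v \<noteq> 0" by (auto simp: diff_h_eq[OF n] split: if_splits)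
      hence "j \<le> 0" using D by force
      moreover have "i - j \<le> - int n" using f by (auto simp: diff_h_eq[OF n] split: if_splits)
      ultimately show "j \<in> (\<lambda>k. i + int n + int k) ` {..<K}"
        using K by (intro image_eqI[of _ _ "nat (j - i - int n)"]) auto
    qed
  qed auto
  also have "\<dots> = (\<Sum>k<K. ?f (i + int n + int k))"
    by (subst sum.reindex) (auto intro!: inj_onI)
  also have "\<dots> = (\<Sum>k<K. cst (h_coeff n k) * partial_xi k (D (i + int n + int k) l v))"
    by (rule sum.cong) (auto simp: diff_h_eq[OF n])
  finally show ?thesis .
qed

lemma diff_op_nth_partial: "diff_op D \<Longrightarrow> D i l (partial_xi k v) = partial_xi k (D i l v)"
  by (simp add: diff_op_def)

text \<open>The sum over k is finite for two reasons. The absence of positive powers of x gives a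
  bound that depends on i; vanishing derivatives of v give a bound uniform in i, and only such a
  bound yields an identity between Laurent series.\<close>

lemma op_mult_diff_h_partial:
  assumes "n \<ge> 1" "diff_op D" "\<And>k. k \<ge> K \<Longrightarrow> partial_xi k v = 0"
  shows "op_mult (diff_h n) D i l v = (\<Sum>k<K. cst (h_coeff n k) * D (i + int n + int k) l (partial_xi k v))"
proof -
  define L where "L = max K (nat (1 - i - int n))"
  have "op_mult (diff_h n) D i l v = (\<Sum>k<L. cst (h_coeff n k) * partial_xi k (D (i + int n + int k) l v))"
    by (rule op_mult_diff_h) (use assms in \<open>auto simp: diff_op_def L_def\<close>)
  also have "\<dots> = (\<Sum>k<L. cst (h_coeff n k) * D (i + int n + int k) l (partial_xi k v))"
    using assms(2) by (simp add: diff_op_nth_partial)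
  also have "\<dots> = (\<Sum>k<K. cst (h_coeff n k) * D (i + int n + int k) l (partial_xi k v))"
    by (rule sum.mono_neutral_right) (use assms in \<open>auto simp: L_def diff_op_0\<close>)
  finally show ?thesis .
qed

lemma diff_op_mult_diff_h:
  assumes n: "n \<ge> 1" and D: "diff_op D"
  shows "diff_op (op_mult (diff_h n) D)"
proof -
  have eq: "op_mult (diff_h n) D i l v =
      (\<Sum>k<nat (1 - i - int n). cst (h_coeff n k) * partial_xi k (D (i + int n + int k) l v))" for i l v
    by (rule op_mult_diff_h) (use assms in \<open>auto simp: diff_op_def\<close>)
  show ?thesis
    unfolding diff_op_def
  proof (intro conjI allI ballI impI)
    fix i :: int and l v assume "i > 0"
    thus "op_mult (diff_h n) D i l v = 0" using n by (simp add: eq)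
  next
    fix i l v w
    show "op_mult (diff_h n) D i l (v + w) = op_mult (diff_h n) D i l v + op_mult (diff_h n) D i l w"
      using D by (simp add: eq diff_op_def partial_xi_add distrib_left sum.distrib)
  next
    fix i l c v
    show "op_mult (diff_h n) D i l (cst c * v) = cst c * op_mult (diff_h n) D i l v"
      using D by (simp add: eq diff_op_def partial_xi_cst sum_distrib_left mult.left_commute[of _ "cst c"])
  next
    fix i l k v
    show "op_mult (diff_h n) D i l (partial_xi k v) = partial_xi k (op_mult (diff_h n) D i l v)"
      using D by (simp add: eq diff_op_def partial_xi_cst partial_xi_sum partial_xi_commute[of k])
  next
    fix v assume v: "v \<in> Xi"
    then obtain K where K: "\<forall>k\<ge>K. partial_xi k v = 0" using partial_xi_eventually_0 by blast
    obtain J where J: "\<forall>i<J. \<forall>l. D i l v = 0" using D v by (auto simp: diff_op_def)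
    have "op_mult (diff_h n) D i l v = 0" if "i < J - int n - int K" for i l
    proof -
      have "op_mult (diff_h n) D i l v = (\<Sum>k<K. cst (h_coeff n k) * D (i + int n + int k) l (partial_xi k v))"
        by (rule op_mult_diff_h_partial) (use n D K in auto)
      also have "\<dots> = 0"
        using D J that by (intro sum.neutral) (auto simp: diff_op_nth_partial)
      finally show ?thesis .
    qed
    thus "\<exists>J. \<forall>i<J. \<forall>l. op_mult (diff_h n) D i l v = 0" by blast
  qed
qed

lemma op_series_mult_diff_h:
  assumes "n \<ge> 1" "diff_op D" "v \<in> Xi" "\<And>k. k \<ge> K \<Longrightarrow> partial_xi k v = 0"
  shows "op_series (op_mult (diff_h n) D) l v =
    (\<Sum>k<K. h_term n k * op_series D l (partial_xi k v))"
proof (rule fls_eqI)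
  fix i
  have "op_series (op_mult (diff_h n) D) l v $$ i = op_mult (diff_h n) D i l v"
    by (rule op_series_nth) (use assms diff_op_mult_diff_h in auto)
  also have "\<dots> = (\<Sum>k<K. cst (h_coeff n k) * D (i + int n + int k) l (partial_xi k v))"
    by (rule op_mult_diff_h_partial) (use assms in auto)
  finally show "op_series (op_mult (diff_h n) D) l v $$ i =
      (\<Sum>k<K. h_term n k * op_series D l (partial_xi k v)) $$ i"
    using assms by (simp add: fls_sum_nth mult.assoc op_series_nth partial_xi_in_Xi algebra_simps)
qed

subsection \<open>Normally ordered products\<close>

text \<open>The expanded normally ordered product: each h_n contributes either its multiplication
  part or its differential part, and the multiplication operators of a summand are already combined
  into one Laurent series.\<close>

fun nord_factors :: "int \<Rightarrow> nat list \<Rightarrow> (amb fls \<times> opser) list" where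
  "nord_factors m [] = [(exp_h_series m, exp_h_plus m)]"
| "nord_factors m (n # ns) = map (\<lambda>(f, D). (h_series n * f, D)) (nord_factors m ns) @
     map (\<lambda>(f, D). (f, op_mult (diff_h n) D)) (nord_factors m ns)"

lemma foldr_nord_mult:
  "foldr nord_mult (map nord_h ns) (nord_exp m) = map (\<lambda>(f, D). (mult_op f, D)) (nord_factors m ns)"
proof (induction ns)
  case Nil
  show ?case by (simp add: nord_exp_def op_exp_h_minus exp_h_plus_def)
next
  case (Cons n ns)
  have h: "nord_h n = [(mult_op (h_series n), op_one), (op_one, diff_h n)]"
    by (simp add: nord_h_def nord_h_minus diff_h_def)
  have step: "foldr nord_mult (map nord_h (n # ns)) (nord_exp m) =
      nord_mult (nord_h n) (map (\<lambda>(f, D). (mult_op f, D)) (nord_factors m ns))"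
    by (simp only: list.map foldr.simps o_apply Cons)
  show ?case
    unfolding step h by (simp add: nord_mult_def case_prod_beta' comp_def op_mult_mult_op op_mult_one)
qed

lemma diff_op_nord_factors:
  "\<forall>n\<in>set ns. n \<ge> 1 \<Longrightarrow> (f, D) \<in> set (nord_factors m ns) \<Longrightarrow> diff_op D"
proof (induction ns arbitrary: f D)
  case Nil
  thus ?case by (simp add: diff_op_exp_h_plus)
next
  case (Cons n ns)
  thus ?case by (auto intro!: diff_op_mult_diff_h)
qed

definition nord_series :: "int \<Rightarrow> nat list \<Rightarrow> nat \<Rightarrow> amb \<Rightarrow> amb fls" where
  "nord_series m ns l v = (\<Sum>(f, D)\<leftarrow>nord_factors m ns. f * op_series D l v)"

lemma sum_list_fls_nth: "(\<Sum>x\<leftarrow>xs. F x) $$ i = (\<Sum>x\<leftarrow>xs. F x $$ i)"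
  by (induction xs) auto

lemma nord_op_eq:
  assumes "\<forall>n\<in>set ns. n \<ge> 1" "v \<in> Xi"
  shows "nord_op (foldr nord_mult (map nord_h ns) (nord_exp m)) i l v = nord_series m ns l v $$ i"
proof -
  have "op_mult (mult_op f) D i l v = (f * op_series D l v) $$ i" if "(f, D) \<in> set (nord_factors m ns)" for f D
    by (rule op_mult_series) (use that assms diff_op_nord_factors in \<open>auto simp: op_series_nth\<close>)
  hence "map (\<lambda>(f, D). op_mult (mult_op f) D i l v) (nord_factors m ns) =
      map (\<lambda>(f, D). (f * op_series D l v) $$ i) (nord_factors m ns)"
    by auto
  thus ?thesis
    unfolding foldr_nord_mult
    by (simp add: nord_op_def nord_series_def sum_list_fls_nth comp_def case_prod_beta' cong: map_cong)
qed

lemma nord_series_Nil: "nord_series m [] l v = exp_h_series m * op_series (exp_h_plus m) l v"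
  by (simp add: nord_series_def)

text \<open>The differential operators of all factors commute, so the part h_n^+ of the new factor
  may act on v before the others do.\<close>

lemma nord_series_Cons:
  assumes "\<forall>n\<in>set (n # ns). n \<ge> 1" "v \<in> Xi" "\<And>k. k \<ge> K \<Longrightarrow> partial_xi k v = 0"
  shows "nord_series m (n # ns) l v = h_series n * nord_series m ns l v +
    (\<Sum>k<K. h_term n k * nord_series m ns l (partial_xi k v))"
proof -
  have "(\<Sum>(f, D)\<leftarrow>C. h_series n * f * op_series D l v) = h_series n * (\<Sum>(f, D)\<leftarrow>C. f * op_series D l v)" for C
    by (induction C) (auto simp: distrib_left mult.assoc)
  moreover have "(\<Sum>(f, D)\<leftarrow>C. f * op_series (op_mult (diff_h n) D) l v) =
      (\<Sum>k<K. h_term n k *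
        (\<Sum>(f, D)\<leftarrow>C. f * op_series D l (partial_xi k v)))"
    if "\<And>f D. (f, D) \<in> set C \<Longrightarrow> diff_op D" for C
    using that
  proof (induction C)
    case (Cons x C)
    obtain f D where x: "x = (f, D)" by force
    have "op_series (op_mult (diff_h n) D) l v =
      (\<Sum>k<K. h_term n k * op_series D l (partial_xi k v))"
      by (rule op_series_mult_diff_h) (use assms Cons.prems x in auto)
    moreover note Cons.IH[OF Cons.prems[OF list.set_intros(2)]]
    ultimately show ?case
      by (simp add: x distrib_left sum.distrib sum_distrib_left mult_ac)
  qed simp
  ultimately show ?thesis
    using diff_op_nord_factors[of ns _ _ m] assms(1)
    by (simp add: nord_series_def comp_def case_prod_beta')
qed

lemma op_series_add:
  "diff_op D \<Longrightarrow> v \<in> Xi \<Longrightarrow> w \<in> Xi \<Longrightarrow> op_series D l (v + w) = op_series D l v + op_series D l w"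
  by (rule fls_eqI) (simp add: op_series_nth Xi_add, simp add: diff_op_def)

lemma op_series_cst:
  "diff_op D \<Longrightarrow> v \<in> Xi \<Longrightarrow> op_series D l (cst c * v) = cst1 c * op_series D l v"
  by (rule fls_eqI) (simp add: op_series_nth Xi_cst_mult, simp add: diff_op_def)

lemma nord_series_add:
  assumes "\<forall>n\<in>set ns. n \<ge> 1" "v \<in> Xi" "w \<in> Xi"
  shows "nord_series m ns l (v + w) = nord_series m ns l v + nord_series m ns l w"
proof -
  have "(\<Sum>(f, D)\<leftarrow>C. f * op_series D l (v + w)) =
      (\<Sum>(f, D)\<leftarrow>C. f * op_series D l v) + (\<Sum>(f, D)\<leftarrow>C. f * op_series D l w)"
    if "\<And>f D. (f, D) \<in> set C \<Longrightarrow> diff_op D" for C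
    using that
  proof (induction C)
    case (Cons x C)
    obtain f D where x: "x = (f, D)" by force
    note IH = Cons.IH[OF Cons.prems[OF list.set_intros(2)]]
    have "diff_op D" by (rule Cons.prems[of f]) (simp add: x)
    thus ?case by (simp add: x IH op_series_add assms distrib_left add_ac)
  qed simp
  thus ?thesis using diff_op_nord_factors[OF assms(1)] by (simp add: nord_series_def)
qed

lemma nord_series_cst:
  assumes "\<forall>n\<in>set ns. n \<ge> 1" "v \<in> Xi"
  shows "nord_series m ns l (cst c * v) = cst1 c * nord_series m ns l v"
proof -
  have "(\<Sum>(f, D)\<leftarrow>C. f * op_series D l (cst c * v)) = cst1 c * (\<Sum>(f, D)\<leftarrow>C. f * op_series D l v)"
    if "\<And>f D. (f, D) \<in> set C \<Longrightarrow> diff_op D" for C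
    using that
  proof (induction C)
    case (Cons x C)
    obtain f D where x: "x = (f, D)" by force
    note IH = Cons.IH[OF Cons.prems[OF list.set_intros(2)]]
    have "diff_op D" by (rule Cons.prems[of f]) (simp add: x)
    thus ?case by (simp add: x IH op_series_cst assms distrib_left mult.left_commute)
  qed simp
  thus ?thesis using diff_op_nord_factors[OF assms(1)] by (simp add: nord_series_def)
qed

text \<open>Normal ordering is insensitive to the order of factors. This is needed because
  \<open>Upsilon_monom\<close> lists the indices in sorted order, while the recursion adds a factor
  in front.\<close>

lemma nord_series_swap:
  assumes "\<forall>n\<in>set (a # b # ns). n \<ge> 1" "v \<in> Xi"
  shows "nord_series m (a # b # ns) l v = nord_series m (b # a # ns) l v"
proof -
  obtain K where "\<forall>k\<ge>K. partial_xi k v = 0" using partial_xi_eventually_0[OF assms(2)] by blast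
  hence K: "\<And>k. k \<ge> K \<Longrightarrow> partial_xi k v = 0" "\<And>k j. k \<ge> K \<Longrightarrow> partial_xi k (partial_xi j v) = 0"
    by (simp, metis partial_xi_commute partial_xi_zero)
  let ?c = "\<lambda>n k. h_term n k :: amb fls"
  have two: "nord_series m (a # b # ns) l v =
      h_series a * h_series b * nord_series m ns l v
      + (\<Sum>k<K. h_series a * (?c b k * nord_series m ns l (partial_xi k v)))
      + (\<Sum>k<K. h_series b * (?c a k * nord_series m ns l (partial_xi k v)))
      + (\<Sum>k<K. \<Sum>j<K. ?c a k * (?c b j * nord_series m ns l (partial_xi j (partial_xi k v))))"
    if ab: "\<forall>n\<in>set (a # b # ns). n \<ge> 1" for a b
  proof -
    have "nord_series m (a # b # ns) l v = h_series a * nord_series m (b # ns) l v +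
        (\<Sum>k<K. ?c a k * nord_series m (b # ns) l (partial_xi k v))"
      by (rule nord_series_Cons) (use ab assms K in auto)
    moreover have "nord_series m (b # ns) l w = h_series b * nord_series m ns l w +
        (\<Sum>k<K. ?c b k * nord_series m ns l (partial_xi k w))"
      if "w \<in> Xi" "\<And>k. k \<ge> K \<Longrightarrow> partial_xi k w = 0" for w
      by (rule nord_series_Cons) (use ab that in auto)
    ultimately show ?thesis using K assms(2) partial_xi_in_Xi
      by (simp add: distrib_left sum.distrib sum_distrib_left mult.assoc
        mult.left_commute[of "fls_const _" "h_series b"] mult.left_commute[of "fls_Xp _" "h_series b"])
  qed
  have "(\<Sum>k<K. \<Sum>j<K. ?c a k * (?c b j * nord_series m ns l (partial_xi j (partial_xi k v)))) =
      (\<Sum>j<K. \<Sum>k<K. ?c b j * (?c a k * nord_series m ns l (partial_xi k (partial_xi j v))))"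
    by (subst sum.swap) (intro sum.cong refl, simp only: mult.left_commute partial_xi_commute)
  thus ?thesis using assms by (simp add: two mult_ac add_ac)
qed

lemma nord_series_insort:
  assumes "\<forall>n\<in>set (a # ns). n \<ge> 1" "v \<in> Xi"
  shows "nord_series m (insort a ns) l v = nord_series m (a # ns) l v"
  using assms
proof (induction ns arbitrary: v)
  case (Cons b ns)
  obtain K where K: "\<forall>k\<ge>K. partial_xi k v = 0" using partial_xi_eventually_0[OF Cons.prems(2)] by blast
  have "nord_series m (b # insort a ns) l v = nord_series m (b # a # ns) l v"
    using Cons K nord_series_Cons[of b "insort a ns" v K m l] nord_series_Cons[of b "a # ns" v K m l]
    by (simp add: set_insort_key partial_xi_in_Xi)
  moreover have "nord_series m (b # a # ns) l v = nord_series m (a # b # ns) l v"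
    by (rule nord_series_swap) (use Cons.prems in auto)
  ultimately show ?case by simp
qed simp

definition Upsilon_series :: "int \<Rightarrow> nat multiset \<Rightarrow> nat \<Rightarrow> amb \<Rightarrow> amb fls" where
  "Upsilon_series m N = nord_series m (sorted_list_of_multiset N)"

lemma Upsilon_monom_eq:
  "0 \<notin># N \<Longrightarrow> v \<in> Xi \<Longrightarrow> Upsilon_monom m N i l v = Upsilon_series m N l v $$ i"
  unfolding Upsilon_monom_def Upsilon_series_def
  by (rule nord_op_eq) (auto simp: Suc_le_eq intro!: Nat.gr0I)

lemma Upsilon_series_empty: "Upsilon_series m {#} l v = exp_h_series m * op_series (exp_h_plus m) l v"
  by (simp add: Upsilon_series_def nord_series_Nil)

lemma Upsilon_series_add_mset:
  assumes "0 \<notin># add_mset n N" "v \<in> Xi" "\<And>k. k \<ge> K \<Longrightarrow> partial_xi k v = 0"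
  shows "Upsilon_series m (add_mset n N) l v = h_series n * Upsilon_series m N l v +
    (\<Sum>k<K. h_term n k * Upsilon_series m N l (partial_xi k v))"
proof -
  have 1: "\<forall>a\<in>set (n # sorted_list_of_multiset N). a \<ge> 1"
    using assms(1) by (auto simp: Suc_le_eq intro!: Nat.gr0I)
  have "Upsilon_series m (add_mset n N) l v = nord_series m (n # sorted_list_of_multiset N) l v"
    using nord_series_insort[OF 1 assms(2)] by (simp add: Upsilon_series_def)
  also have "\<dots> = h_series n * Upsilon_series m N l v +
    (\<Sum>k<K. h_term n k * Upsilon_series m N l (partial_xi k v))"
    unfolding Upsilon_series_def by (rule nord_series_Cons[OF 1]) (use assms in auto)
  finally show ?thesis .
qed

lemma Upsilon_series_add:
  assumes "0 \<notin># N" "v \<in> Xi" "w \<in> Xi"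
  shows "Upsilon_series m N l (v + w) = Upsilon_series m N l v + Upsilon_series m N l w"
  unfolding Upsilon_series_def
  by (rule nord_series_add) (use assms in \<open>auto simp: Suc_le_eq intro!: Nat.gr0I\<close>)

lemma Upsilon_series_cst:
  assumes "0 \<notin># N" "v \<in> Xi"
  shows "Upsilon_series m N l (cst c * v) = cst1 c * Upsilon_series m N l v"
  unfolding Upsilon_series_def
  by (rule nord_series_cst) (use assms in \<open>auto simp: Suc_le_eq intro!: Nat.gr0I\<close>)

text \<open>
  The vectors of charge \<open>q\<close> are the eigenvectors of \<open>\<partial>/\<partial>\<xi>\<^sub>0\<close> in \<open>\<Xi>\<close> with eigenvalue \<open>q\<close>. They are described
  here by the only property needed: on them \<open>log x\<close> occurs in \<open>e^(m h^+(x))\<close> through \<open>e^(2 m q log x)\<close>.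
\<close>

definition charge :: "int \<Rightarrow> amb \<Rightarrow> bool" where
  "charge q v \<longleftrightarrow> v \<in> Xi \<and> (\<forall>m i l. exp_h_plus m i l v =
     cst ((2 * of_int m * of_int q) ^ l / fact l) * exp_h_plus m i 0 v)"

lemma charge_partial: "charge q v \<Longrightarrow> charge q (partial_xi k v)"
  unfolding charge_def by (metis exp_h_plus_partial partial_xi_cst partial_xi_in_Xi)

lemma charge_monom_Xi: "0 \<notin># N \<Longrightarrow> charge q (monom_Xi q N)"
proof (induction N)
  case empty
  show ?case by (simp add: charge_def exp_h_plus_exp exp_xi0_in_Xi)
next
  case (add n N)
  hence n: "n \<ge> 1" by (simp add: Suc_le_eq)
  have IH: "exp_h_plus m i l (monom_Xi q N) =
     cst ((2 * of_int m * of_int q) ^ l / fact l) * exp_h_plus m i 0 (monom_Xi q N)" for m i l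
  proof -
    have "charge q (monom_Xi q N)" using add by auto
    thus ?thesis unfolding charge_def by blast
  qed
  have "exp_h_plus m i l (xi n * monom_Xi q N) =
     cst ((2 * of_int m * of_int q) ^ l / fact l) * exp_h_plus m i 0 (xi n * monom_Xi q N)" for m i l
    unfolding exp_h_plus_xi[OF n]
    by (subst IH[of m i l], subst IH[of m "i + int n" l]) (simp only: right_diff_distrib mult.left_commute)
  moreover have "xi n * monom_Xi q N \<in> Xi"
    using add.prems monom_Xi_in_Xi[of N q] n by (simp add: Xi_xi_mult)
  ultimately show ?case unfolding charge_def monom_Xi_add_mset by blast
qed

text \<open>The derivatives of h contain no logarithm, and d/dxi_k preserves the charge; all powers
  of log x thus stem from e^(m h^+(x)) acting on vectors of one charge.\<close>

lemma Upsilon_series_charge: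
  assumes "0 \<notin># N" "charge q v"
  shows "Upsilon_series m N l v = cst1 ((2 * of_int m * of_int q) ^ l / fact l) * Upsilon_series m N 0 v"
  using assms
proof (induction N arbitrary: v)
  case empty
  have "op_series (exp_h_plus m) l v =
      cst1 ((2 * of_int m * of_int q) ^ l / fact l) * op_series (exp_h_plus m) 0 v"
  proof (rule fls_eqI)
    fix i
    have "v \<in> Xi" using empty by (simp add: charge_def)
    moreover have "exp_h_plus m i l v = cst ((2 * of_int m * of_int q) ^ l / fact l) * exp_h_plus m i 0 v"
      using empty unfolding charge_def by blast
    ultimately show "op_series (exp_h_plus m) l v $$ i =
        (cst1 ((2 * of_int m * of_int q) ^ l / fact l) * op_series (exp_h_plus m) 0 v) $$ i"
      by (simp add: op_series_nth diff_op_exp_h_plus)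
  qed
  thus ?case by (simp add: Upsilon_series_empty mult.left_commute)
next
  case (add n N)
  have v: "v \<in> Xi" using add.prems by (simp add: charge_def)
  then obtain K where "\<forall>k\<ge>K. partial_xi k v = 0" using partial_xi_eventually_0 by blast
  hence step: "Upsilon_series m (add_mset n N) l v = h_series n * Upsilon_series m N l v +
    (\<Sum>k<K. h_term n k * Upsilon_series m N l (partial_xi k v))" for l
    using add.prems v by (intro Upsilon_series_add_mset) auto
  have IH: "Upsilon_series m N l w = cst1 ((2 * of_int m * of_int q) ^ l / fact l) * Upsilon_series m N 0 w"
    if "charge q w" for w
    using add that by auto
  show ?case
    unfolding step
    by (simp only: IH[OF add.prems(2)] IH[OF charge_partial[OF add.prems(2)]] distrib_left sum_distrib_left mult.left_commute)
qed

subsection \<open>Linear extension and \<open>\<phi>\<^sub>x\<close>\<close>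

lemma monom_in_basis_Xi: "0 \<notin># N \<Longrightarrow> monom_Xi m N \<in> basis_Xi"
  by (auto simp: basis_Xi_def)

lemma finite_representation_monom:
  "finite {(m, N). 0 \<notin># N \<and> amb.representation basis_Xi p (monom_Xi m N) \<noteq> 0}" (is "finite ?S")
proof (rule finite_imageD)
  show "finite ((\<lambda>(m, N). monom_Xi m N) ` ?S)"
    by (rule finite_subset[OF _ amb.finite_representation[of basis_Xi p]]) auto
  show "inj_on (\<lambda>(m, N). monom_Xi m N) ?S"
    using monom_Xi_inj by (auto simp: inj_on_def)
qed

text \<open>The index set in the definition changes with p. With any larger finite set allowed, the
  sums for p, q and p + q can run over the same one.\<close>

lemma Upsilon_eq_sum:
  assumes "finite F" "\<And>m N. (m, N) \<in> F \<Longrightarrow> 0 \<notin># N"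
    "\<And>m N. 0 \<notin># N \<Longrightarrow> amb.representation basis_Xi p (monom_Xi m N) \<noteq> 0 \<Longrightarrow> (m, N) \<in> F"
  shows "Upsilon p i l v =
    (\<Sum>(m, N)\<in>F. cst (amb.representation basis_Xi p (monom_Xi m N)) * Upsilon_monom m N i l v)"
  unfolding Upsilon_def ascale_cst [symmetric]
  by (rule sum.mono_neutral_left) (use assms in auto)

lemma Upsilon_add:
  assumes "p \<in> Xi" "q \<in> Xi"
  shows "Upsilon (p + q) i l v = Upsilon p i l v + Upsilon q i l v"
proof -
  let ?S = "\<lambda>p. {(m, N). 0 \<notin># N \<and> amb.representation basis_Xi p (monom_Xi m N) \<noteq> 0}"
  have rep: "amb.representation basis_Xi (p + q) b = amb.representation basis_Xi p b + amb.representation basis_Xi q b" for b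
    using amb.representation_add[OF independent_basis_Xi, of q p] assms by (simp add: Xi_def)
  have eq: "Upsilon r i l v = (\<Sum>(m, N)\<in>?S p \<union> ?S q. cst (amb.representation basis_Xi r (monom_Xi m N)) * Upsilon_monom m N i l v)"
    if "r = p \<or> r = q \<or> r = p + q" for r
    by (rule Upsilon_eq_sum) (use that rep in \<open>auto intro: finite_representation_monom\<close>)
  show ?thesis
    unfolding eq[of p, simplified] eq[of q, simplified] eq[of "p + q", simplified]
    by (simp add: rep cst.emb_add distrib_right case_prod_beta sum.distrib)
qed

lemma Upsilon_cst:
  assumes "p \<in> Xi"
  shows "Upsilon (cst c * p) i l v = cst c * Upsilon p i l v"
proof -
  let ?S = "{(m, N). 0 \<notin># N \<and> amb.representation basis_Xi p (monom_Xi m N) \<noteq> 0}"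
  have rep: "amb.representation basis_Xi (cst c * p) b = c * amb.representation basis_Xi p b" for b
    using amb.representation_scale[OF independent_basis_Xi, of p c] assms
    unfolding ascale_cst [symmetric] by (simp add: Xi_def)
  have eq: "Upsilon r i l v = (\<Sum>(m, N)\<in>?S. cst (amb.representation basis_Xi r (monom_Xi m N)) * Upsilon_monom m N i l v)"
    if "r = p \<or> r = cst c * p" for r
    by (rule Upsilon_eq_sum) (use that rep in \<open>auto intro: finite_representation_monom\<close>)
  show ?thesis
    unfolding eq[of p, simplified] eq[of "cst c * p", simplified]
    by (simp add: rep cst.emb_mult case_prod_beta sum_distrib_left mult.assoc)
qed

lemma Upsilon_monom_Xi:
  assumes "0 \<notin># N"
  shows "Upsilon (monom_Xi m N) i l v = Upsilon_monom m N i l v"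
proof -
  have rep: "amb.representation basis_Xi (monom_Xi m N) b = (if b = monom_Xi m N then 1 else 0)" for b
    using amb.representation_basis[OF independent_basis_Xi, of "monom_Xi m N"]
      monom_in_basis_Xi[OF assms] by auto
  have "Upsilon (monom_Xi m N) i l v = (\<Sum>(m', N')\<in>{(m, N)}.
      cst (amb.representation basis_Xi (monom_Xi m N) (monom_Xi m' N')) * Upsilon_monom m' N' i l v)"
    by (rule Upsilon_eq_sum) (use assms monom_Xi_inj in \<open>auto simp: rep split: if_splits\<close>)
  thus ?thesis by (simp add: rep)
qed

lemma Upsilon_add_right:
  assumes "p \<in> Xi" "v \<in> Xi" "w \<in> Xi"
  shows "Upsilon p i l (v + w) = Upsilon p i l v + Upsilon p i l w"
  using assms(1)
  by (induction p rule: Xi_induct)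
    (simp_all add: Upsilon_monom_Xi Upsilon_monom_eq Xi_add assms Upsilon_series_add Upsilon_add Upsilon_cst distrib_left)

lemma Upsilon_cst_right:
  assumes "p \<in> Xi" "v \<in> Xi"
  shows "Upsilon p i l (cst c * v) = cst c * Upsilon p i l v"
  using assms(1)
  by (induction p rule: Xi_induct)
    (simp_all add: Upsilon_monom_Xi Upsilon_monom_eq Xi_cst_mult assms Upsilon_series_cst Upsilon_add Upsilon_cst
      distrib_left mult.left_commute[of _ "cst c"])

text \<open>\<open>log_expansion f g\<close> means \<open>g = \<Sum>n. f\<^sub>n(x) e^(n log x)\<close>, the sum being finite.\<close>

definition log_expansion :: "(int \<Rightarrow> int \<Rightarrow> amb) \<Rightarrow> (int \<Rightarrow> nat \<Rightarrow> amb) \<Rightarrow> bool" where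
  "log_expansion f g \<longleftrightarrow> finite {n. f n \<noteq> (\<lambda>_. 0)} \<and> log_exp_sum f = g"

lemma log_exp_sum_superset:
  assumes "finite S" "{n. f n \<noteq> (\<lambda>_. 0)} \<subseteq> S"
  shows "log_exp_sum f i l = (\<Sum>n\<in>S. cst (of_int n ^ l / fact l) * f n i)"
  unfolding log_exp_sum_def ascale_cst
  by (rule sum.mono_neutral_left) (use assms in auto)

text \<open>At fixed x^i the coefficients of (log x)^l, times l!, are power sums in the exponents n.
  Uniqueness gives meaning to the description in \<open>phi_x\<close>.\<close>

lemma log_expansion_unique:
  assumes "log_expansion f g" "log_expansion f' g"
  shows "f = f'"
proof (intro ext)
  fix n i
  define S where "S = insert n ({n. f n \<noteq> (\<lambda>_. 0)} \<union> {n. f' n \<noteq> (\<lambda>_. 0)})"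
  have S: "finite S" using assms by (simp add: S_def log_expansion_def)
  have "f n i - f' n i = 0"
  proof (rule vandermonde_cst[where f = "\<lambda>n. f n i - f' n i", OF S])
    fix l
    have eq: "(\<Sum>n\<in>S. cst (of_int n ^ l / fact l) * f n i) = (\<Sum>n\<in>S. cst (of_int n ^ l / fact l) * f' n i)"
    proof -
      have "log_exp_sum f i l = log_exp_sum f' i l" using assms by (simp add: log_expansion_def)
      moreover have "log_exp_sum f i l = (\<Sum>n\<in>S. cst (of_int n ^ l / fact l) * f n i)"
        by (rule log_exp_sum_superset[OF S]) (auto simp: S_def)
      moreover have "log_exp_sum f' i l = (\<Sum>n\<in>S. cst (of_int n ^ l / fact l) * f' n i)"
        by (rule log_exp_sum_superset[OF S]) (auto simp: S_def)
      ultimately show ?thesis by simp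
    qed
    have "(\<Sum>n\<in>S. cst (of_int n ^ l) * (f n i - f' n i)) =
        cst (fact l) * ((\<Sum>n\<in>S. cst (of_int n ^ l / fact l) * f n i) - (\<Sum>n\<in>S. cst (of_int n ^ l / fact l) * f' n i))"
      by (simp add: sum_distrib_left sum_subtractf right_diff_distrib mult.assoc [symmetric] flip: cst.emb_mult)
    thus "(\<Sum>n\<in>S. cst (of_int n ^ l) * (f n i - f' n i)) = 0" using eq by simp
  qed (simp add: S_def)
  thus "f n i = f' n i" by simp
qed

lemma phi_x_log_expansion:
  assumes "log_expansion f g" "finite S" "{n. f n \<noteq> (\<lambda>_. 0)} \<subseteq> S"
  shows "phi_x g i = (\<Sum>n\<in>S. f n (i - n))"
proof -
  have "(THE f. finite {n. f n \<noteq> (\<lambda>_. 0)} \<and> log_exp_sum f = g) = f"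
    using assms(1) log_expansion_unique unfolding log_expansion_def by (intro the_equality) blast+
  hence "phi_x g i = (\<Sum>n | f n \<noteq> (\<lambda>_. 0). f n (i - n))"
    by (simp add: phi_x_def)
  also have "\<dots> = (\<Sum>n\<in>S. f n (i - n))"
    by (rule sum.mono_neutral_left) (use assms in auto)
  finally show ?thesis .
qed

lemma log_expansion_add:
  assumes "log_expansion f g" "log_expansion f' g'"
  shows "log_expansion (\<lambda>n i. f n i + f' n i) (\<lambda>i l. g i l + g' i l)"
    and "phi_x (\<lambda>i l. g i l + g' i l) i = phi_x g i + phi_x g' i"
proof -
  define S where "S = {n. f n \<noteq> (\<lambda>_. 0)} \<union> {n. f' n \<noteq> (\<lambda>_. 0)}"
  have S: "finite S" using assms by (simp add: S_def log_expansion_def)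
  have sub: "{n. f n \<noteq> (\<lambda>_. 0)} \<subseteq> S" "{n. f' n \<noteq> (\<lambda>_. 0)} \<subseteq> S" "{n. (\<lambda>i. f n i + f' n i) \<noteq> (\<lambda>_. 0)} \<subseteq> S"
    by (auto simp: S_def)
  show *: "log_expansion (\<lambda>n i. f n i + f' n i) (\<lambda>i l. g i l + g' i l)"
    unfolding log_expansion_def
  proof (intro conjI ext)
    show "finite {n. (\<lambda>i. f n i + f' n i) \<noteq> (\<lambda>_. 0)}" using sub(3) S by (rule finite_subset)
    fix i l
    have "g = log_exp_sum f" "g' = log_exp_sum f'" using assms by (auto simp: log_expansion_def)
    thus "log_exp_sum (\<lambda>n i. f n i + f' n i) i l = g i l + g' i l"
      by (simp add: log_exp_sum_superset[OF S sub(1)] log_exp_sum_superset[OF S sub(2)]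
          log_exp_sum_superset[OF S sub(3)] distrib_left sum.distrib)
  qed
  show "phi_x (\<lambda>i l. g i l + g' i l) i = phi_x g i + phi_x g' i"
    by (simp add: phi_x_log_expansion[OF * S sub(3)] phi_x_log_expansion[OF assms(1) S sub(1)]
        phi_x_log_expansion[OF assms(2) S sub(2)] sum.distrib)
qed

lemma log_expansion_cst:
  assumes "log_expansion f g"
  shows "log_expansion (\<lambda>n i. cst c * f n i) (\<lambda>i l. cst c * g i l)"
    and "phi_x (\<lambda>i l. cst c * g i l) i = cst c * phi_x g i"
proof -
  define S where "S = {n. f n \<noteq> (\<lambda>_. 0)}"
  have S: "finite S" using assms by (simp add: S_def log_expansion_def)
  have sub: "{n. f n \<noteq> (\<lambda>_. 0)} \<subseteq> S" "{n. (\<lambda>i. cst c * f n i) \<noteq> (\<lambda>_. 0)} \<subseteq> S"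
    by (auto simp: S_def)
  show *: "log_expansion (\<lambda>n i. cst c * f n i) (\<lambda>i l. cst c * g i l)"
    unfolding log_expansion_def
  proof (intro conjI ext)
    show "finite {n. (\<lambda>i. cst c * f n i) \<noteq> (\<lambda>_. 0)}" using sub(2) S by (rule finite_subset)
    fix i l
    have "g = log_exp_sum f" using assms by (auto simp: log_expansion_def)
    thus "log_exp_sum (\<lambda>n i. cst c * f n i) i l = cst c * g i l"
      by (simp add: log_exp_sum_superset[OF S sub(1)] log_exp_sum_superset[OF S sub(2)]
          sum_distrib_left mult.left_commute[of _ "cst c"])
  qed
  show "phi_x (\<lambda>i l. cst c * g i l) i = cst c * phi_x g i"
    by (simp add: phi_x_log_expansion[OF * S sub(2)] phi_x_log_expansion[OF assms S sub(1)] sum_distrib_left)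
qed

text \<open>For vectors of one charge the expansion has the single exponent 2mq, and
  \<open>phi_x\<close> only shifts the powers of x.\<close>

lemma Upsilon_log_expansion_charge:
  fixes m q :: int
  assumes "0 \<notin># N" "charge q v"
  defines "f \<equiv> \<lambda>n i. if n = 2 * m * q then Upsilon_series m N 0 v $$ i else 0"
  shows "log_expansion f (\<lambda>i l. Upsilon (monom_Xi m N) i l v)"
    and "Y_Xi (monom_Xi m N) i v = Upsilon_series m N 0 v $$ (i - 2 * m * q)"
proof -
  let ?S = "{2 * m * q}"
  have sub: "{n. f n \<noteq> (\<lambda>_. 0)} \<subseteq> ?S" by (auto simp: f_def)
  have v: "v \<in> Xi" using assms by (simp add: charge_def)
  show *: "log_expansion f (\<lambda>i l. Upsilon (monom_Xi m N) i l v)"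
    unfolding log_expansion_def
  proof (intro conjI ext)
    show "finite {n. f n \<noteq> (\<lambda>_. 0)}" using sub by (rule finite_subset) simp
    fix i l
    have "log_exp_sum f i l = cst (of_int (2 * m * q) ^ l / fact l) * f (2 * m * q) i"
      using log_exp_sum_superset[OF _ sub] by simp
    also have "\<dots> = Upsilon_series m N l v $$ i"
      using Upsilon_series_charge[OF assms(1,2), of m l] by (simp add: f_def)
    finally show "log_exp_sum f i l = Upsilon (monom_Xi m N) i l v"
      by (simp add: Upsilon_monom_Xi Upsilon_monom_eq assms v)
  qed
  show "Y_Xi (monom_Xi m N) i v = Upsilon_series m N 0 v $$ (i - 2 * m * q)"
    using phi_x_log_expansion[OF * _ sub] by (simp add: Y_Xi_def f_def)
qed

text \<open>Being a definite description, \<open>phi_x\<close> can be handled linearly only on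
  series known to have an expansion. Monomials have one, and sums and scalar multiples inherit
  it.\<close>

lemma Upsilon_log_expansion:
  assumes "u \<in> Xi" "v \<in> Xi"
  shows "\<exists>f. log_expansion f (\<lambda>i l. Upsilon u i l v)"
  using assms(1)
proof (induction u rule: Xi_induct)
  case (monom m N)
  show ?case using assms(2)
  proof (induction v rule: Xi_induct)
    case (monom q N')
    thus ?case using Upsilon_log_expansion_charge(1)[OF \<open>0 \<notin># N\<close> charge_monom_Xi] by blast
  next
    case (add v w)
    then obtain f g where "log_expansion f (\<lambda>i l. Upsilon (monom_Xi m N) i l v)"
      "log_expansion g (\<lambda>i l. Upsilon (monom_Xi m N) i l w)" by blast
    from log_expansion_add(1)[OF this] show ?case
      using add.hyps monom_Xi_in_Xi[OF monom] by (auto simp: Upsilon_add_right)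
  next
    case (scale c v)
    then obtain f where "log_expansion f (\<lambda>i l. Upsilon (monom_Xi m N) i l v)" by blast
    from log_expansion_cst(1)[OF this, of c] show ?case
      using scale.hyps monom_Xi_in_Xi[OF monom] by (auto simp: Upsilon_cst_right)
  qed
next
  case (add u w)
  then obtain f g where "log_expansion f (\<lambda>i l. Upsilon u i l v)" "log_expansion g (\<lambda>i l. Upsilon w i l v)"
    by blast
  from log_expansion_add(1)[OF this] show ?case using add.hyps by (auto simp: Upsilon_add)
next
  case (scale c u)
  then obtain f where "log_expansion f (\<lambda>i l. Upsilon u i l v)" by blast
  from log_expansion_cst(1)[OF this, of c] show ?case using scale.hyps by (auto simp: Upsilon_cst)
qed

lemma Y_Xi_add_left:
  assumes "u \<in> Xi" "u' \<in> Xi" "v \<in> Xi"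
  shows "Y_Xi (u + u') i v = Y_Xi u i v + Y_Xi u' i v"
proof -
  obtain f g where "log_expansion f (\<lambda>i l. Upsilon u i l v)" "log_expansion g (\<lambda>i l. Upsilon u' i l v)"
    using Upsilon_log_expansion assms by meson
  from log_expansion_add(2)[OF this] show ?thesis by (simp add: Y_Xi_def Upsilon_add assms)
qed

lemma Y_Xi_cst_left:
  assumes "u \<in> Xi" "v \<in> Xi"
  shows "Y_Xi (cst c * u) i v = cst c * Y_Xi u i v"
proof -
  obtain f where "log_expansion f (\<lambda>i l. Upsilon u i l v)"
    using Upsilon_log_expansion assms by meson
  from log_expansion_cst(2)[OF this] show ?thesis by (simp add: Y_Xi_def Upsilon_cst assms)
qed

lemma Y_Xi_add_right:
  assumes "u \<in> Xi" "v \<in> Xi" "v' \<in> Xi"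
  shows "Y_Xi u i (v + v') = Y_Xi u i v + Y_Xi u i v'"
proof -
  obtain f g where "log_expansion f (\<lambda>i l. Upsilon u i l v)" "log_expansion g (\<lambda>i l. Upsilon u i l v')"
    using Upsilon_log_expansion assms by meson
  from log_expansion_add(2)[OF this] show ?thesis by (simp add: Y_Xi_def Upsilon_add_right assms)
qed

lemma Y_Xi_cst_right:
  assumes "u \<in> Xi" "v \<in> Xi"
  shows "Y_Xi u i (cst c * v) = cst c * Y_Xi u i v"
proof -
  obtain f where "log_expansion f (\<lambda>i l. Upsilon u i l v)"
    using Upsilon_log_expansion assms by meson
  from log_expansion_cst(2)[OF this] show ?thesis by (simp add: Y_Xi_def Upsilon_cst_right assms)
qed

lemma Y_Xi_truncation:
  assumes "u \<in> Xi" "v \<in> Xi"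
  shows "\<exists>J. \<forall>i<J. Y_Xi u i v = 0"
  using assms(1)
proof (induction u rule: Xi_induct)
  case (monom m N)
  show ?case using assms(2)
  proof (induction v rule: Xi_induct)
    case (monom q N')
    obtain J where "\<forall>i<J. Upsilon_series m N 0 (monom_Xi q N') $$ i = 0" by (rule fls_nth_vanishes_belowE)
    thus ?case using Upsilon_log_expansion_charge(2)[OF \<open>0 \<notin># N\<close> charge_monom_Xi[OF monom]]
      by (intro exI[of _ "J + 2 * m * q"]) simp
  next
    case (add v w)
    then obtain I J where "\<forall>i<I. Y_Xi (monom_Xi m N) i v = 0" "\<forall>i<J. Y_Xi (monom_Xi m N) i w = 0" by blast
    thus ?case using add monom_Xi_in_Xi[OF monom] by (intro exI[of _ "min I J"]) (simp add: Y_Xi_add_right)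
  next
    case (scale c v)
    then obtain J where "\<forall>i<J. Y_Xi (monom_Xi m N) i v = 0" by blast
    thus ?case using scale monom_Xi_in_Xi[OF monom] by (intro exI[of _ J]) (simp add: Y_Xi_cst_right)
  qed
next
  case (add u w)
  then obtain I J where "\<forall>i<I. Y_Xi u i v = 0" "\<forall>i<J. Y_Xi w i v = 0" by blast
  thus ?case using add assms(2) by (intro exI[of _ "min I J"]) (simp add: Y_Xi_add_left)
next
  case (scale c u)
  then obtain J where "\<forall>i<J. Y_Xi u i v = 0" by blast
  thus ?case using scale assms(2) by (intro exI[of _ J]) (simp add: Y_Xi_cst_left)
qed

section \<open>Recursions for the vertex operators\<close>

definition Y_series :: "amb \<Rightarrow> amb \<Rightarrow> amb fls" where
  "Y_series u v = Abs_fls (\<lambda>i. Y_Xi u i v)"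

lemma Y_series_nth: "u \<in> Xi \<Longrightarrow> v \<in> Xi \<Longrightarrow> Y_series u v $$ i = Y_Xi u i v"
  unfolding Y_series_def by (rule nth_Abs_fls_ex_lower_bound) (rule Y_Xi_truncation)

lemma Y_series_add_left:
  "u \<in> Xi \<Longrightarrow> u' \<in> Xi \<Longrightarrow> v \<in> Xi \<Longrightarrow> Y_series (u + u') v = Y_series u v + Y_series u' v"
  by (rule fls_eqI) (simp add: Y_series_nth Xi_add Y_Xi_add_left)

lemma Y_series_cst_left:
  "u \<in> Xi \<Longrightarrow> v \<in> Xi \<Longrightarrow> Y_series (cst c * u) v = cst1 c * Y_series u v"
  by (rule fls_eqI) (simp add: Y_series_nth Xi_cst_mult Y_Xi_cst_left)

lemma Y_series_add_right:
  "u \<in> Xi \<Longrightarrow> v \<in> Xi \<Longrightarrow> v' \<in> Xi \<Longrightarrow> Y_series u (v + v') = Y_series u v + Y_series u v'"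
  by (rule fls_eqI) (simp add: Y_series_nth Xi_add Y_Xi_add_right)

lemma Y_series_cst_right:
  "u \<in> Xi \<Longrightarrow> v \<in> Xi \<Longrightarrow> Y_series u (cst c * v) = cst1 c * Y_series u v"
  by (rule fls_eqI) (simp add: Y_series_nth Xi_cst_mult Y_Xi_cst_right)

lemma Y_series_0_right [simp]: "u \<in> Xi \<Longrightarrow> Y_series u 0 = 0"
  using Y_series_cst_right[of u 0 0] by simp

lemma Y_series_0_left [simp]: "v \<in> Xi \<Longrightarrow> Y_series 0 v = 0"
  using Y_series_cst_left[of 0 v 0] by simp

lemma Y_series_charge:
  assumes "0 \<notin># N" "charge q v"
  shows "Y_series (monom_Xi m N) v = fls_Xp (2 * m * q) * Upsilon_series m N 0 v"
proof (rule fls_eqI)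
  fix i
  have "v \<in> Xi" using assms by (simp add: charge_def)
  thus "Y_series (monom_Xi m N) v $$ i = (fls_Xp (2 * m * q) * Upsilon_series m N 0 v) $$ i"
    using assms by (simp add: Y_series_nth monom_Xi_in_Xi Upsilon_log_expansion_charge(2))
qed

lemma Y_series_xi_charge:
  assumes "n \<ge> 1" "0 \<notin># N" "charge q v" "\<And>k. k \<ge> K \<Longrightarrow> partial_xi k v = 0"
  shows "Y_series (xi n * monom_Xi m N) v = h_series n * Y_series (monom_Xi m N) v +
    (\<Sum>k<K. h_term n k * Y_series (monom_Xi m N) (partial_xi k v))"
proof -
  have "v \<in> Xi" using assms by (simp add: charge_def)
  hence "Upsilon_series m (add_mset n N) 0 v = h_series n * Upsilon_series m N 0 v +
    (\<Sum>k<K. h_term n k * Upsilon_series m N 0 (partial_xi k v))"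
    by (intro Upsilon_series_add_mset) (use assms in auto)
  moreover have "Y_series (xi n * monom_Xi m N) v = fls_Xp (2 * m * q) * Upsilon_series m (add_mset n N) 0 v"
    using Y_series_charge[of "add_mset n N" q v m] assms by (simp add: monom_Xi_add_mset)
  moreover have "Y_series (monom_Xi m N) (partial_xi k v) = fls_Xp (2 * m * q) * Upsilon_series m N 0 (partial_xi k v)" for k
    using assms by (intro Y_series_charge charge_partial)
  ultimately show ?thesis
    using Y_series_charge[OF assms(2,3), of m] by (simp add: distrib_left sum_distrib_left mult_ac)
qed

text \<open>On a vector of charge q the factor x^(2mq) is common to all terms, since derivatives
  preserve the charge. Linearity in both arguments does the rest.\<close>

lemma Y_series_xi:
  assumes "n \<ge> 1" "u \<in> Xi" "v \<in> Xi" "\<And>k. k \<ge> K \<Longrightarrow> partial_xi k v = 0"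
  shows "Y_series (xi n * u) v = h_series n * Y_series u v +
    (\<Sum>k<K. h_term n k * Y_series u (partial_xi k v))"
proof -
  let ?P = "\<lambda>u v K. Y_series (xi n * u) v = h_series n * Y_series u v +
    (\<Sum>k<K. h_term n k * Y_series u (partial_xi k v))"
  have n: "xi n * u \<in> Xi" if "u \<in> Xi" for u using that assms(1) by (simp add: Xi_xi_mult)
  \<comment> \<open>A bound for the derivatives of a sum does not bound those of its summands. The
    induction therefore proves the formula for all large \<open>K\<close>; the surplus terms are
    discarded at the end.\<close>
  have "\<exists>L. \<forall>K\<ge>L. ?P u v K" using assms(2)
  proof (induction u rule: Xi_induct)
    case (monom m N)
    note mN = monom_Xi_in_Xi[OF monom, of m]
    show ?case using assms(3)
    proof (induction v rule: Xi_induct)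
      case (monom q N')
      obtain L where "\<forall>k\<ge>L. partial_xi k (monom_Xi q N') = 0"
        using partial_xi_eventually_0[OF monom_Xi_in_Xi[OF monom]] by blast
      thus ?case
        by (intro exI[of _ L] allI impI Y_series_xi_charge[OF assms(1) \<open>0 \<notin># N\<close> charge_monom_Xi[OF monom]]) auto
    next
      case (add v w)
      then obtain L L' where L: "\<forall>K\<ge>L. ?P (monom_Xi m N) v K" "\<forall>K\<ge>L'. ?P (monom_Xi m N) w K" by blast
      show ?case
      proof (intro exI allI impI)
        fix K assume "K \<ge> max L L'"
        hence *: "?P (monom_Xi m N) v K" "?P (monom_Xi m N) w K" using L by auto
        show "?P (monom_Xi m N) (v + w) K"
          using add.hyps mN
          by (simp only: Y_series_add_right n * partial_xi_add partial_xi_in_Xi distrib_left sum.distrib add_ac)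
      qed
    next
      case (scale c v)
      then obtain L where L: "\<forall>K\<ge>L. ?P (monom_Xi m N) v K" by blast
      show ?case
      proof (intro exI allI impI)
        fix K assume "K \<ge> L"
        hence *: "?P (monom_Xi m N) v K" using L by auto
        show "?P (monom_Xi m N) (cst c * v) K"
          using scale.hyps mN
          by (simp only: Y_series_cst_right n * partial_xi_cst partial_xi_in_Xi distrib_left sum_distrib_left
              mult.left_commute[of _ "cst1 c"])
      qed
    qed
  next
    case (add u w)
    then obtain L L' where L: "\<forall>K\<ge>L. ?P u v K" "\<forall>K\<ge>L'. ?P w v K" by blast
    show ?case
    proof (intro exI allI impI)
      fix K assume "K \<ge> max L L'"
      hence *: "?P u v K" "?P w v K" using L by auto
      show "?P (u + w) v K"
        using add.hyps assms(3)
        by (simp only: distrib_left[of "xi n"] Y_series_add_left n * partial_xi_in_Xi distrib_left sum.distrib add_ac)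
    qed
  next
    case (scale c u)
    then obtain L where L: "\<forall>K\<ge>L. ?P u v K" by blast
    show ?case
    proof (intro exI allI impI)
      fix K assume "K \<ge> L"
      hence *: "?P u v K" using L by auto
      show "?P (cst c * u) v K"
        using scale.hyps assms(3)
        by (simp only: mult.left_commute[of "xi n" "cst c"] Y_series_cst_left n * partial_xi_in_Xi distrib_left
            sum_distrib_left mult.left_commute[of _ "cst1 c"])
    qed
  qed
  then obtain L where L: "\<forall>K\<ge>L. ?P u v K" by blast
  have "(\<Sum>k<max K L. h_term n k * Y_series u (partial_xi k v)) =
      (\<Sum>k<K. h_term n k * Y_series u (partial_xi k v))"
    by (rule sum.mono_neutral_right) (use assms in auto)
  moreover have "?P u v (max K L)" using L by simp
  ultimately show ?thesis by simp
qed

lemma Y_series_exp_xi: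
  assumes "k \<ge> 1" "v \<in> Xi"
  shows "Y_series (exp_xi0 m) (xi k * v) =
    (fls_const (xi k) - cst1 (2 * of_int m / of_nat k) * fls_Xp (- int k)) * Y_series (exp_xi0 m) v"
  using assms(2)
proof (induction v rule: Xi_induct)
  case (monom q N)
  have v: "monom_Xi q N \<in> Xi" "xi k * monom_Xi q N \<in> Xi"
    using monom assms(1) by (auto simp: monom_Xi_in_Xi Xi_xi_mult)
  have ch: "charge q (monom_Xi q N)" "charge q (xi k * monom_Xi q N)"
    using charge_monom_Xi[of N q] charge_monom_Xi[of "add_mset k N" q] monom assms(1)
    by (auto simp: monom_Xi_add_mset)
  have "op_series (exp_h_plus m) 0 (xi k * monom_Xi q N) =
      (fls_const (xi k) - cst1 (2 * of_int m / of_nat k) * fls_Xp (- int k)) *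
      op_series (exp_h_plus m) 0 (monom_Xi q N)"
    by (rule fls_eqI)
      (simp add: op_series_nth diff_op_exp_h_plus v exp_h_plus_xi[OF assms(1)] left_diff_distrib mult.assoc)
  thus ?case
    using Y_series_charge[OF _ ch(1), of "{#}" m] Y_series_charge[OF _ ch(2), of "{#}" m]
    by (simp add: Upsilon_series_empty mult_ac)
next
  case (add v w)
  thus ?case using assms(1)
    by (simp add: distrib_left[of "xi k"] Y_series_add_right exp_xi0_in_Xi Xi_xi_mult distrib_left)
next
  case (scale c v)
  have *: "xi k * (cst c * v) = cst c * (xi k * v)" by (rule mult.left_commute)
  show ?case using scale assms(1)
    unfolding * by (simp add: Y_series_cst_right exp_xi0_in_Xi Xi_xi_mult mult.left_commute[of _ "cst1 c"])
qed

lemma Y_series_exp_exp: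
  "Y_series (exp_xi0 m) (exp_xi0 q) = fls_Xp (2 * m * q) * exp_h_series m * fls_const (exp_xi0 q)"
proof -
  have "op_series (exp_h_plus m) 0 (exp_xi0 q) = fls_const (exp_xi0 q)"
    by (rule fls_eqI) (simp add: op_series_nth diff_op_exp_h_plus exp_xi0_in_Xi exp_h_plus_exp)
  moreover have "charge q (exp_xi0 q)" using charge_monom_Xi[of "{#}" q] by simp
  ultimately show ?thesis
    using Y_series_charge[of "{#}" q "exp_xi0 q" m] by (simp add: Upsilon_series_empty mult.assoc)
qed

subsection \<open>Commutation with multiplication operators and partial derivatives\<close>

definition Xi_series :: "amb fls \<Rightarrow> bool" where
  "Xi_series F \<longleftrightarrow> (\<forall>i. F $$ i \<in> Xi)"

lemma Xi_series_nth: "Xi_series F \<Longrightarrow> F $$ i \<in> Xi"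
  by (simp add: Xi_series_def)

lemma Xi_minus: "v \<in> Xi \<Longrightarrow> - v \<in> Xi"
  using Xi_cst_mult[of v "- 1"] by (simp add: cst.emb_minus)

lemma Xi_series_mult: "Xi_series F \<Longrightarrow> Xi_series G \<Longrightarrow> Xi_series (F * G)"
  unfolding Xi_series_def fls_times_nth(2) by (auto intro!: Xi_sum Xi_mult)

lemma Xi_series_add: "Xi_series F \<Longrightarrow> Xi_series G \<Longrightarrow> Xi_series (F + G)"
  by (simp add: Xi_series_def Xi_add)

lemma Xi_series_diff: "Xi_series F \<Longrightarrow> Xi_series G \<Longrightarrow> Xi_series (F - G)"
  using Xi_add[OF _ Xi_minus] by (simp add: Xi_series_def)

lemma Xi_series_sum: "(\<And>a. a \<in> A \<Longrightarrow> Xi_series (f a)) \<Longrightarrow> Xi_series (\<Sum>a\<in>A. f a)"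
  by (simp add: Xi_series_def fls_sum_nth Xi_sum)

lemma Xi_series_const: "v \<in> Xi \<Longrightarrow> Xi_series (fls_const v)"
  by (simp add: Xi_series_def)

lemma Xi_series_Xp: "Xi_series (fls_Xp r)"
  by (simp add: Xi_series_def)

lemma Xi_series_h_series: "n \<ge> 1 \<Longrightarrow> Xi_series (h_series n)"
  by (simp add: Xi_series_def h_series_nth Xi_cst_mult xi_in_Xi)

lemma exp_h_coeff_in_Xi: "exp_h_coeff m i \<in> Xi"
proof (induction m i rule: exp_h_coeff.induct)
  case (2 m i)
  thus ?case by (auto intro!: Xi_cst_mult Xi_sum Xi_mult xi_in_Xi)
qed (simp add: exp_xi0_in_Xi)

lemma Xi_series_exp_h_series: "Xi_series (exp_h_series m)"
  by (simp add: Xi_series_def exp_h_series_nth exp_h_coeff_in_Xi)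

text \<open>Vertex operators can be composed and iterated only because the coefficients they produce
  are again vectors of \<open>Xi\<close>.\<close>

lemma Xi_series_Y_series:
  assumes "u \<in> Xi" "v \<in> Xi"
  shows "Xi_series (Y_series u v)"
  using assms
proof (induction u arbitrary: v rule: Xi_induct_gen)
  case (exp m)
  show ?case using exp
  proof (induction v rule: Xi_induct_gen)
    case (exp q)
    show ?case unfolding Y_series_exp_exp
      by (intro Xi_series_mult Xi_series_Xp Xi_series_exp_h_series Xi_series_const exp_xi0_in_Xi)
  next
    case (xi k v)
    thus ?case
      by (auto simp: Y_series_exp_xi intro!: Xi_series_mult Xi_series_diff Xi_series_Xp Xi_series_const xi_in_Xi)
  next
    case (add v w)
    thus ?case by (simp add: Y_series_add_right exp_xi0_in_Xi Xi_series_add)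
  next
    case (scale c v)
    thus ?case by (simp add: Y_series_cst_right exp_xi0_in_Xi Xi_series_mult Xi_series_const)
  qed
next
  case (xi n u)
  obtain K where K: "\<forall>k\<ge>K. partial_xi k v = 0" using partial_xi_eventually_0[OF xi.prems] by blast
  have "Y_series (xi n * u) v = h_series n * Y_series u v +
    (\<Sum>k<K. h_term n k * Y_series u (partial_xi k v))"
    by (rule Y_series_xi) (use xi K in auto)
  thus ?case using xi
    by (auto intro!: Xi_series_add Xi_series_mult Xi_series_sum Xi_series_const Xi_series_Xp Xi_series_h_series
        partial_xi_in_Xi)
next
  case (add u w)
  thus ?case by (simp add: Y_series_add_left Xi_series_add)
next
  case (scale c u)
  thus ?case by (simp add: Y_series_cst_left Xi_series_mult Xi_series_const)
qed

lemma Y_series_nth_in_Xi: "u \<in> Xi \<Longrightarrow> v \<in> Xi \<Longrightarrow> Y_series u v $$ i \<in> Xi"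
  using Xi_series_Y_series Xi_series_nth by blast

lemma Y_series_sum_right:
  assumes "u \<in> Xi" "\<And>a. a \<in> A \<Longrightarrow> f a \<in> Xi"
  shows "Y_series u (\<Sum>a\<in>A. f a) = (\<Sum>a\<in>A. Y_series u (f a))"
  using assms(2)
  by (induction A rule: infinite_finite_induct) (auto simp: assms(1) Y_series_add_right Xi_sum)

lemma Y_series_sum_left:
  assumes "v \<in> Xi" "\<And>a. a \<in> A \<Longrightarrow> f a \<in> Xi"
  shows "Y_series (\<Sum>a\<in>A. f a) v = (\<Sum>a\<in>A. Y_series (f a) v)"
  using assms(2)
  by (induction A rule: infinite_finite_induct) (auto simp: assms(1) Y_series_add_left Xi_sum)

lemma h_coeff_0: "k \<ge> 1 \<Longrightarrow> h_coeff 0 k = - (2 / of_nat k)"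
  by (cases k) (simp_all add: h_coeff_def field_simps del: of_nat_Suc)

text \<open>Moving xi_m to the left through Y(v,x) contracts it with each factor of v:
  differentiating v by xi_j removes a factor, and the removed h_j(x) leaves the scalar
  \<open>h_coeff j m\<close> times x^(-j-m). The term j = 0 accounts for the exponential.\<close>

lemma Y_series_xi_right:
  assumes "m \<ge> 1" "v \<in> Xi" "w \<in> Xi" "\<And>j. j \<ge> K \<Longrightarrow> partial_xi j v = 0"
  shows "Y_series v (xi m * w) = fls_const (xi m) * Y_series v w +
    (\<Sum>j<K. h_term j m * Y_series (partial_xi j v) w)"
proof -
  let ?d = "\<lambda>j. h_term j m :: amb fls"
  let ?P = "\<lambda>v w K. Y_series v (xi m * w) = fls_const (xi m) * Y_series v w +
    (\<Sum>j<K. ?d j * Y_series (partial_xi j v) w)"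
  have m: "xi m * w \<in> Xi" if "w \<in> Xi" for w using that assms(1) by (rule Xi_xi_mult)
  have "\<exists>L. \<forall>K\<ge>L. \<forall>w\<in>Xi. ?P v w K" using assms(2)
  proof (induction v rule: Xi_induct_gen)
    case (exp q)
    show ?case
    proof (intro exI[of _ 1] allI impI ballI)
      fix K :: nat and w assume K: "1 \<le> K" and w: "w \<in> Xi"
      have "(\<Sum>j<K. ?d j * Y_series (partial_xi j (exp_xi0 q)) w) =
          (\<Sum>j\<in>{0}. ?d j * Y_series (partial_xi j (exp_xi0 q)) w)"
        by (rule sum.mono_neutral_right) (use K w in \<open>auto simp: partial_xi_exp\<close>)
      also have "\<dots> = ?d 0 * (cst1 (of_int q) * Y_series (exp_xi0 q) w)"
        using w by (simp add: partial_xi_exp Y_series_cst_left exp_xi0_in_Xi)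
      also have "\<dots> = (cst1 (h_coeff 0 m) * cst1 (of_int q)) * fls_Xp (- int m) * Y_series (exp_xi0 q) w"
        by (simp only: mult_ac of_nat_0 diff_0 minus_zero)
      also have "cst1 (h_coeff 0 m) * cst1 (of_int q) = cst1 (- (2 * of_int q / of_nat m))"
        using assms(1) by (simp add: h_coeff_0 flip: cst.emb_mult)
      finally show "?P (exp_xi0 q) w K"
        using Y_series_exp_xi[OF assms(1) w, of q] by (simp add: cst.emb_minus left_diff_distrib)
    qed
  next
    case (xi n v)
    then obtain L where L: "\<forall>K\<ge>L. \<forall>w\<in>Xi. ?P v w K" by blast
    show ?case
    proof (intro exI[of _ "max L (Suc n)"] allI impI ballI)
      fix K w assume K: "max L (Suc n) \<le> K" and w: "w \<in> Xi"
      have IH: "?P v w K" if "w \<in> Xi" for w using L K that by auto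
      obtain M0 where M0: "\<forall>k\<ge>M0. partial_xi k w = 0" using partial_xi_eventually_0[OF w] by blast
      define M where "M = max M0 (Suc m)"
      have M: "partial_xi k w = 0" "k \<noteq> m" if "k \<ge> M" for k using that M0 by (auto simp: M_def)
      let ?e = "\<lambda>k. h_term n k :: amb fls"
      let ?h = "h_series n"
      have R1: "Y_series (xi n * u) w' = ?h * Y_series u w' + (\<Sum>k<M. ?e k * Y_series u (partial_xi k w'))"
        if "u \<in> Xi" "w' \<in> Xi" "\<And>k. k \<ge> M \<Longrightarrow> partial_xi k w' = 0" for u w'
        by (rule Y_series_xi) (use xi that in auto)
      have "Y_series (xi n * v) (xi m * w) = ?h * Y_series v (xi m * w) +
          (\<Sum>k<M. ?e k * Y_series v (partial_xi k (xi m * w)))"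
        by (rule R1) (use xi w m M assms(1) in \<open>auto simp: partial_xi_xi_mult\<close>)
      \<comment> \<open>The extra term at k = m is the contraction of the new factor h_n with
        xi_m.\<close>
      also have "(\<Sum>k<M. ?e k * Y_series v (partial_xi k (xi m * w))) =
          (\<Sum>k<M. (if k = m then ?e m * Y_series v w else 0) + ?e k * (fls_const (xi m) * Y_series v (partial_xi k w)
            + (\<Sum>j<K. ?d j * Y_series (partial_xi j v) (partial_xi k w))))"
      proof (rule sum.cong)
        fix k
        have "Y_series v (partial_xi k (xi m * w)) = (if k = m then Y_series v w else 0) + Y_series v (xi m * partial_xi k w)"
          using xi w m assms(1) by (simp add: partial_xi_xi_mult Y_series_add_right partial_xi_in_Xi)
        thus "?e k * Y_series v (partial_xi k (xi m * w)) =
          (if k = m then ?e m * Y_series v w else 0) + ?e k * (fls_const (xi m) * Y_series v (partial_xi k w)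
            + (\<Sum>j<K. ?d j * Y_series (partial_xi j v) (partial_xi k w)))"
          using IH[OF partial_xi_in_Xi[OF w, of k]] by (simp only: distrib_left) simp
      qed simp
      also have "\<dots> = ?e m * Y_series v w + fls_const (xi m) * (\<Sum>k<M. ?e k * Y_series v (partial_xi k w))
          + (\<Sum>j<K. ?d j * (\<Sum>k<M. ?e k * Y_series (partial_xi j v) (partial_xi k w)))"
      proof -
        have "(\<Sum>k<M. if k = m then ?e m * Y_series v w else 0) = ?e m * Y_series v w"
          by (simp add: M_def)
        moreover have "(\<Sum>k<M. ?e k * (fls_const (xi m) * Y_series v (partial_xi k w))) =
            fls_const (xi m) * (\<Sum>k<M. ?e k * Y_series v (partial_xi k w))"
          unfolding sum_distrib_left by (simp only: mult.left_commute)
        moreover have "(\<Sum>k<M. ?e k * (\<Sum>j<K. ?d j * Y_series (partial_xi j v) (partial_xi k w))) =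
            (\<Sum>j<K. ?d j * (\<Sum>k<M. ?e k * Y_series (partial_xi j v) (partial_xi k w)))"
          unfolding sum_distrib_left by (subst sum.swap) (simp only: mult.left_commute)
        ultimately show ?thesis by (simp only: sum.distrib distrib_left add.assoc)
      qed
      also have "?h * Y_series v (xi m * w) + \<dots> = fls_const (xi m) * Y_series (xi n * v) w +
          (?e m * Y_series v w + (\<Sum>j<K. ?d j * (?h * Y_series (partial_xi j v) w
            + (\<Sum>k<M. ?e k * Y_series (partial_xi j v) (partial_xi k w)))))"
      proof -
        have "Y_series (xi n * v) w = ?h * Y_series v w + (\<Sum>k<M. ?e k * Y_series v (partial_xi k w))"
          by (rule R1) (use xi w M in auto)
        moreover have "?h * (\<Sum>j<K. ?d j * Y_series (partial_xi j v) w) = (\<Sum>j<K. ?d j * (?h * Y_series (partial_xi j v) w))"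
          unfolding sum_distrib_left by (simp only: mult.left_commute)
        ultimately show ?thesis unfolding IH[OF w]
          by (simp only: distrib_left sum.distrib mult.left_commute[of ?h "fls_const (xi m)"] add_ac)
      qed
      \<comment> \<open>The extra term is exactly what d/dxi_n gives on the factor xi_n of
        \<open>xi n * v\<close>, because \<open>?e m\<close> and \<open>?d n\<close> are the same
        series.\<close>
      also have "?e m * Y_series v w + (\<Sum>j<K. ?d j * (?h * Y_series (partial_xi j v) w
            + (\<Sum>k<M. ?e k * Y_series (partial_xi j v) (partial_xi k w)))) =
          (\<Sum>j<K. ?d j * Y_series (partial_xi j (xi n * v)) w)"
      proof -
        have "Y_series (partial_xi j (xi n * v)) w = (if j = n then Y_series v w else 0) +
            (?h * Y_series (partial_xi j v) w + (\<Sum>k<M. ?e k * Y_series (partial_xi j v) (partial_xi k w)))" for j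
        proof -
          have "Y_series (partial_xi j (xi n * v)) w = (if j = n then Y_series v w else 0) + Y_series (xi n * partial_xi j v) w"
            using xi w by (simp add: partial_xi_xi_mult Y_series_add_left Xi_xi_mult partial_xi_in_Xi)
          moreover have "Y_series (xi n * partial_xi j v) w = ?h * Y_series (partial_xi j v) w +
              (\<Sum>k<M. ?e k * Y_series (partial_xi j v) (partial_xi k w))"
            by (rule R1) (use xi w M in \<open>auto simp: partial_xi_in_Xi\<close>)
          ultimately show ?thesis by simp
        qed
        moreover have "(\<Sum>j<K. ?d j * (if j = n then Y_series v w else 0)) = ?e m * Y_series v w"
        proof -
          have "(\<Sum>j<K. ?d j * (if j = n then Y_series v w else 0)) = (\<Sum>j<K. if j = n then ?d n * Y_series v w else 0)"
            by (rule sum.cong) auto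
          also have "\<dots> = ?d n * Y_series v w" using K by simp
          finally show ?thesis by simp
        qed
        ultimately show ?thesis by (simp only: distrib_left sum.distrib)
      qed
      finally show "?P (xi n * v) w K" .
    qed
  next
    case (add u v)
    then obtain L L' where L: "\<forall>K\<ge>L. \<forall>w\<in>Xi. ?P u w K" "\<forall>K\<ge>L'. \<forall>w\<in>Xi. ?P v w K" by blast
    show ?case
    proof (intro exI[of _ "max L L'"] allI impI ballI)
      fix K w assume "max L L' \<le> K" and w: "w \<in> Xi"
      hence "?P u w K" "?P v w K" using L by auto
      thus "?P (u + v) w K"
        using add.hyps w m
        by (simp only: Y_series_add_left partial_xi_add partial_xi_in_Xi distrib_left sum.distrib add_ac)
    qed
  next
    case (scale c v)
    then obtain L where L: "\<forall>K\<ge>L. \<forall>w\<in>Xi. ?P v w K" by blast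
    show ?case
    proof (intro exI[of _ L] allI impI ballI)
      fix K w assume "L \<le> K" and w: "w \<in> Xi"
      hence "?P v w K" using L by auto
      thus "?P (cst c * v) w K"
        using scale.hyps w m
        by (simp only: Y_series_cst_left partial_xi_cst partial_xi_in_Xi distrib_left sum_distrib_left
            mult.left_commute[of _ "cst1 c"])
    qed
  qed
  then obtain L where L: "\<forall>K\<ge>L. \<forall>w\<in>Xi. ?P v w K" by blast
  have "(\<Sum>j<max K L. ?d j * Y_series (partial_xi j v) w) = (\<Sum>j<K. ?d j * Y_series (partial_xi j v) w)"
    by (rule sum.mono_neutral_right) (use assms in auto)
  moreover have "?P v w (max K L)" using L assms(3) by simp
  ultimately show ?thesis by simp
qed

text \<open>The equation determines (n+1) times the coefficient at n + 1 from the lower ones. The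
  coefficients will themselves be power series or Laurent series, so division by n + 1 is phrased as
  absence of torsion.\<close>

lemma fls_ode_unique:
  fixes D :: "'a::comm_ring_1 fls"
  assumes torsion: "\<And>n (x :: 'a). of_nat (Suc n) * x = 0 \<Longrightarrow> x = 0"
    and f: "\<And>i. i < 0 \<Longrightarrow> f $$ i = 0" and D: "\<And>i. i < 0 \<Longrightarrow> D $$ i = 0" "D $$ 0 = 0"
    and ode: "fls_deriv D = f * D"
  shows "D = 0"
proof (rule fls_eqI)
  have nat: "D $$ int n = 0" for n
  proof (induction n rule: less_induct)
    case (less n)
    show ?case
    proof (cases n)
      case (Suc k)
      have "of_nat (Suc k) * D $$ int (Suc k) = fls_deriv D $$ int k"
        by (simp add: add.commute)
      also have "\<dots> = (\<Sum>u\<le>k. f $$ int u * D $$ int (k - u))"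
        unfolding ode by (rule fls_times_nth_atMost) (use f D in auto)
      also have "\<dots> = 0"
      proof (rule sum.neutral, rule ballI)
        fix u
        have "D $$ int (k - u) = 0" by (rule less) (simp add: Suc)
        thus "f $$ int u * D $$ int (k - u) = 0" by simp
      qed
      finally show ?thesis using torsion Suc by blast
    qed (use D in simp)
  qed
  fix i show "D $$ i = 0 $$ i"
    using nat[of "nat i"] D(1)[of i] by (cases "i < 0") auto
qed

lemma fls_ode_unique_amb:
  fixes F G :: "amb fls"
  assumes "\<And>i. i < 0 \<Longrightarrow> f $$ i = 0" "\<And>i. i < 0 \<Longrightarrow> F $$ i = 0" "\<And>i. i < 0 \<Longrightarrow> G $$ i = 0"
    "F $$ 0 = G $$ 0" "fls_deriv F = f * F + g" "fls_deriv G = f * G + g"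
  shows "F = G"
proof -
  have "F - G = 0"
  proof (rule fls_ode_unique[of f])
    fix n and x :: amb assume "of_nat (Suc n) * x = 0"
    hence "cst (of_nat (Suc n)) * x = 0" by (simp only: cst.emb_of_nat)
    thus "x = 0" by (rule cst_mult_eq_0 [rotated]) (simp del: of_nat_Suc)
  qed (use assms in \<open>auto simp: right_diff_distrib\<close>)
  thus ?thesis by simp
qed

lemma fls_ode_unique_amb2:
  fixes F G :: "amb fls fls"
  assumes "\<And>i. i < 0 \<Longrightarrow> f $$ i = 0" "\<And>i. i < 0 \<Longrightarrow> F $$ i = 0" "\<And>i. i < 0 \<Longrightarrow> G $$ i = 0"
    "F $$ 0 = G $$ 0" "fls_deriv F = f * F" "fls_deriv G = f * G"
  shows "F = G"
proof -
  have "F - G = 0"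
  proof (rule fls_ode_unique[of f])
    fix n and x :: "amb fls" assume "of_nat (Suc n) * x = 0"
    hence *: "cst1 (of_nat (Suc n)) * x = 0" by (simp only: cst.emb_of_nat fls_of_nat)
    show "x = 0"
    proof (rule fls_eqI)
      fix i
      have "cst (of_nat (Suc n)) * x $$ i = 0" using arg_cong[OF *, of "\<lambda>x. x $$ i"] by (simp del: of_nat_Suc)
      thus "x $$ i = 0 $$ i" using cst_mult_eq_0[of "of_nat (Suc n)" "x $$ i"] by (simp del: of_nat_Suc)
    qed
  qed (use assms in \<open>auto simp: right_diff_distrib\<close>)
  thus ?thesis by simp
qed

section \<open>Coefficientwise partial derivatives and their commutators\<close>

definition fls_partial :: "nat \<Rightarrow> amb fls \<Rightarrow> amb fls" where
  "fls_partial k F = Abs_fls (\<lambda>i. partial_xi k (F $$ i))"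

lemma fls_partial_nth [simp]: "fls_partial k F $$ i = partial_xi k (F $$ i)"
proof -
  obtain N where "\<forall>n<N. F $$ n = 0" by (rule fls_nth_vanishes_belowE)
  thus ?thesis unfolding fls_partial_def by (intro nth_Abs_fls_lower_bound[of N]) auto
qed

lemma fls_partial_add: "fls_partial k (F + G) = fls_partial k F + fls_partial k G"
  by (rule fls_eqI) (simp add: partial_xi_add)

lemma fls_partial_sum: "fls_partial k (\<Sum>a\<in>A. F a) = (\<Sum>a\<in>A. fls_partial k (F a))"
  by (rule fls_eqI) (simp add: fls_sum_nth partial_xi_sum)

lemma fls_partial_cst: "fls_partial k (cst1 c * F) = cst1 c * fls_partial k F"
  by (rule fls_eqI) (simp add: partial_xi_cst)

lemma fls_partial_Xp: "fls_partial k (fls_Xp r * F) = fls_Xp r * fls_partial k F"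
  by (rule fls_eqI) simp

lemma fls_partial_mult:
  assumes "Xi_series F"
  shows "fls_partial k (F * G) = fls_partial k F * G + F * fls_partial k G"
proof (rule fls_eqI)
  fix n
  let ?S = "{fls_subdegree F..n - fls_subdegree G}"
  have S: "m \<in> ?S" if "F $$ m \<noteq> 0" "G $$ (n - m) \<noteq> 0" for m
    using fls_subdegree_leI[OF that(1)] fls_subdegree_leI[OF that(2)] by simp
  have "(fls_partial k F * G) $$ n = (\<Sum>m\<in>?S. fls_partial k F $$ m * G $$ (n - m))"
  proof (rule fls_times_nth_sum)
    fix m assume "fls_partial k F $$ m \<noteq> 0" "G $$ (n - m) \<noteq> 0"
    moreover from this have "F $$ m \<noteq> 0" by auto
    ultimately show "m \<in> ?S" using S by blast
  qed simp
  moreover have "(F * fls_partial k G) $$ n = (\<Sum>m\<in>?S. F $$ m * fls_partial k G $$ (n - m))"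
  proof (rule fls_times_nth_sum)
    fix m assume "F $$ m \<noteq> 0" "fls_partial k G $$ (n - m) \<noteq> 0"
    moreover from this have "G $$ (n - m) \<noteq> 0" by auto
    ultimately show "m \<in> ?S" using S by blast
  qed simp
  moreover have "(F * G) $$ n = (\<Sum>m\<in>?S. F $$ m * G $$ (n - m))"
    by (rule fls_times_nth_sum[OF _ S]) auto
  ultimately show "fls_partial k (F * G) $$ n = (fls_partial k F * G + F * fls_partial k G) $$ n"
    using assms by (simp add: partial_xi_sum partial_xi_mult Xi_series_nth sum.distrib)
qed

text \<open>In the n-th divided derivative of h^-(x) the variable xi_k has the coefficient (k choose
  n) x^(k-n).\<close>

lemma fls_partial_h_series:
  assumes "n \<ge> 1"
  shows "fls_partial k (h_series n) = cst1 (of_nat (k choose n)) * fls_Xp (int k - int n)"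
proof (rule fls_eqI)
  fix i
  have *: "partial_xi k (xi (j + n)) = (if k = j + n then 1 else 0)" for j
    using partial_xi_xi_mult[of "j + n" k 1] assms by simp
  consider "i < 0" | "i \<ge> 0" "int k = i + int n" | "i \<ge> 0" "int k \<noteq> i + int n" by linarith
  thus "fls_partial k (h_series n) $$ i = (cst1 (of_nat (k choose n)) * fls_Xp (int k - int n)) $$ i"
  proof cases
    case 1
    thus ?thesis by (auto simp: h_series_nth binomial_eq_0)
  next
    case 2
    then obtain j where j: "i = int j" "k = j + n"
      by (metis nonneg_int_cases of_nat_add of_nat_eq_iff)
    thus ?thesis using *[of j] by (simp add: h_series_nth partial_xi_cst)
  next
    case 3
    then obtain j where j: "i = int j" by (metis nonneg_int_cases)
    hence "k \<noteq> j + n" "int j \<noteq> int k - int n" using 3 by auto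
    thus ?thesis by (simp add: j h_series_nth partial_xi_cst *)
  qed
qed

lemma partial_xi_of_int: "partial_xi k (of_int c * w) = of_int c * partial_xi k w"
  by (simp add: of_int_amb partial_xi_cst)

lemma fls_deriv_partial: "fls_deriv (fls_partial k F) = fls_partial k (fls_deriv F)"
  by (rule fls_eqI) (simp add: partial_xi_of_int del: of_int_add)

lemma fls_deriv_Xp: "fls_deriv (fls_Xp r) = of_int r * fls_Xp (r - 1)"
  by (rule fls_eqI) (auto simp: fls_of_int_nth fls_of_int simp flip: fls_const_mult_const)

text \<open>Formally the chain rule, as d/dxi_k turns h^-(x) into x^k. The series is known through
  its differential equation, so both sides are shown to solve the differentiated, now inhomogeneous,
  equation with the same initial value.\<close>

lemma fls_partial_exp_h_series:
  "fls_partial k (exp_h_series m) = cst1 (of_int m) * fls_Xp (int k) * exp_h_series m"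
proof (rule fls_ode_unique_amb)
  let ?f = "cst1 (of_int m) * h_series 1"
  let ?g = "cst1 (of_int m) * (cst1 (of_nat k) * fls_Xp (int k - 1)) * exp_h_series m"
  show "fls_deriv (fls_partial k (exp_h_series m)) = ?f * fls_partial k (exp_h_series m) + ?g"
    unfolding fls_deriv_partial fls_deriv_exp_h_series mult.assoc fls_partial_cst
      fls_partial_mult[OF Xi_series_h_series[OF order_refl]] fls_partial_h_series[OF order_refl]
    by (simp add: distrib_left mult_ac)
  show "fls_deriv (cst1 (of_int m) * fls_Xp (int k) * exp_h_series m) =
      ?f * (cst1 (of_int m) * fls_Xp (int k) * exp_h_series m) + ?g"
    by (simp add: fls_deriv_exp_h_series fls_deriv_Xp cst.emb_of_nat fls_of_nat distrib_left mult_ac)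
  show "fls_partial k (exp_h_series m) $$ 0 = (cst1 (of_int m) * fls_Xp (int k) * exp_h_series m) $$ 0"
    by (simp add: mult.assoc exp_h_series_nth partial_xi_exp)
qed (auto simp: h_series_nth exp_h_series_nth mult.assoc)

lemma fls_partial_Y_series_exp:
  assumes "w \<in> Xi"
  shows "fls_partial k (Y_series (exp_xi0 m) w) = Y_series (exp_xi0 m) (partial_xi k w)
    + cst1 (of_int m) * fls_Xp (int k) * Y_series (exp_xi0 m) w"
  using assms
proof (induction w rule: Xi_induct_gen)
  case (exp q)
  have "fls_partial k (fls_const (exp_xi0 q)) = (if k = 0 then cst1 (of_int q) else 0) * fls_const (exp_xi0 q)"
    by (rule fls_eqI) (auto simp: partial_xi_exp)
  moreover have "Y_series (exp_xi0 m) (partial_xi k (exp_xi0 q)) =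
      (if k = 0 then cst1 (of_int q) else 0) * Y_series (exp_xi0 m) (exp_xi0 q)"
    by (auto simp: partial_xi_exp Y_series_cst_right exp_xi0_in_Xi)
  ultimately show ?case
    unfolding Y_series_exp_exp mult.assoc fls_partial_Xp
    by (simp add: fls_partial_mult Xi_series_exp_h_series fls_partial_exp_h_series distrib_left mult_ac add_ac)
next
  case (xi n w)
  let ?A = "fls_const (xi n) - cst1 (2 * of_int m / of_nat n) * fls_Xp (- int n)"
  have R2: "Y_series (exp_xi0 m) (xi n * v) = ?A * Y_series (exp_xi0 m) v" if "v \<in> Xi" for v
    using that xi by (intro Y_series_exp_xi) auto
  have A: "Xi_series ?A"
    using xi by (intro Xi_series_diff Xi_series_mult Xi_series_const Xi_series_Xp xi_in_Xi) auto
  have pA: "fls_partial k ?A = (if k = n then 1 else 0)"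
  proof (rule fls_eqI)
    fix i
    have diff: "partial_xi k (a - cst c) = partial_xi k a" for a c
      using partial_xi_add[of k "a - cst c" "cst c"] partial_xi_cst[of k c 1] by simp
    have "partial_xi k (xi n) = (if k = n then 1 else 0)"
      using partial_xi_xi_mult[of n k 1] xi by simp
    thus "fls_partial k ?A $$ i = (if k = n then 1 else 0) $$ i"
      using diff[of "xi n" 0] diff[of 0 "2 * of_int m / of_nat n"] diff[of "xi n" "2 * of_int m / of_nat n"] by auto
  qed
  have "Y_series (exp_xi0 m) (partial_xi k (xi n * w)) =
      (if k = n then Y_series (exp_xi0 m) w else 0) + ?A * Y_series (exp_xi0 m) (partial_xi k w)"
    using xi R2[OF partial_xi_in_Xi[of w k]]
    by (simp add: partial_xi_xi_mult Y_series_add_right exp_xi0_in_Xi partial_xi_in_Xi Xi_xi_mult)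
  thus ?case
    unfolding R2[OF \<open>w \<in> Xi\<close>] fls_partial_mult[OF A] pA xi.IH
    by (auto simp: distrib_left mult_ac add_ac)
next
  case (add v w)
  thus ?case by (simp add: Y_series_add_right partial_xi_add partial_xi_in_Xi exp_xi0_in_Xi fls_partial_add distrib_left)
next
  case (scale c w)
  thus ?case
    by (simp add: Y_series_cst_right partial_xi_cst partial_xi_in_Xi exp_xi0_in_Xi fls_partial_cst distrib_left
        mult.left_commute)
qed

text \<open>The counterpart of \<open>Y_series_xi_right\<close>: d/dxi_k commutes with all
  differential operators in Y(v,x) and meets each multiplication operator h_j^-(x) in the scalar (k
  choose j) x^(k-j).\<close>

lemma fls_partial_Y_series:
  assumes "v \<in> Xi" "w \<in> Xi"
  shows "fls_partial k (Y_series v w) = Y_series v (partial_xi k w) +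
    (\<Sum>j\<le>k. cst1 (of_nat (k choose j)) * fls_Xp (int k - int j) * Y_series (partial_xi j v) w)"
  using assms
proof (induction v arbitrary: w rule: Xi_induct_gen)
  case (exp m)
  have "(\<Sum>j\<le>k. cst1 (of_nat (k choose j)) * fls_Xp (int k - int j) * Y_series (partial_xi j (exp_xi0 m)) w) =
      (\<Sum>j\<in>{0}. cst1 (of_nat (k choose j)) * fls_Xp (int k - int j) * Y_series (partial_xi j (exp_xi0 m)) w)"
    by (rule sum.mono_neutral_right) (use exp in \<open>auto simp: partial_xi_exp\<close>)
  thus ?case using exp
    by (simp add: fls_partial_Y_series_exp partial_xi_exp Y_series_cst_left exp_xi0_in_Xi mult.left_commute)
next
  case (xi n v)
  let ?b = "\<lambda>j. cst1 (of_nat (k choose j)) * fls_Xp (int k - int j) :: amb fls"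
  let ?e = "\<lambda>i. h_term n i :: amb fls"
  let ?h = "h_series n"
  obtain K where K: "\<forall>k\<ge>K. partial_xi k w = 0" using partial_xi_eventually_0[OF xi.prems] by blast
  have K': "partial_xi i (partial_xi k w) = 0" if "i \<ge> K" for i
    using K that by (metis partial_xi_commute partial_xi_zero)
  have R1: "Y_series (xi n * u) w' = ?h * Y_series u w' + (\<Sum>i<K. ?e i * Y_series u (partial_xi i w'))"
    if "u \<in> Xi" "w' \<in> Xi" "\<And>i. i \<ge> K \<Longrightarrow> partial_xi i w' = 0" for u w'
    by (rule Y_series_xi) (use xi that in auto)
  have IH: "fls_partial k (Y_series v w') = Y_series v (partial_xi k w') + (\<Sum>j\<le>k. ?b j * Y_series (partial_xi j v) w')"
    if "w' \<in> Xi" for w' using xi.IH[OF that] .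
  have "fls_partial k (Y_series (xi n * v) w) =
      fls_partial k (?h * Y_series v w) + (\<Sum>i<K. fls_partial k (?e i * Y_series v (partial_xi i w)))"
    using R1[OF xi(2) xi.prems] K by (simp add: fls_partial_add fls_partial_sum)
  also have "fls_partial k (?h * Y_series v w) = ?b n * Y_series v w + ?h * fls_partial k (Y_series v w)"
    using xi by (simp add: fls_partial_mult Xi_series_h_series fls_partial_h_series)
  also have "(\<Sum>i<K. fls_partial k (?e i * Y_series v (partial_xi i w))) =
      (\<Sum>i<K. ?e i * Y_series v (partial_xi i (partial_xi k w))) +
      (\<Sum>j\<le>k. ?b j * (\<Sum>i<K. ?e i * Y_series (partial_xi j v) (partial_xi i w)))"
  proof -
    have "fls_partial k (?e i * Y_series v (partial_xi i w)) = ?e i * Y_series v (partial_xi i (partial_xi k w)) +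
        (\<Sum>j\<le>k. ?b j * (?e i * Y_series (partial_xi j v) (partial_xi i w)))" for i
      using IH[OF partial_xi_in_Xi[OF xi.prems, of i]]
      by (simp add: mult.assoc fls_partial_cst fls_partial_Xp partial_xi_commute[of k i] distrib_left sum_distrib_left)
        (simp add: mult_ac)
    hence "(\<Sum>i<K. fls_partial k (?e i * Y_series v (partial_xi i w))) =
        (\<Sum>i<K. ?e i * Y_series v (partial_xi i (partial_xi k w))) +
        (\<Sum>i<K. \<Sum>j\<le>k. ?b j * (?e i * Y_series (partial_xi j v) (partial_xi i w)))"
      by (simp only: sum.distrib)
    also have "(\<Sum>i<K. \<Sum>j\<le>k. ?b j * (?e i * Y_series (partial_xi j v) (partial_xi i w))) =
        (\<Sum>j\<le>k. ?b j * (\<Sum>i<K. ?e i * Y_series (partial_xi j v) (partial_xi i w)))"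
      unfolding sum_distrib_left by (rule sum.swap)
    finally show ?thesis .
  qed
  also have "?b n * Y_series v w + ?h * fls_partial k (Y_series v w) + \<dots> =
      (?h * Y_series v (partial_xi k w) + (\<Sum>i<K. ?e i * Y_series v (partial_xi i (partial_xi k w)))) +
      (?b n * Y_series v w + (\<Sum>j\<le>k. ?b j * (?h * Y_series (partial_xi j v) w
        + (\<Sum>i<K. ?e i * Y_series (partial_xi j v) (partial_xi i w)))))"
  proof -
    have "?h * (\<Sum>j\<le>k. ?b j * Y_series (partial_xi j v) w) = (\<Sum>j\<le>k. ?b j * (?h * Y_series (partial_xi j v) w))"
      unfolding sum_distrib_left by (simp only: mult.left_commute)
    thus ?thesis unfolding IH[OF xi.prems] by (simp only: distrib_left sum.distrib add_ac)
  qed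
  also have "?h * Y_series v (partial_xi k w) + (\<Sum>i<K. ?e i * Y_series v (partial_xi i (partial_xi k w))) =
      Y_series (xi n * v) (partial_xi k w)"
    by (rule R1 [symmetric]) (use xi K' in \<open>auto simp: partial_xi_in_Xi\<close>)
  also have "?b n * Y_series v w + (\<Sum>j\<le>k. ?b j * (?h * Y_series (partial_xi j v) w
        + (\<Sum>i<K. ?e i * Y_series (partial_xi j v) (partial_xi i w)))) =
      (\<Sum>j\<le>k. ?b j * Y_series (partial_xi j (xi n * v)) w)"
  proof -
    have "Y_series (partial_xi j (xi n * v)) w = (if j = n then Y_series v w else 0) +
        (?h * Y_series (partial_xi j v) w + (\<Sum>i<K. ?e i * Y_series (partial_xi j v) (partial_xi i w)))" for j
    proof -
      have "Y_series (partial_xi j (xi n * v)) w = (if j = n then Y_series v w else 0) + Y_series (xi n * partial_xi j v) w"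
        using xi by (simp add: partial_xi_xi_mult Y_series_add_left Xi_xi_mult partial_xi_in_Xi)
      moreover have "Y_series (xi n * partial_xi j v) w = ?h * Y_series (partial_xi j v) w +
          (\<Sum>i<K. ?e i * Y_series (partial_xi j v) (partial_xi i w))"
        by (rule R1) (use xi K in \<open>auto simp: partial_xi_in_Xi\<close>)
      ultimately show ?thesis by simp
    qed
    \<comment> \<open>For n > k the index n is missing from the sum, but then the binomial in
      \<open>?b n\<close> is zero.\<close>
    moreover have "(\<Sum>j\<le>k. ?b j * (if j = n then Y_series v w else 0)) = ?b n * Y_series v w"
    proof -
      have "(\<Sum>j\<le>k. ?b j * (if j = n then Y_series v w else 0)) = (\<Sum>j\<le>k. if j = n then ?b n * Y_series v w else 0)"
        by (rule sum.cong) auto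
      also have "\<dots> = ?b n * Y_series v w" by (cases "n \<le> k") (auto simp: binomial_eq_0)
      finally show ?thesis .
    qed
    ultimately show ?thesis by (simp only: distrib_left sum.distrib)
  qed
  finally show ?case .
next
  case (add u v)
  thus ?case
    by (simp add: Y_series_add_left partial_xi_add partial_xi_in_Xi fls_partial_add distrib_left sum.distrib add_ac)
next
  case (scale c v)
  thus ?case
    by (simp add: Y_series_cst_left partial_xi_cst partial_xi_in_Xi fls_partial_cst distrib_left sum_distrib_left
        mult.left_commute)
qed

section \<open>Products and iterates of vertex operators\<close>

text \<open>\<open>Y(u,x)Y(v,y)w\<close>, with inner variable \<open>x\<close> and outer variable \<open>y\<close>\<close>

definition Y_comp :: "amb \<Rightarrow> amb \<Rightarrow> amb \<Rightarrow> amb fls fls" where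
  "Y_comp u v w = Abs_fls (\<lambda>j. Y_series u (Y_series v w $$ j))"

text \<open>\<open>Y(Y(u,z)v,y)w\<close>, with inner variable \<open>y\<close> and outer variable \<open>z\<close>\<close>

definition Y_iter :: "amb \<Rightarrow> amb \<Rightarrow> amb \<Rightarrow> amb fls fls" where
  "Y_iter u v w = Abs_fls (\<lambda>k. Y_series (Y_series u v $$ k) w)"

lemma Y_comp_nth: "u \<in> Xi \<Longrightarrow> Y_comp u v w $$ j = Y_series u (Y_series v w $$ j)"
proof -
  assume "u \<in> Xi"
  obtain N where "\<forall>n<N. Y_series v w $$ n = 0" by (rule fls_nth_vanishes_belowE)
  thus ?thesis unfolding Y_comp_def using \<open>u \<in> Xi\<close> by (intro nth_Abs_fls_lower_bound[of N]) auto
qed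

lemma Y_iter_nth: "w \<in> Xi \<Longrightarrow> Y_iter u v w $$ k = Y_series (Y_series u v $$ k) w"
proof -
  assume "w \<in> Xi"
  obtain N where "\<forall>n<N. Y_series u v $$ n = 0" by (rule fls_nth_vanishes_belowE)
  thus ?thesis unfolding Y_iter_def using \<open>w \<in> Xi\<close> by (intro nth_Abs_fls_lower_bound[of N]) auto
qed

lemma Y_comp_add:
  "u \<in> Xi \<Longrightarrow> u' \<in> Xi \<Longrightarrow> v \<in> Xi \<Longrightarrow> w \<in> Xi \<Longrightarrow> Y_comp (u + u') v w = Y_comp u v w + Y_comp u' v w"
  "u \<in> Xi \<Longrightarrow> u' \<in> Xi \<Longrightarrow> v \<in> Xi \<Longrightarrow> w \<in> Xi \<Longrightarrow> Y_comp v (u + u') w = Y_comp v u w + Y_comp v u' w"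
  "u \<in> Xi \<Longrightarrow> u' \<in> Xi \<Longrightarrow> v \<in> Xi \<Longrightarrow> w \<in> Xi \<Longrightarrow> Y_comp v w (u + u') = Y_comp v w u + Y_comp v w u'"
  by (rule fls_eqI, simp add: Y_comp_nth Y_series_add_left Y_series_add_right Y_series_nth_in_Xi Xi_add)+

lemma Y_iter_add:
  "u \<in> Xi \<Longrightarrow> u' \<in> Xi \<Longrightarrow> v \<in> Xi \<Longrightarrow> w \<in> Xi \<Longrightarrow> Y_iter (u + u') v w = Y_iter u v w + Y_iter u' v w"
  "u \<in> Xi \<Longrightarrow> u' \<in> Xi \<Longrightarrow> v \<in> Xi \<Longrightarrow> w \<in> Xi \<Longrightarrow> Y_iter v (u + u') w = Y_iter v u w + Y_iter v u' w"
  "u \<in> Xi \<Longrightarrow> u' \<in> Xi \<Longrightarrow> v \<in> Xi \<Longrightarrow> w \<in> Xi \<Longrightarrow> Y_iter v w (u + u') = Y_iter v w u + Y_iter v w u'"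
  by (rule fls_eqI, simp add: Y_iter_nth Y_series_add_left Y_series_add_right Y_series_nth_in_Xi Xi_add)+

lemma Y_comp_cst:
  "u \<in> Xi \<Longrightarrow> v \<in> Xi \<Longrightarrow> w \<in> Xi \<Longrightarrow> Y_comp (cst c * u) v w = cst2 c * Y_comp u v w"
  "u \<in> Xi \<Longrightarrow> v \<in> Xi \<Longrightarrow> w \<in> Xi \<Longrightarrow> Y_comp u (cst c * v) w = cst2 c * Y_comp u v w"
  "u \<in> Xi \<Longrightarrow> v \<in> Xi \<Longrightarrow> w \<in> Xi \<Longrightarrow> Y_comp u v (cst c * w) = cst2 c * Y_comp u v w"
  by (rule fls_eqI, simp add: Y_comp_nth Y_series_cst_left Y_series_cst_right Y_series_nth_in_Xi Xi_cst_mult)+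

lemma Y_iter_cst:
  "u \<in> Xi \<Longrightarrow> v \<in> Xi \<Longrightarrow> w \<in> Xi \<Longrightarrow> Y_iter (cst c * u) v w = cst2 c * Y_iter u v w"
  "u \<in> Xi \<Longrightarrow> v \<in> Xi \<Longrightarrow> w \<in> Xi \<Longrightarrow> Y_iter u (cst c * v) w = cst2 c * Y_iter u v w"
  "u \<in> Xi \<Longrightarrow> v \<in> Xi \<Longrightarrow> w \<in> Xi \<Longrightarrow> Y_iter u v (cst c * w) = cst2 c * Y_iter u v w"
  by (rule fls_eqI, simp add: Y_iter_nth Y_series_cst_left Y_series_cst_right Y_series_nth_in_Xi Xi_cst_mult)+

section \<open>Expansions of the contractions\<close>

lemma fls_common_lower_bound:
  "finite A \<Longrightarrow> \<exists>N. \<forall>a\<in>A. \<forall>i<N. (F a :: 'a::zero fls) $$ i = 0"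
proof (induction A rule: finite_induct)
  case (insert x A)
  then obtain N where "\<forall>a\<in>A. \<forall>i<N. F a $$ i = 0" by blast
  moreover obtain M where "\<forall>i<M. F x $$ i = 0" by (rule fls_nth_vanishes_belowE)
  ultimately show ?case by (intro exI[of _ "min M N"]) auto
qed auto

text \<open>The coefficients of \<open>h_coeff n j\<close> times (x - y)^(-n-j), expanded in powers
  of y: the power y^s collects what d/dxi_(j+s) in h_n^+(x) meets in h_j^-(y).\<close>

lemma h_coeff_binomial:
  assumes "n + j \<ge> 1"
  shows "h_coeff n (j + s) * of_nat ((j + s) choose j) =
    h_coeff n j * ((of_int (- int n - int j) gchoose s) * (-1) ^ s)"
proof -
  obtain p where p: "n + j = Suc p" using assms by (cases "n + j") auto
  have "(of_int (- int n - int j) :: complex) = - of_nat (n + j)" by simp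
  hence "(of_int (- int n - int j) :: complex) = - of_nat (Suc p)" by (simp only: p)
  moreover have "(- of_nat (Suc p) :: complex) gchoose s = (-1) ^ s * (of_nat (p + s) gchoose s)"
    by (subst gbinomial_negated_upper) (simp add: algebra_simps)
  ultimately have "(of_int (- int n - int j) gchoose s) * (-1) ^ s = (of_nat (p + s) gchoose s :: complex)"
    by (simp only: mult.commute[of "_ gchoose _"] mult.assoc [symmetric])
      (simp flip: power_mult_distrib)
  also have "\<dots> = of_nat ((p + s) choose s)" by (simp add: binomial_gbinomial)
  also have "\<dots> = fact (p + s) / (fact s * fact p)" by (subst binomial_fact) auto
  finally have 1: "(of_int (- int n - int j) gchoose s) * (-1) ^ s = (fact (p + s) / (fact s * fact p) :: complex)" .
  have 2: "of_nat ((j + s) choose j) = (fact (j + s) / (fact j * fact s) :: complex)"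
    by (subst binomial_fact) auto
  have 3: "n + (j + s) - 1 = p + s" "n + j - 1 = p" using p by auto
  show ?thesis unfolding 1 2 h_coeff_def 3 by simp
qed

lemma neg_one_powi_minus: "(-1) powi (- int m) = ((-1) ^ m :: complex)"
  by (cases "even m") (auto simp: power_int_minus)

text \<open>The contraction of h_n(x) with h_j(y) equals that of h_j(y) with h_n(x), since log (x -
  y) and log (y - x) have the same derivatives; the sign converts (x - y)^(-n-j) into (y -
  x)^(-n-j).\<close>

lemma h_coeff_sym: "h_coeff j n = (-1) powi (- int n - int j) * h_coeff n j"
proof -
  have "(-1) powi (- int n - int j) = ((-1) ^ (n + j) :: complex)"
    using neg_one_powi_minus[of "n + j"] by simp
  moreover have "(-1) ^ (n + j) * (-1) ^ Suc n = ((-1) ^ Suc j :: complex)"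
    by (simp add: power_add mult_ac flip: power_mult_distrib)
  ultimately show ?thesis by (simp add: h_coeff_def add.commute mult_ac)
qed

lemma h_coeff_binser_minus:
  assumes "n + j \<ge> 1" "\<And>s. s \<ge> S \<Longrightarrow> G $$ (t - int s) = 0"
  shows "(cst2 (h_coeff n j) * cst.binser (-1) (- int n - int j) * G) $$ t =
    (\<Sum>s<S. cst1 (h_coeff n (j + s) * of_nat ((j + s) choose j)) * fls_Xp (- int n - int (j + s)) * G $$ (t - int s))"
proof -
  have "(cst.binser (-1) (- int n - int j) * G) $$ t =
      (\<Sum>s<S. cst.binser (-1) (- int n - int j) $$ int s * G $$ (t - int s))"
    by (rule fls_times_nth_nat) (use assms in \<open>auto simp: cst.binser_nth_neg\<close>)
  thus ?thesis
    using assms(1) h_coeff_binomial[of n j]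
    by (simp add: mult.assoc cst.binser_nth_nat sum_distrib_left)
      (simp add: mult.assoc [symmetric] diff_diff_eq flip: cst.emb_mult)
qed

lemma h_coeff_binser_minus':
  assumes "n + j \<ge> 1" "\<And>s. j + s \<ge> K \<Longrightarrow> G $$ (t - int s) = 0"
  shows "(cst2 (h_coeff n j) * cst.binser (-1) (- int n - int j) * G) $$ t =
    (\<Sum>k<K. cst1 (h_coeff n k * of_nat (k choose j)) * fls_Xp (- int n - int k) * G $$ (t - (int k - int j)))"
proof -
  have "(cst2 (h_coeff n j) * cst.binser (-1) (- int n - int j) * G) $$ t =
    (\<Sum>s<K - j. cst1 (h_coeff n (j + s) * of_nat ((j + s) choose j)) * fls_Xp (- int n - int (j + s)) * G $$ (t - int s))"
    by (rule h_coeff_binser_minus) (use assms in auto)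
  also have "\<dots> = (\<Sum>k\<in>{j..<K}. cst1 (h_coeff n k * of_nat (k choose j)) * fls_Xp (- int n - int k) * G $$ (t - (int k - int j)))"
    by (rule sum.reindex_bij_witness[of _ "\<lambda>k. k - j" "\<lambda>s. j + s"]) auto
  also have "\<dots> = (\<Sum>k<K. cst1 (h_coeff n k * of_nat (k choose j)) * fls_Xp (- int n - int k) * G $$ (t - (int k - int j)))"
    by (rule sum.mono_neutral_left) (auto simp: binomial_eq_0)
  finally show ?thesis .
qed

text \<open>The same function (x - y)^(-n-j), expanded in powers of x. Exchanging the indices of
  \<open>h_coeff\<close> absorbs the sign \<open>sgn_pow\<close>.\<close>

lemma h_coeff_binser_minus_sym:
  assumes "n + j \<ge> 1" "\<And>s. s \<ge> S \<Longrightarrow> G $$ (t - int s) = 0"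
  shows "(cst2 (h_coeff n j) * (cst.sgn_pow (- int n - int j) * cst.binser (-1) (- int n - int j) * G)) $$ t =
    (\<Sum>s<S. cst1 (h_coeff j (s + n) * of_nat ((s + n) choose n)) * fls_Xp (- int j - int (s + n)) * G $$ (t - int s))"
proof -
  have "cst.binser (-1) (- int n - int j) = cst.binser (-1) (- int j - int n)"
    by (rule arg_cong) simp
  hence "cst2 (h_coeff n j) * (cst.sgn_pow (- int n - int j) * cst.binser (-1) (- int n - int j) * G) =
      cst2 (h_coeff j n) * cst.binser (-1) (- int j - int n) * G"
    by (simp add: h_coeff_sym[of j n] cst.sgn_pow_def cst.emb_mult mult_ac flip: fls_const_mult_const)
  thus ?thesis
    using h_coeff_binser_minus[of j n S G t] assms by (simp add: add.commute)
qed

text \<open>Taylor's formula for the coefficient of d/dxi_k in h_n^+(y + z). Up to signs, which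
  cancel, it is \<open>h_coeff_binomial\<close> with the two indices exchanged.\<close>

lemma h_coeff_binser_plus:
  assumes "n + k \<ge> 1" "\<And>s. s \<ge> S \<Longrightarrow> G $$ (t - int s) = 0"
  shows "(cst2 (h_coeff n k) * (cst.binser 1 (- int n - int k) * G)) $$ t =
    (\<Sum>s<S. cst1 (of_nat ((s + n) choose n) * h_coeff (s + n) k) * fls_Xp (- int (s + n) - int k) * G $$ (t - int s))"
proof -
  have num: "h_coeff n k * (of_int (- int n - int k) gchoose s) = of_nat ((s + n) choose n) * h_coeff (s + n) k" for s
  proof -
    have 1: "- int k - int n = - int n - int k" by simp
    have "h_coeff (s + n) k = (-1) ^ (s + n + k) * h_coeff k (n + s)"
    proof -
      have "(-1) powi (- int k - int (s + n)) = ((-1) ^ (s + n + k) :: complex)"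
        using neg_one_powi_minus[of "s + n + k"] by (simp add: algebra_simps)
      thus ?thesis using h_coeff_sym[of "s + n" k] by (simp add: add.commute)
    qed
    moreover have "h_coeff k n = (-1) ^ (n + k) * h_coeff n k"
    proof -
      have "(-1) powi (- int n - int k) = ((-1) ^ (n + k) :: complex)"
        using neg_one_powi_minus[of "n + k"] by simp
      thus ?thesis using h_coeff_sym[of k n] by simp
    qed
    moreover have "h_coeff k (n + s) * of_nat ((n + s) choose n) =
        h_coeff k n * ((of_int (- int n - int k) gchoose s) * (-1) ^ s)"
      using h_coeff_binomial[of k n s] assms(1) by (simp add: 1 add.commute)
    ultimately have "of_nat ((s + n) choose n) * h_coeff (s + n) k =
        (-1) ^ (s + n + k) * (-1) ^ (n + k) * (-1) ^ s * (h_coeff n k * (of_int (- int n - int k) gchoose s))"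
      by (simp add: add.commute mult_ac)
    also have "(-1) ^ (s + n + k) * (-1) ^ (n + k) * (-1) ^ s = (1 :: complex)"
      by (simp add: power_add mult_ac flip: power_mult_distrib)
    finally show ?thesis by simp
  qed
  have "(cst.binser 1 (- int n - int k) * G) $$ t =
      (\<Sum>s<S. cst.binser 1 (- int n - int k) $$ int s * G $$ (t - int s))"
    by (rule fls_times_nth_nat) (use assms in \<open>auto simp: cst.binser_nth_neg\<close>)
  hence "(cst2 (h_coeff n k) * (cst.binser 1 (- int n - int k) * G)) $$ t =
      (\<Sum>s<S. cst1 (h_coeff n k) * (cst.binser 1 (- int n - int k) $$ int s * G $$ (t - int s)))"
    by (simp add: sum_distrib_left)
  also have "\<dots> = (\<Sum>s<S. cst1 (of_nat ((s + n) choose n) * h_coeff (s + n) k) *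
      fls_Xp (- int (s + n) - int k) * G $$ (t - int s))"
  proof (rule sum.cong)
    fix s
    have "- int n - int k - int s = - int (s + n) - int k" by simp
    thus "cst1 (h_coeff n k) * (cst.binser 1 (- int n - int k) $$ int s * G $$ (t - int s)) =
        cst1 (of_nat ((s + n) choose n) * h_coeff (s + n) k) *
        fls_Xp (- int (s + n) - int k) * G $$ (t - int s)"
      by (simp only: cst.binser_nth_nat num [symmetric] power_one mult_1_right mult.assoc [symmetric]
          fls_const_mult_const cst.emb_mult [symmetric])
  qed simp
  finally show ?thesis .
qed

text \<open>Taylor's formula for h_n^-(y + z), whose divided derivatives are multiples of the series
  h_(i+n)^-. The binomial identity behind it follows by multiplying both sides with n! i!
  j!.\<close>

lemma fls_sub_h_series_nth:
  assumes "n \<ge> 1"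
  shows "cst.fls_sub (h_series n) $$ int i = cst1 (of_nat ((i + n) choose n)) * h_series (i + n)"
proof (rule fls_eqI)
  fix l
  consider "l \<ge> 0" | "l < 0" "l + int i \<ge> 0" | "l + int i < 0" by linarith
  thus "cst.fls_sub (h_series n) $$ int i $$ l = (cst1 (of_nat ((i + n) choose n)) * h_series (i + n)) $$ l"
  proof cases
    case 1
    then obtain j where j: "l = int j" by (metis nonneg_int_cases)
    have "(of_int (int j + int i) gchoose i) = (of_nat ((j + i) choose i) :: complex)"
      by (simp add: binomial_gbinomial)
    moreover have "((j + i) choose i) * ((j + i + n) choose n) = ((i + n) choose n) * ((j + (i + n)) choose (i + n))"
    proof -
      have "((j + i) choose i) * ((j + i + n) choose n) * (fact n * fact i * fact j) = (fact (j + i + n) :: nat)"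
      proof -
        have "((j + i) choose i) * ((j + i + n) choose n) * (fact n * fact i * fact j) =
            fact n * (fact i * fact j * ((j + i) choose i)) * ((j + i + n) choose n)"
          by (simp only: mult_ac)
        also have "fact i * fact j * ((j + i) choose i) = fact (j + i)"
          using binomial_fact_lemma[of i "j + i"] by simp
        also have "fact n * fact (j + i) * ((j + i + n) choose n) = fact (j + i + n)"
          using binomial_fact_lemma[of n "j + i + n"] by simp
        finally show ?thesis .
      qed
      moreover have "((i + n) choose n) * ((j + (i + n)) choose (i + n)) * (fact n * fact i * fact j) = (fact (j + i + n) :: nat)"
      proof -
        have "((i + n) choose n) * ((j + (i + n)) choose (i + n)) * (fact n * fact i * fact j) =
            fact n * fact i * ((i + n) choose n) * fact j * ((j + (i + n)) choose (i + n))"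
          by (simp only: mult_ac)
        also have "fact n * fact i * ((i + n) choose n) = fact (i + n)"
          using binomial_fact_lemma[of n "i + n"] by simp
        also have "fact (i + n) * fact j * ((j + (i + n)) choose (i + n)) = fact (j + (i + n))"
          using binomial_fact_lemma[of "i + n" "j + (i + n)"] by simp
        finally show ?thesis by (simp add: add.assoc)
      qed
      ultimately show ?thesis by (metis fact_nonzero mult_eq_0_iff mult_right_cancel)
    qed
    hence "(of_nat ((j + i) choose i) * of_nat ((j + i + n) choose n) :: complex) =
        of_nat ((i + n) choose n) * of_nat ((j + (i + n)) choose (i + n))"
      by (simp only: of_nat_mult [symmetric])
    ultimately show ?thesis
      by (simp add: j cst.fls_sub_nth h_series_nth nat_add_distrib mult.assoc [symmetric] add.assoc flip: cst.emb_mult)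
  next
    case 2
    then obtain j where j: "l + int i = int j" by (metis nonneg_int_cases)
    hence "j < i" using 2 by simp
    hence "(of_int (l + int i) gchoose i) = (0 :: complex)"
      unfolding j by (simp flip: binomial_gbinomial)
    thus ?thesis using 2 by (simp add: cst.fls_sub_nth h_series_nth)
  next
    case 3
    thus ?thesis by (simp add: cst.fls_sub_nth h_series_nth)
  qed
qed

text \<open>The part h_n^+(x) has to pass Y(v,y) before it reaches w. For every j the commutators
  with d/dxi_k, summed over k, reassemble into (x - y)^(-n-j) expanded in powers of y.\<close>

lemma Y_comp_xi_left:
  assumes n: "n \<ge> 1" and u: "u \<in> Xi" and v: "v \<in> Xi" and w: "w \<in> Xi"
    and Kv: "\<And>k. k \<ge> Kv \<Longrightarrow> partial_xi k v = 0" and Kw: "\<And>k. k \<ge> Kw \<Longrightarrow> partial_xi k w = 0"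
  shows "Y_comp (xi n * u) v w = fls_const (h_series n) * Y_comp u v w
    + (\<Sum>j<Kv. cst2 (h_coeff n j) * (cst.binser (-1) (- int n - int j) * Y_comp u (partial_xi j v) w))
    + (\<Sum>k<Kw. cst2 (h_coeff n k) * (fls_const (fls_Xp (- int n - int k)) * Y_comp u v (partial_xi k w)))"
proof (rule fls_eqI)
  fix t
  let ?e = "\<lambda>k. h_term n k :: amb fls"
  let ?G = "\<lambda>j. Y_comp u (partial_xi j v) w"
  define p where "p = Y_series v w $$ t"
  have p: "p \<in> Xi" using v w by (simp add: p_def Y_series_nth_in_Xi)
  obtain K0 where K0: "\<forall>k\<ge>K0. partial_xi k p = 0" using partial_xi_eventually_0[OF p] by blast
  obtain N where N: "\<forall>j\<in>{..<Kv}. \<forall>i<N. ?G j $$ i = 0"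
    using fls_common_lower_bound[of "{..<Kv}" ?G] by auto
  \<comment> \<open>Beyond \<open>K\<close> the derivatives of p and of w vanish, and for every j <
    Kv the exponent t - (k - j) falls below the common lower bound N.\<close>
  define K where "K = max (max K0 Kw) (Kv + nat (t - N + 1))"
  have partial: "partial_xi k p = Y_series v (partial_xi k w) $$ t +
      (\<Sum>j<Kv. cst (of_nat (k choose j)) * Y_series (partial_xi j v) w $$ (t - (int k - int j)))" for k
  proof -
    \<comment> \<open>The range of j becomes independent of k: binomials vanish for j > k,
      derivatives of v for j >= Kv.\<close>
    have "(\<Sum>j\<le>k. cst (of_nat (k choose j)) * Y_series (partial_xi j v) w $$ (t - (int k - int j))) =
        (\<Sum>j\<in>{..k} \<union> {..<Kv}. cst (of_nat (k choose j)) * Y_series (partial_xi j v) w $$ (t - (int k - int j)))"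
      by (rule sum.mono_neutral_left) (auto simp: binomial_eq_0)
    also have "\<dots> = (\<Sum>j<Kv. cst (of_nat (k choose j)) * Y_series (partial_xi j v) w $$ (t - (int k - int j)))"
      by (rule sum.mono_neutral_right) (use Kv w in \<open>auto simp: binomial_eq_0 not_le\<close>)
    finally show ?thesis
      using arg_cong[OF fls_partial_Y_series[OF v w, of k], of "\<lambda>F. F $$ t"]
      by (simp add: p_def fls_sum_nth mult.assoc)
  qed
  have Yp: "Y_series u (partial_xi k p) = Y_comp u v (partial_xi k w) $$ t +
      (\<Sum>j<Kv. cst1 (of_nat (k choose j)) * ?G j $$ (t - (int k - int j)))" for k
    unfolding partial using u v w
    by (simp add: Y_comp_nth Y_series_add_right Y_series_sum_right Y_series_cst_right Y_series_nth_in_Xi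
        partial_xi_in_Xi Xi_sum Xi_cst_mult)
  have "Y_comp (xi n * u) v w $$ t = h_series n * Y_series u p + (\<Sum>k<K. ?e k * Y_series u (partial_xi k p))"
    using n u p K0 Y_series_xi[of n u p K] by (simp add: Y_comp_nth Xi_xi_mult p_def K_def)
  also have "(\<Sum>k<K. ?e k * Y_series u (partial_xi k p)) = (\<Sum>k<K. ?e k * Y_comp u v (partial_xi k w) $$ t) +
      (\<Sum>j<Kv. \<Sum>k<K. cst1 (h_coeff n k * of_nat (k choose j)) * fls_Xp (- int n - int k) * ?G j $$ (t - (int k - int j)))"
    unfolding Yp distrib_left sum.distrib sum_distrib_left
    by (subst sum.swap) (simp add: cst.emb_mult mult_ac flip: fls_const_mult_const)
  also have "(\<Sum>k<K. ?e k * Y_comp u v (partial_xi k w) $$ t) = (\<Sum>k<Kw. ?e k * Y_comp u v (partial_xi k w) $$ t)"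
    by (rule sum.mono_neutral_right) (use Kw u v in \<open>auto simp: K_def Y_comp_nth\<close>)
  also have "(\<Sum>j<Kv. \<Sum>k<K. cst1 (h_coeff n k * of_nat (k choose j)) * fls_Xp (- int n - int k) * ?G j $$ (t - (int k - int j))) =
      (\<Sum>j<Kv. (cst2 (h_coeff n j) * cst.binser (-1) (- int n - int j) * ?G j) $$ t)"
  proof (intro sum.cong refl h_coeff_binser_minus' [symmetric])
    fix j s assume "j \<in> {..<Kv}" "K \<le> j + s"
    thus "?G j $$ (t - int s) = 0" using N by (auto simp: K_def)
  qed (use n in auto)
  finally show "Y_comp (xi n * u) v w $$ t = (fls_const (h_series n) * Y_comp u v w
    + (\<Sum>j<Kv. cst2 (h_coeff n j) * (cst.binser (-1) (- int n - int j) * Y_comp u (partial_xi j v) w))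
    + (\<Sum>k<Kw. cst2 (h_coeff n k) * (fls_const (fls_Xp (- int n - int k)) * Y_comp u v (partial_xi k w)))) $$ t"
    using u by (simp add: fls_sum_nth Y_comp_nth p_def mult.assoc add_ac)
qed

text \<open>Here it is h_n^-(x) that has to pass Y(v,y) to the left. The commutators come from
  \<open>Y_series_xi_right\<close> and sum to the same function (x - y)^(-n-j), now expanded in
  powers of x.\<close>

lemma Y_comp_xi_middle:
  assumes n: "n \<ge> 1" and u: "u \<in> Xi" and v: "v \<in> Xi" and w: "w \<in> Xi"
    and Kv: "\<And>k. k \<ge> Kv \<Longrightarrow> partial_xi k v = 0" and Kw: "\<And>k. k \<ge> Kw \<Longrightarrow> partial_xi k w = 0"
  shows "Y_comp v (xi n * u) w = fls_outer (h_series n) * Y_comp v u w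
    + (\<Sum>j<Kv. cst2 (h_coeff n j) *
        (cst.sgn_pow (- int n - int j) * cst.binser (-1) (- int n - int j) * Y_comp (partial_xi j v) u w))
    + (\<Sum>k<Kw. cst2 (h_coeff n k) * (fls_outer (fls_Xp (- int n - int k)) * Y_comp v u (partial_xi k w)))"
proof (rule fls_eqI)
  fix t
  let ?p = "\<lambda>i. Y_series u w $$ i"
  let ?d = "\<lambda>j k. h_term j k :: amb fls"
  have p: "?p i \<in> Xi" for i using u w by (rule Y_series_nth_in_Xi)
  obtain N where N: "\<forall>i<N. ?p i = 0" by (rule fls_nth_vanishes_belowE)
  define S where "S = nat (t - N + 1)"
  have S: "?p (t - int s) = 0" if "s \<ge> S" for s using that N by (simp add: S_def)
  have hp: "(h_series n * Y_series u w) $$ t = (\<Sum>s<S. h_series n $$ int s * ?p (t - int s))"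
    by (rule fls_times_nth_nat) (use S in \<open>auto simp: h_series_nth\<close>)
  have hcomp: "(fls_outer (h_series n) * Y_comp v u w) $$ t =
      (\<Sum>s<S. fls_const (h_series n $$ int s) * Y_series v (?p (t - int s)))"
    using fls_times_nth_nat[of "fls_outer (h_series n)" S "Y_comp v u w" t] S v
    by (simp add: h_series_nth Y_comp_nth)
  have coeff: "Y_series v (h_series n $$ int s * ?p (t - int s)) =
      fls_const (h_series n $$ int s) * Y_series v (?p (t - int s)) +
      (\<Sum>j<Kv. cst1 (h_coeff j (s + n) * of_nat ((s + n) choose n)) * fls_Xp (- int j - int (s + n))
        * Y_comp (partial_xi j v) u w $$ (t - int s))" for s
  proof -
    let ?b = "cst (of_nat ((s + n) choose n))"
    have "Y_series v (?b * (xi (s + n) * ?p (t - int s))) = fls_const ?b * (fls_const (xi (s + n)) * Y_series v (?p (t - int s))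
      + (\<Sum>j<Kv. ?d j (s + n) * Y_series (partial_xi j v) (?p (t - int s))))"
    proof -
      have "Y_series v (xi (s + n) * ?p (t - int s)) = fls_const (xi (s + n)) * Y_series v (?p (t - int s))
          + (\<Sum>j<Kv. ?d j (s + n) * Y_series (partial_xi j v) (?p (t - int s)))"
        by (rule Y_series_xi_right) (use n v p Kv in auto)
      moreover have "xi (s + n) * ?p (t - int s) \<in> Xi" using n p by (intro Xi_xi_mult) auto
      ultimately show ?thesis using v by (simp only: Y_series_cst_right)
    qed
    thus ?thesis using v
      by (simp add: h_series_nth mult.assoc distrib_left sum_distrib_left Y_comp_nth partial_xi_in_Xi cst.emb_mult
          flip: fls_const_mult_const) (simp add: mult_ac)
  qed
  have R1: "Y_series (xi n * u) w = h_series n * Y_series u w +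
      (\<Sum>k<Kw. h_term n k * Y_series u (partial_xi k w))"
    by (rule Y_series_xi[OF n u w Kw])
  have "Y_series (xi n * u) w $$ t = (\<Sum>s<S. h_series n $$ int s * ?p (t - int s)) +
      (\<Sum>k<Kw. cst (h_coeff n k) * Y_series u (partial_xi k w) $$ (t + int n + int k))"
    using arg_cong[OF R1, of "\<lambda>F. F $$ t"] hp
    by (simp add: fls_sum_nth mult.assoc algebra_simps)
  hence "Y_comp v (xi n * u) w $$ t = Y_series v (\<Sum>s<S. h_series n $$ int s * ?p (t - int s)) +
      Y_series v (\<Sum>k<Kw. cst (h_coeff n k) * Y_series u (partial_xi k w) $$ (t + int n + int k))"
    using n u v w p
    by (simp add: Y_comp_nth) (intro Y_series_add_right Xi_sum Xi_mult Xi_series_nth[OF Xi_series_h_series];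
        simp add: Y_series_nth_in_Xi partial_xi_in_Xi)
  also have "Y_series v (\<Sum>s<S. h_series n $$ int s * ?p (t - int s)) =
      (\<Sum>s<S. Y_series v (h_series n $$ int s * ?p (t - int s)))"
    using n v p by (intro Y_series_sum_right Xi_mult Xi_series_nth[OF Xi_series_h_series]) auto
  also have "\<dots> = (fls_outer (h_series n) * Y_comp v u w) $$ t +
      (\<Sum>j<Kv. \<Sum>s<S. cst1 (h_coeff j (s + n) * of_nat ((s + n) choose n)) * fls_Xp (- int j - int (s + n))
        * Y_comp (partial_xi j v) u w $$ (t - int s))"
    unfolding coeff hcomp sum.distrib by (subst sum.swap) (rule refl)
  also have "(\<Sum>j<Kv. \<Sum>s<S. cst1 (h_coeff j (s + n) * of_nat ((s + n) choose n)) * fls_Xp (- int j - int (s + n))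
        * Y_comp (partial_xi j v) u w $$ (t - int s)) =
      (\<Sum>j<Kv. (cst2 (h_coeff n j) *
        (cst.sgn_pow (- int n - int j) * cst.binser (-1) (- int n - int j) * Y_comp (partial_xi j v) u w)) $$ t)"
    using n v S by (intro sum.cong refl h_coeff_binser_minus_sym [symmetric]) (auto simp: Y_comp_nth partial_xi_in_Xi)
  also have "Y_series v (\<Sum>k<Kw. cst (h_coeff n k) * Y_series u (partial_xi k w) $$ (t + int n + int k)) =
      (\<Sum>k<Kw. (cst2 (h_coeff n k) * (fls_outer (fls_Xp (- int n - int k)) * Y_comp v u (partial_xi k w))) $$ t)"
  proof -
    have idx: "t + int n + int k = t - (- int n - int k)" for k by simp
    show ?thesis using u v w unfolding idx
      by (simp add: Y_series_sum_right Y_series_cst_right Y_comp_nth Xi_cst_mult Y_series_nth_in_Xi partial_xi_in_Xi)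
  qed
  finally show "Y_comp v (xi n * u) w $$ t = (fls_outer (h_series n) * Y_comp v u w
    + (\<Sum>j<Kv. cst2 (h_coeff n j) *
        (cst.sgn_pow (- int n - int j) * cst.binser (-1) (- int n - int j) * Y_comp (partial_xi j v) u w))
    + (\<Sum>k<Kw. cst2 (h_coeff n k) * (fls_outer (fls_Xp (- int n - int k)) * Y_comp v u (partial_xi k w)))) $$ t"
    by (simp only: fls_plus_nth fls_sum_nth)
qed

text \<open>The contraction of xi_n with v takes place inside and gives z^(-n-j). The coefficients
  xi_(s+n) of h_n^-(z) become h_(s+n)(y) under the outer vertex operator, and Taylor's formula
  collects these into h_n(y + z).\<close>

lemma Y_iter_xi_left:
  assumes n: "n \<ge> 1" and u: "u \<in> Xi" and v: "v \<in> Xi" and w: "w \<in> Xi"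
    and Kv: "\<And>k. k \<ge> Kv \<Longrightarrow> partial_xi k v = 0" and Kw: "\<And>k. k \<ge> Kw \<Longrightarrow> partial_xi k w = 0"
  shows "Y_iter (xi n * u) v w = cst.fls_sub (h_series n) * Y_iter u v w
    + (\<Sum>j<Kv. cst2 (h_coeff n j) * (fls_Xp (- int n - int j) * Y_iter u (partial_xi j v) w))
    + (\<Sum>k<Kw. cst2 (h_coeff n k) * (cst.fls_sub (fls_Xp (- int n - int k)) * Y_iter u v (partial_xi k w)))"
proof (rule fls_eqI)
  fix t
  let ?p = "\<lambda>i. Y_series u v $$ i"
  have p: "?p i \<in> Xi" for i using u v by (rule Y_series_nth_in_Xi)
  obtain N where N: "\<forall>i<N. ?p i = 0" by (rule fls_nth_vanishes_belowE)
  define S where "S = nat (t - N + 1)"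
  have S: "?p (t - int s) = 0" if "s \<ge> S" for s using that N by (simp add: S_def)
  have hp: "(h_series n * Y_series u v) $$ t = (\<Sum>s<S. h_series n $$ int s * ?p (t - int s))"
    by (rule fls_times_nth_nat) (use S in \<open>auto simp: h_series_nth\<close>)
  have hiter: "(cst.fls_sub (h_series n) * Y_iter u v w) $$ t =
      (\<Sum>s<S. cst1 (of_nat ((s + n) choose n)) * h_series (s + n) * Y_series (?p (t - int s)) w)"
    using fls_times_nth_nat[of "cst.fls_sub (h_series n)" S "Y_iter u v w" t] S w n
    by (simp add: cst.fls_sub_nth_neg Y_iter_nth fls_sub_h_series_nth)
  have coeff: "Y_series (h_series n $$ int s * ?p (t - int s)) w =
      cst1 (of_nat ((s + n) choose n)) * h_series (s + n) * Y_series (?p (t - int s)) w +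
      (\<Sum>k<Kw. cst1 (of_nat ((s + n) choose n) * h_coeff (s + n) k) * fls_Xp (- int (s + n) - int k)
        * Y_iter u v (partial_xi k w) $$ (t - int s))" for s
  proof -
    let ?b = "cst (of_nat ((s + n) choose n))"
    have "Y_series (?b * (xi (s + n) * ?p (t - int s))) w = fls_const ?b * (h_series (s + n) * Y_series (?p (t - int s)) w
      + (\<Sum>k<Kw. cst1 (h_coeff (s + n) k) * fls_Xp (- int (s + n) - int k) * Y_series (?p (t - int s)) (partial_xi k w)))"
    proof -
      have "Y_series (xi (s + n) * ?p (t - int s)) w = h_series (s + n) * Y_series (?p (t - int s)) w
          + (\<Sum>k<Kw. cst1 (h_coeff (s + n) k) * fls_Xp (- int (s + n) - int k) * Y_series (?p (t - int s)) (partial_xi k w))"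
        by (rule Y_series_xi) (use n w p Kw in auto)
      moreover have "xi (s + n) * ?p (t - int s) \<in> Xi" using n p by (intro Xi_xi_mult) auto
      ultimately show ?thesis using w by (simp only: Y_series_cst_left)
    qed
    thus ?thesis using w
      by (simp add: h_series_nth mult.assoc distrib_left sum_distrib_left Y_iter_nth partial_xi_in_Xi cst.emb_mult
          flip: fls_const_mult_const)
  qed
  have R1: "Y_series (xi n * u) v = h_series n * Y_series u v +
      (\<Sum>k<Kv. h_term n k * Y_series u (partial_xi k v))"
    by (rule Y_series_xi[OF n u v Kv])
  have "Y_series (xi n * u) v $$ t = (\<Sum>s<S. h_series n $$ int s * ?p (t - int s)) +
      (\<Sum>k<Kv. cst (h_coeff n k) * Y_series u (partial_xi k v) $$ (t + int n + int k))"
    using arg_cong[OF R1, of "\<lambda>F. F $$ t"] hp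
    by (simp add: fls_sum_nth mult.assoc algebra_simps)
  hence "Y_iter (xi n * u) v w $$ t = Y_series (\<Sum>s<S. h_series n $$ int s * ?p (t - int s)) w +
      Y_series (\<Sum>k<Kv. cst (h_coeff n k) * Y_series u (partial_xi k v) $$ (t + int n + int k)) w"
    using n u v w p
    by (simp add: Y_iter_nth) (intro Y_series_add_left Xi_sum Xi_mult Xi_series_nth[OF Xi_series_h_series];
        simp add: Y_series_nth_in_Xi partial_xi_in_Xi)
  also have "Y_series (\<Sum>s<S. h_series n $$ int s * ?p (t - int s)) w =
      (\<Sum>s<S. Y_series (h_series n $$ int s * ?p (t - int s)) w)"
    using n w p by (intro Y_series_sum_left Xi_mult Xi_series_nth[OF Xi_series_h_series]) auto
  also have "\<dots> = (cst.fls_sub (h_series n) * Y_iter u v w) $$ t +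
      (\<Sum>k<Kw. \<Sum>s<S. cst1 (of_nat ((s + n) choose n) * h_coeff (s + n) k) * fls_Xp (- int (s + n) - int k)
        * Y_iter u v (partial_xi k w) $$ (t - int s))"
    unfolding coeff hiter sum.distrib by (subst sum.swap) (rule refl)
  also have "(\<Sum>k<Kw. \<Sum>s<S. cst1 (of_nat ((s + n) choose n) * h_coeff (s + n) k) * fls_Xp (- int (s + n) - int k)
        * Y_iter u v (partial_xi k w) $$ (t - int s)) =
      (\<Sum>k<Kw. (cst2 (h_coeff n k) * (cst.fls_sub (fls_Xp (- int n - int k)) * Y_iter u v (partial_xi k w))) $$ t)"
    unfolding cst.fls_sub_Xp
    using n w S by (intro sum.cong refl h_coeff_binser_plus [symmetric]) (auto simp: Y_iter_nth partial_xi_in_Xi)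
  also have "Y_series (\<Sum>k<Kv. cst (h_coeff n k) * Y_series u (partial_xi k v) $$ (t + int n + int k)) w =
      (\<Sum>k<Kv. (cst2 (h_coeff n k) * (fls_Xp (- int n - int k) * Y_iter u (partial_xi k v) w)) $$ t)"
    using u v w
    by (subst Y_series_sum_left)
      (auto simp: Y_series_cst_left Y_iter_nth Xi_cst_mult Y_series_nth_in_Xi partial_xi_in_Xi algebra_simps)
  finally show "Y_iter (xi n * u) v w $$ t = (cst.fls_sub (h_series n) * Y_iter u v w
    + (\<Sum>j<Kv. cst2 (h_coeff n j) * (fls_Xp (- int n - int j) * Y_iter u (partial_xi j v) w))
    + (\<Sum>k<Kw. cst2 (h_coeff n k) * (cst.fls_sub (fls_Xp (- int n - int k)) * Y_iter u v (partial_xi k w)))) $$ t"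
    by (simp only: fls_plus_nth fls_sum_nth add_ac)
qed

text \<open>A factor xi_n in v has to be pulled out of Y(u,z)v from the right. With u an exponential
  this costs a single scalar multiple of z^(-n), which is why u is kept exponential until v is
  general.\<close>

lemma Y_iter_exp_xi:
  assumes n: "n \<ge> 1" and v: "v \<in> Xi" and w: "w \<in> Xi" and Kw: "\<And>k. k \<ge> Kw \<Longrightarrow> partial_xi k w = 0"
  shows "Y_iter (exp_xi0 m) (xi n * v) w = fls_const (h_series n) * Y_iter (exp_xi0 m) v w
    + cst2 (- (2 * of_int m / of_nat n)) * (fls_Xp (- int n) * Y_iter (exp_xi0 m) v w)
    + (\<Sum>k<Kw. cst2 (h_coeff n k) * (fls_const (fls_Xp (- int n - int k)) * Y_iter (exp_xi0 m) v (partial_xi k w)))"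
proof (rule fls_eqI)
  fix t
  let ?p = "\<lambda>i. Y_series (exp_xi0 m) v $$ i"
  have p: "?p i \<in> Xi" for i using v by (intro Y_series_nth_in_Xi exp_xi0_in_Xi)
  have "Y_series (exp_xi0 m) (xi n * v) $$ t = xi n * ?p t + cst (- (2 * of_int m / of_nat n)) * ?p (t + int n)"
    by (simp add: Y_series_exp_xi[OF n v] left_diff_distrib mult.assoc cst.emb_minus)
  hence "Y_iter (exp_xi0 m) (xi n * v) w $$ t = Y_series (xi n * ?p t) w
      + cst1 (- (2 * of_int m / of_nat n)) * Y_series (?p (t + int n)) w"
    using n p w by (simp add: Y_iter_nth Y_series_add_left Y_series_cst_left Xi_xi_mult Xi_cst_mult)
  also have "Y_series (xi n * ?p t) w = h_series n * Y_series (?p t) w +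
      (\<Sum>k<Kw. h_term n k * Y_series (?p t) (partial_xi k w))"
    by (rule Y_series_xi) (use n p w Kw in auto)
  finally show "Y_iter (exp_xi0 m) (xi n * v) w $$ t = (fls_const (h_series n) * Y_iter (exp_xi0 m) v w
    + cst2 (- (2 * of_int m / of_nat n)) * (fls_Xp (- int n) * Y_iter (exp_xi0 m) v w)
    + (\<Sum>k<Kw. cst2 (h_coeff n k) * (fls_const (fls_Xp (- int n - int k)) * Y_iter (exp_xi0 m) v (partial_xi k w)))) $$ t"
    using w by (simp add: fls_sum_nth Y_iter_nth partial_xi_in_Xi mult.assoc)
qed

lemma Y_comp_exp_exp_xi:
  assumes k: "k \<ge> 1" and w: "w \<in> Xi"
  shows "Y_comp (exp_xi0 m) (exp_xi0 q) (xi k * w) = fls_const (fls_const (xi k)) * Y_comp (exp_xi0 m) (exp_xi0 q) w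
    + cst2 (- (2 * of_int m / of_nat k)) * (fls_const (fls_Xp (- int k)) * Y_comp (exp_xi0 m) (exp_xi0 q) w)
    + cst2 (- (2 * of_int q / of_nat k)) * (fls_outer (fls_Xp (- int k)) * Y_comp (exp_xi0 m) (exp_xi0 q) w)"
proof (rule fls_eqI)
  fix t
  let ?p = "\<lambda>i. Y_series (exp_xi0 q) w $$ i"
  have p: "?p i \<in> Xi" for i using w by (intro Y_series_nth_in_Xi exp_xi0_in_Xi)
  have "Y_series (exp_xi0 q) (xi k * w) $$ t = xi k * ?p t + cst (- (2 * of_int q / of_nat k)) * ?p (t + int k)"
    by (simp add: Y_series_exp_xi[OF k w] left_diff_distrib mult.assoc cst.emb_minus)
  hence "Y_comp (exp_xi0 m) (exp_xi0 q) (xi k * w) $$ t = Y_series (exp_xi0 m) (xi k * ?p t)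
      + cst1 (- (2 * of_int q / of_nat k)) * Y_series (exp_xi0 m) (?p (t + int k))"
    using k p by (simp add: Y_comp_nth exp_xi0_in_Xi Y_series_add_right Y_series_cst_right Xi_xi_mult Xi_cst_mult)
  also have "Y_series (exp_xi0 m) (xi k * ?p t) = fls_const (xi k) * Y_series (exp_xi0 m) (?p t)
      + cst1 (- (2 * of_int m / of_nat k)) * (fls_Xp (- int k) * Y_series (exp_xi0 m) (?p t))"
    by (simp add: Y_series_exp_xi[OF k p] left_diff_distrib mult.assoc cst.emb_minus)
  finally show "Y_comp (exp_xi0 m) (exp_xi0 q) (xi k * w) $$ t = (fls_const (fls_const (xi k)) * Y_comp (exp_xi0 m) (exp_xi0 q) w
    + cst2 (- (2 * of_int m / of_nat k)) * (fls_const (fls_Xp (- int k)) * Y_comp (exp_xi0 m) (exp_xi0 q) w)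
    + cst2 (- (2 * of_int q / of_nat k)) * (fls_outer (fls_Xp (- int k)) * Y_comp (exp_xi0 m) (exp_xi0 q) w)) $$ t"
    by (simp add: Y_comp_nth exp_xi0_in_Xi)
qed

text \<open>The factor xi_k is contracted with both exponentials, located at y + z and at y. The
  power of y + z appears as a sum over the derivatives d/dxi_j of Y(e^(m xi_0),z) e^(q
  xi_0).\<close>

lemma Y_iter_exp_exp_xi:
  assumes k: "k \<ge> 1" and w: "w \<in> Xi"
  shows "Y_iter (exp_xi0 m) (exp_xi0 q) (xi k * w) = fls_const (fls_const (xi k)) * Y_iter (exp_xi0 m) (exp_xi0 q) w
    + cst2 (- (2 * of_int m / of_nat k)) * (cst.fls_sub (fls_Xp (- int k)) * Y_iter (exp_xi0 m) (exp_xi0 q) w)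
    + cst2 (- (2 * of_int q / of_nat k)) * (fls_const (fls_Xp (- int k)) * Y_iter (exp_xi0 m) (exp_xi0 q) w)"
proof (rule fls_eqI)
  fix t
  let ?C = "Y_iter (exp_xi0 m) (exp_xi0 q) w"
  let ?p = "\<lambda>i. Y_series (exp_xi0 m) (exp_xi0 q) $$ i"
  let ?c = "\<lambda>j. h_term j k :: amb fls"
  have p: "?p i \<in> Xi" for i by (intro Y_series_nth_in_Xi exp_xi0_in_Xi)
  obtain N where N: "\<forall>i<N. ?p i = 0" by (rule fls_nth_vanishes_belowE)
  obtain K0 where K0: "\<forall>j\<ge>K0. partial_xi j (?p t) = 0" using partial_xi_eventually_0[OF p] by blast
  define K where "K = max (max 1 K0) (nat (t - N + 1))"
  have K: "?p (t - int j) = 0" if "j \<ge> K" for j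
  proof -
    have "t - int j < N" using that by (simp add: K_def nat_le_iff)
    thus ?thesis using N by blast
  qed
  \<comment> \<open>The second vector contributes q at j = 0 only; the vertex operator of e^(m xi_0)
    contributes m z^j for every j.\<close>
  have partial: "Y_series (partial_xi j (?p t)) w =
      (if j = 0 then cst1 (of_int q) * ?C $$ t else 0) + cst1 (of_int m) * ?C $$ (t - int j)" for j
  proof -
    have "partial_xi j (?p t) = Y_series (exp_xi0 m) (partial_xi j (exp_xi0 q)) $$ t + cst (of_int m) * ?p (t - int j)"
      using arg_cong[OF fls_partial_Y_series_exp[OF exp_xi0_in_Xi, of j m q], of "\<lambda>F. F $$ t"]
      by (simp add: mult.assoc)
    also have "Y_series (exp_xi0 m) (partial_xi j (exp_xi0 q)) $$ t = (if j = 0 then cst (of_int q) * ?p t else 0)"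
      by (simp add: partial_xi_exp Y_series_cst_right exp_xi0_in_Xi)
    finally show ?thesis using p w
      by (simp add: Y_series_add_left Y_series_cst_left Xi_cst_mult Y_iter_nth)
  qed
  have "Y_series (?p t) (xi k * w) = fls_const (xi k) * Y_series (?p t) w +
      (\<Sum>j<K. ?c j * Y_series (partial_xi j (?p t)) w)"
    by (rule Y_series_xi_right[OF k p w]) (use K0 in \<open>auto simp: K_def\<close>)
  hence "Y_iter (exp_xi0 m) (exp_xi0 q) (xi k * w) $$ t = fls_const (xi k) * ?C $$ t +
      (\<Sum>j<K. ?c j * Y_series (partial_xi j (?p t)) w)"
    using k w by (simp add: Y_iter_nth Xi_xi_mult)
  also have "(\<Sum>j<K. ?c j * Y_series (partial_xi j (?p t)) w) =
      (\<Sum>j<K. ?c j * (if j = 0 then cst1 (of_int q) * ?C $$ t else 0)) +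
      (\<Sum>j<K. ?c j * (cst1 (of_int m) * ?C $$ (t - int j)))"
    unfolding partial distrib_left sum.distrib ..
  also have "(\<Sum>j<K. ?c j * (if j = 0 then cst1 (of_int q) * ?C $$ t else 0)) =
      (cst2 (- (2 * of_int q / of_nat k)) * (fls_const (fls_Xp (- int k)) * ?C)) $$ t"
  proof -
    have "(\<Sum>j<K. ?c j * (if j = 0 then cst1 (of_int q) * ?C $$ t else 0)) =
        (\<Sum>j\<in>{0}. ?c j * (if j = 0 then cst1 (of_int q) * ?C $$ t else 0))"
      by (rule sum.mono_neutral_right) (auto simp: K_def)
    also have "\<dots> = (cst1 (h_coeff 0 k) * cst1 (of_int q)) * (fls_Xp (- int k) * ?C $$ t)"
      by simp (simp only: mult_ac fls_const_mult_const [symmetric])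
    also have "cst1 (h_coeff 0 k) * cst1 (of_int q) = cst1 (- (2 * of_int q / of_nat k))"
      using k by (simp add: h_coeff_0 flip: cst.emb_mult)
    finally show ?thesis by simp
  qed
  also have "(\<Sum>j<K. ?c j * (cst1 (of_int m) * ?C $$ (t - int j))) =
      (cst2 (- (2 * of_int m / of_nat k)) * (cst.fls_sub (fls_Xp (- int k)) * ?C)) $$ t"
  proof -
    have "(cst2 (h_coeff 0 k) * (cst.binser 1 (- int 0 - int k) * ?C)) $$ t =
      (\<Sum>s<K. cst1 (of_nat ((s + 0) choose 0) * h_coeff (s + 0) k) * fls_Xp (- int (s + 0) - int k) * ?C $$ (t - int s))"
      by (rule h_coeff_binser_plus) (use k K w in \<open>auto simp: Y_iter_nth\<close>)
    hence "(\<Sum>s<K. ?c s * ?C $$ (t - int s)) = (cst2 (h_coeff 0 k) * (cst.fls_sub (fls_Xp (- int k)) * ?C)) $$ t"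
      by (simp add: cst.fls_sub_Xp)
    moreover have "(\<Sum>j<K. ?c j * (cst1 (of_int m) * ?C $$ (t - int j))) =
        cst1 (of_int m) * (\<Sum>s<K. ?c s * ?C $$ (t - int s))"
      unfolding sum_distrib_left by (simp only: mult.left_commute)
    moreover have "cst1 (of_int m) * (cst1 (h_coeff 0 k) * X) =
        cst1 (- (2 * of_int m / of_nat k)) * X" for X
    proof -
      have "of_int m * h_coeff 0 k = - (2 * of_int m / of_nat k)" using k by (simp add: h_coeff_0)
      thus ?thesis by (simp only: mult.assoc [symmetric] fls_const_mult_const cst.emb_mult [symmetric])
    qed
    ultimately show ?thesis by simp
  qed
  finally show "Y_iter (exp_xi0 m) (exp_xi0 q) (xi k * w) $$ t = (fls_const (fls_const (xi k)) * ?C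
    + cst2 (- (2 * of_int m / of_nat k)) * (cst.fls_sub (fls_Xp (- int k)) * ?C)
    + cst2 (- (2 * of_int q / of_nat k)) * (fls_const (fls_Xp (- int k)) * ?C)) $$ t"
    by (simp add: add_ac)
qed

section \<open>Products and iterates of exponentials\<close>

lemma exp_h_series_add: "exp_h_series (m + q) = exp_h_series m * exp_h_series q"
proof (rule fls_ode_unique_amb)
  let ?f = "cst1 (of_int (m + q)) * h_series 1"
  show "fls_deriv (exp_h_series (m + q)) = ?f * exp_h_series (m + q) + 0"
    by (simp add: fls_deriv_exp_h_series)
  have "?f = cst1 (of_int m) * h_series 1 + cst1 (of_int q) * h_series 1"
    by (simp add: cst.emb_add distrib_right flip: fls_plus_const)
  thus "fls_deriv (exp_h_series m * exp_h_series q) = ?f * (exp_h_series m * exp_h_series q) + 0"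
    by (simp add: fls_deriv_exp_h_series distrib_right distrib_left mult_ac)
  show "exp_h_series (m + q) $$ 0 = (exp_h_series m * exp_h_series q) $$ 0"
    using fls_times_nth_atMost[of "exp_h_series m" "exp_h_series q" 0]
    by (simp add: exp_h_series_nth exp_xi0_add)
  show "(exp_h_series m * exp_h_series q) $$ i = 0" if "i < 0" for i
    by (rule fls_times_nth_eq_0[of 0 _ 0]) (use that in \<open>auto simp: exp_h_series_nth\<close>)
qed (auto simp: h_series_nth exp_h_series_nth)

lemma exp_h_series_nth_Suc:
  "cst (of_nat (Suc k)) * exp_h_series m $$ int (Suc k) =
    cst (of_int m) * (\<Sum>a\<le>k. cst (of_nat (Suc a)) * (xi (Suc a) * exp_h_series m $$ int (k - a)))"
proof -
  have "cst (of_nat (Suc k)) * (cst (of_int m / of_nat (Suc k)) * X) = cst (of_int m) * X" for X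
    by (simp add: mult.assoc [symmetric] flip: cst.emb_mult del: of_nat_Suc)
  thus ?thesis by (simp add: exp_h_series_nth mult.assoc nat_add_distrib del: of_nat_Suc of_nat_diff)
qed

lemma exp_h_series_nth_in_Xi: "exp_h_series m $$ i \<in> Xi"
  by (rule Xi_series_nth[OF Xi_series_exp_h_series])

lemma fls_of_nat_mult: "of_nat k * (F :: amb fls) = cst1 (of_nat k) * F"
  by (simp add: cst.emb_of_nat fls_of_nat)

lemma fls2_ode_coeffI:
  fixes F :: "amb fls fls"
  assumes "\<And>i. i < 0 \<Longrightarrow> F $$ i = 0" "\<And>i. i < 0 \<Longrightarrow> f $$ i = 0"
    "\<And>k. cst1 (of_nat (Suc k)) * F $$ int (Suc k) = (\<Sum>a\<le>k. f $$ int a * F $$ int (k - a))"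
  shows "fls_deriv F = f * F"
proof (rule fls_eqI)
  fix i :: int
  consider "i < -1" | "i = -1" | "i \<ge> 0" by linarith
  thus "fls_deriv F $$ i = (f * F) $$ i"
  proof cases
    case 3
    then obtain k where k: "i = int k" by (metis nonneg_int_cases)
    have "(f * F) $$ int k = (\<Sum>a\<le>k. f $$ int a * F $$ int (k - a))"
      by (rule fls_times_nth_atMost) (use assms in auto)
    also have "\<dots> = of_nat (Suc k) * F $$ int (Suc k)"
      by (simp only: fls_of_nat_mult assms(3))
    finally show ?thesis by (simp add: k add.commute)
  next
    case 1
    have "(f * F) $$ i = 0" by (rule fls_times_nth_eq_0[of 0 _ 0]) (use assms 1 in auto)
    thus ?thesis using 1 assms by simp
  next
    case 2
    have "(f * F) $$ i = 0" by (rule fls_times_nth_eq_0[of 0 _ 0]) (use assms 2 in auto)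
    thus ?thesis using 2 by simp
  qed
qed

lemma minus_one_gchoose: "(- 1 :: complex) gchoose a = (- 1) ^ a"
  using gbinomial_negated_upper[of "- 1 :: complex" a] by (simp flip: binomial_gbinomial)

text \<open>After removal of y^(2qr) both sides are power series in y with logarithmic derivative q
  (h^-)'(y) - 2mq (x - y)^(-1). At y = 0 both equal Y(e^(m xi_0),x) e^((q+r) xi_0).\<close>

lemma Y_comp_exp_exp_exp:
  "Y_comp (exp_xi0 m) (exp_xi0 q) (exp_xi0 r) = fls_const (fls_const (exp_xi0 r)) *
    (fls_const (fls_Xp (2 * m * r) * exp_h_series m) *
      (fls_outer (fls_Xp (2 * q * r) * exp_h_series q) * cst.binser (-1) (2 * m * q)))"
proof -
  let ?e = "fls_const (fls_const (exp_xi0 r)) :: amb fls fls"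
  define F :: "amb fls fls" where "F = Abs_fls (\<lambda>i. Y_series (exp_xi0 m) (exp_h_series q $$ i * exp_xi0 r))"
  have F: "F $$ i = Y_series (exp_xi0 m) (exp_h_series q $$ i * exp_xi0 r)" for i
    unfolding F_def by (rule nth_Abs_fls_lower_bound[of 0]) (simp add: exp_h_series_nth exp_xi0_in_Xi)
  define G where "G = ?e * (fls_const (fls_Xp (2 * m * r) * exp_h_series m) *
      (fls_outer (exp_h_series q) * cst.binser (-1) (2 * m * q)))"
  \<comment> \<open>The logarithmic derivative in y of e^(q h^-(y)) (x - y)^(2mq).\<close>
  define f where "f = cst2 (of_int q) * fls_outer (h_series 1) + cst2 (- (2 * of_int m * of_int q)) * cst.binser (-1) (-1)"
  have f_neg: "f $$ i = 0" if "i < 0" for i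
    using that by (simp add: f_def h_series_nth cst.binser_nth_neg)
  have f_nth: "f $$ int a = cst1 (of_int q) * (cst1 (of_nat (Suc a)) *
      (fls_const (xi (Suc a)) - cst1 (2 * of_int m / of_nat (Suc a)) * fls_Xp (- int (Suc a))))" for a
  proof -
    have "(- 1) ^ a * (- 1) ^ a = (1 :: complex)" by (simp flip: power_mult_distrib)
    hence b: "cst.binser (-1) (-1) $$ int a = fls_Xp (- int (Suc a))"
      by (simp add: cst.binser_nth_nat minus_one_gchoose)
    have num: "of_int q * of_nat (Suc a) * (2 * of_int m / of_nat (Suc a)) = (2 * of_int m * of_int q :: complex)"
      by (simp add: field_simps del: of_nat_Suc)
    have "cst1 (of_int q) * (cst1 (of_nat (Suc a)) * (cst1 (2 * of_int m / of_nat (Suc a)) * X))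
        = cst1 (2 * of_int m * of_int q) * X" for X
      by (simp only: mult.assoc [symmetric] fls_const_mult_const cst.emb_mult [symmetric] num)
    moreover have "h_series 1 $$ int a = cst (of_nat (Suc a)) * xi (Suc a)"
      by (simp add: h_series_nth)
    ultimately show ?thesis
      by (simp add: f_def b right_diff_distrib cst.emb_minus del: of_nat_Suc)
  qed
  have "F = G"
  proof (rule fls_ode_unique_amb2[OF f_neg])
    show F_neg: "F $$ i = 0" if "i < 0" for i using that by (simp add: F exp_h_series_nth exp_xi0_in_Xi)
    have neg: "(fls_outer (exp_h_series q) * cst.binser (-1) (2 * m * q)) $$ i = 0" if "i < 0" for i
      by (rule fls_times_nth_eq_0[of 0 _ 0]) (use that in \<open>auto simp: exp_h_series_nth cst.binser_nth_neg\<close>)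
    show "G $$ i = 0" if "i < 0" for i using that neg by (simp add: G_def)
    show "F $$ 0 = G $$ 0"
    proof -
      have "(fls_outer (exp_h_series q) * cst.binser (-1) (2 * m * q)) $$ int 0 =
          fls_const (exp_xi0 q) * fls_Xp (2 * m * q)"
        by (subst fls_times_nth_atMost) (auto simp: exp_h_series_nth cst.binser_nth_neg cst.binser_nth_nat[of _ _ 0, simplified])
      hence "G $$ 0 = fls_const (exp_xi0 r) * (fls_Xp (2 * m * r) * exp_h_series m * (fls_const (exp_xi0 q) * fls_Xp (2 * m * q)))"
        by (simp add: G_def)
      moreover have "F $$ 0 = fls_Xp (2 * m * (q + r)) * exp_h_series m * fls_const (exp_xi0 (q + r))"
        by (simp add: F exp_h_series_nth Y_series_exp_exp flip: exp_xi0_add)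
      moreover have "fls_Xp (2 * m * (q + r)) = (fls_Xp (2 * m * q) * fls_Xp (2 * m * r) :: amb fls)"
        by (simp add: distrib_left flip: fls_Xp_add)
      ultimately show ?thesis by (simp add: exp_xi0_add mult_ac flip: fls_const_mult_const)
    qed
    show "fls_deriv F = f * F"
    proof (rule fls2_ode_coeffI[OF F_neg f_neg])
      fix k
      have in_Xi: "exp_h_series q $$ i * exp_xi0 r \<in> Xi" for i
        by (intro Xi_mult exp_h_series_nth_in_Xi exp_xi0_in_Xi)
      have "cst1 (of_nat (Suc k)) * F $$ int (Suc k) =
          Y_series (exp_xi0 m) (cst (of_nat (Suc k)) * exp_h_series q $$ int (Suc k) * exp_xi0 r)"
        unfolding F mult.assoc by (rule Y_series_cst_right [symmetric, OF exp_xi0_in_Xi in_Xi])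
      also have "cst (of_nat (Suc k)) * exp_h_series q $$ int (Suc k) * exp_xi0 r = cst (of_int q) *
          (\<Sum>a\<le>k. cst (of_nat (Suc a)) * (xi (Suc a) * (exp_h_series q $$ int (k - a) * exp_xi0 r)))"
        unfolding exp_h_series_nth_Suc by (simp only: mult.assoc sum_distrib_right)
      also have "Y_series (exp_xi0 m) \<dots> = cst1 (of_int q) * (\<Sum>a\<le>k. cst1 (of_nat (Suc a)) *
          ((fls_const (xi (Suc a)) - cst1 (2 * of_int m / of_nat (Suc a)) * fls_Xp (- int (Suc a))) * F $$ int (k - a)))"
        using in_Xi
        by (simp add: Y_series_cst_right Y_series_sum_right exp_xi0_in_Xi Xi_sum Xi_cst_mult Xi_xi_mult
            Y_series_exp_xi F del: of_nat_Suc of_nat_diff)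
      also have "\<dots> = (\<Sum>a\<le>k. f $$ int a * F $$ int (k - a))"
        by (simp only: f_nth sum_distrib_left mult.assoc)
      finally show "cst1 (of_nat (Suc k)) * F $$ int (Suc k) = (\<Sum>a\<le>k. f $$ int a * F $$ int (k - a))" .
    qed
    show "fls_deriv G = f * G"
    proof -
      have o: "fls_deriv (fls_outer (exp_h_series q)) = cst2 (of_int q) * fls_outer (h_series 1) * fls_outer (exp_h_series q)"
        by (simp add: cst.fls_deriv_outer fls_deriv_exp_h_series fls_outer_mult)
      have b: "fls_deriv (cst.binser (-1) (2 * m * q)) = cst2 (- (2 * of_int m * of_int q)) * (cst.binser (-1) (-1) * cst.binser (-1) (2 * m * q))"
        by (simp add: cst.fls_deriv_binser flip: cst.binser_add)
      have "fls_deriv G = ?e * (fls_const (fls_Xp (2 * m * r) * exp_h_series m) *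
          fls_deriv (fls_outer (exp_h_series q) * cst.binser (-1) (2 * m * q)))"
        by (simp add: G_def)
      also have "fls_deriv (fls_outer (exp_h_series q) * cst.binser (-1) (2 * m * q)) =
          f * (fls_outer (exp_h_series q) * cst.binser (-1) (2 * m * q))"
        by (simp only: fls_deriv_mult o b f_def) (simp only: ring_distribs mult_ac add_ac)
      finally show ?thesis unfolding G_def by (simp only: mult.left_commute[of f])
    qed
  qed
  moreover have "Y_comp (exp_xi0 m) (exp_xi0 q) (exp_xi0 r) = fls_outer (fls_Xp (2 * q * r)) * F"
    by (rule fls_eqI) (simp add: Y_comp_nth exp_xi0_in_Xi F Y_series_exp_exp mult.assoc)
  ultimately show ?thesis
    by (simp add: G_def fls_outer_mult mult_ac)
qed

lemma fls_sub_const: "cst.fls_sub (fls_const c) = fls_const (fls_const c)"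
proof (rule fls_eqI, rule fls_eqI)
  fix t i :: int
  show "cst.fls_sub (fls_const c) $$ t $$ i = fls_const (fls_const c) $$ t $$ i"
    by (cases "nat t") (auto simp: cst.fls_sub_nth simp del: of_int_add)
qed

text \<open>The same method in the variable z, after removal of z^(2mq). The logarithmic derivative
  is m (h^-)'(y + z) + 2mr (y + z)^(-1), and at z = 0 both sides equal Y(e^((m+q) xi_0),y) e^(r
  xi_0).\<close>

lemma Y_iter_exp_exp_exp:
  "Y_iter (exp_xi0 m) (exp_xi0 q) (exp_xi0 r) = fls_const (fls_const (exp_xi0 r)) *
    (cst.fls_sub (fls_Xp (2 * m * r) * exp_h_series m) *
      (fls_const (fls_Xp (2 * q * r) * exp_h_series q) * fls_Xp (2 * m * q)))"
proof -
  let ?e = "fls_const (fls_const (exp_xi0 r)) :: amb fls fls"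
  let ?y = "fls_const (fls_Xp (2 * q * r) * exp_h_series q) :: amb fls fls"
  define F :: "amb fls fls" where "F = Abs_fls (\<lambda>i. Y_series (exp_h_series m $$ i * exp_xi0 q) (exp_xi0 r))"
  have F: "F $$ i = Y_series (exp_h_series m $$ i * exp_xi0 q) (exp_xi0 r)" for i
    unfolding F_def by (rule nth_Abs_fls_lower_bound[of 0]) (simp add: exp_h_series_nth exp_xi0_in_Xi)
  define G where "G = ?e * (cst.fls_sub (fls_Xp (2 * m * r) * exp_h_series m) * ?y)"
  define f where "f = cst2 (of_int m) * cst.fls_sub (h_series 1) + cst2 (2 * of_int m * of_int r) * cst.binser 1 (-1)"
  have f_neg: "f $$ i = 0" if "i < 0" for i
    using that by (simp add: f_def cst.fls_sub_nth_neg cst.binser_nth_neg)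
  have f_nth: "f $$ int a = cst1 (of_int m) * (cst1 (of_nat (Suc a)) *
      (h_series (Suc a) + cst1 (h_coeff (Suc a) 0) * fls_Xp (- int (Suc a)) * cst1 (of_int r)))" for a
  proof -
    have b: "cst.binser 1 (-1) $$ int a = cst1 ((-1) ^ a) * fls_Xp (- int (Suc a))"
      by (simp add: cst.binser_nth_nat minus_one_gchoose)
    have num: "of_int m * of_nat (Suc a) * h_coeff (Suc a) 0 * of_int r = 2 * of_int m * of_int r * (-1) ^ a"
      by (simp add: h_coeff_def field_simps del: of_nat_Suc)
    have "cst1 (of_int m) * (cst1 (of_nat (Suc a)) *
        (cst1 (h_coeff (Suc a) 0) * X * cst1 (of_int r))) =
        cst1 (2 * of_int m * of_int r) * (cst1 ((-1) ^ a) * X)" for X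
    proof -
      have "cst1 (h_coeff (Suc a) 0) * X * cst1 (of_int r) =
          cst1 (h_coeff (Suc a) 0) * (cst1 (of_int r) * X)"
        by (simp only: mult_ac)
      thus ?thesis
        by (simp only: mult.assoc [symmetric] fls_const_mult_const cst.emb_mult [symmetric] num)
    qed
    moreover have "cst.fls_sub (h_series 1) $$ int a = cst1 (of_nat (Suc a)) * h_series (Suc a)"
      using fls_sub_h_series_nth[of 1 a] by simp
    ultimately show ?thesis by (simp add: f_def b distrib_left del: of_nat_Suc)
  qed
  have "F = G"
  proof (rule fls_ode_unique_amb2[OF f_neg])
    show F_neg: "F $$ i = 0" if "i < 0" for i using that by (simp add: F exp_h_series_nth exp_xi0_in_Xi)
    show "G $$ i = 0" if "i < 0" for i using that by (simp add: G_def cst.fls_sub_nth_neg)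
    show "F $$ 0 = G $$ 0"
    proof -
      have "cst.fls_sub h $$ 0 = h" for h :: "amb fls"
        by (rule fls_eqI) (simp add: cst.fls_sub_nth)
      hence "G $$ 0 = fls_const (exp_xi0 r) * (fls_Xp (2 * m * r) * exp_h_series m * (fls_Xp (2 * q * r) * exp_h_series q))"
        by (simp add: G_def)
      moreover have "F $$ 0 = fls_Xp (2 * (m + q) * r) * exp_h_series (m + q) * fls_const (exp_xi0 r)"
        by (simp add: F exp_h_series_nth Y_series_exp_exp flip: exp_xi0_add)
      moreover have "fls_Xp (2 * (m + q) * r) = (fls_Xp (2 * m * r) * fls_Xp (2 * q * r) :: amb fls)"
        by (simp add: algebra_simps flip: fls_Xp_add)
      ultimately show ?thesis by (simp add: exp_h_series_add mult_ac)
    qed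
    show "fls_deriv F = f * F"
    proof (rule fls2_ode_coeffI[OF F_neg f_neg])
      fix k
      have in_Xi: "exp_h_series m $$ i * exp_xi0 q \<in> Xi" for i
        by (intro Xi_mult exp_h_series_nth_in_Xi exp_xi0_in_Xi)
      have step: "Y_series (xi (Suc a) * (exp_h_series m $$ i * exp_xi0 q)) (exp_xi0 r) =
          (h_series (Suc a) + cst1 (h_coeff (Suc a) 0) * fls_Xp (- int (Suc a)) * cst1 (of_int r)) * F $$ i" for a i
        using Y_series_xi[of "Suc a" "exp_h_series m $$ i * exp_xi0 q" "exp_xi0 r" 1] in_Xi[of i]
        by (simp add: partial_xi_exp Y_series_cst_right exp_xi0_in_Xi F distrib_right mult.assoc)
      have "cst1 (of_nat (Suc k)) * F $$ int (Suc k) =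
          Y_series (cst (of_nat (Suc k)) * exp_h_series m $$ int (Suc k) * exp_xi0 q) (exp_xi0 r)"
        unfolding F mult.assoc by (rule Y_series_cst_left [symmetric, OF in_Xi exp_xi0_in_Xi])
      also have "cst (of_nat (Suc k)) * exp_h_series m $$ int (Suc k) * exp_xi0 q = cst (of_int m) *
          (\<Sum>a\<le>k. cst (of_nat (Suc a)) * (xi (Suc a) * (exp_h_series m $$ int (k - a) * exp_xi0 q)))"
        unfolding exp_h_series_nth_Suc by (simp only: mult.assoc sum_distrib_right)
      also have "Y_series \<dots> (exp_xi0 r) = cst1 (of_int m) * (\<Sum>a\<le>k. cst1 (of_nat (Suc a)) *
          ((h_series (Suc a) + cst1 (h_coeff (Suc a) 0) * fls_Xp (- int (Suc a)) * cst1 (of_int r)) * F $$ int (k - a)))"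
        using in_Xi
        by (simp add: Y_series_cst_left Y_series_sum_left exp_xi0_in_Xi Xi_sum Xi_cst_mult Xi_xi_mult
            step del: of_nat_Suc of_nat_diff)
      also have "\<dots> = (\<Sum>a\<le>k. f $$ int a * F $$ int (k - a))"
        by (simp only: f_nth sum_distrib_left mult.assoc)
      finally show "cst1 (of_nat (Suc k)) * F $$ int (Suc k) = (\<Sum>a\<le>k. f $$ int a * F $$ int (k - a))" .
    qed
    show "fls_deriv G = f * G"
    proof -
      let ?s = "cst.binser 1 (2 * m * r) * cst.fls_sub (exp_h_series m)"
      have s: "fls_deriv (cst.fls_sub (exp_h_series m)) = cst2 (of_int m) * (cst.fls_sub (h_series 1) * cst.fls_sub (exp_h_series m))"
        by (simp add: cst.fls_deriv_fls_sub fls_deriv_exp_h_series cst.fls_sub_mult fls_sub_const mult.assoc)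
      have b: "fls_deriv (cst.binser 1 (2 * m * r)) = cst2 (2 * of_int m * of_int r) * (cst.binser 1 (-1) * cst.binser 1 (2 * m * r))"
        by (simp add: cst.fls_deriv_binser flip: cst.binser_add)
      have G: "G = ?e * (?s * ?y)"
        by (simp add: G_def cst.fls_sub_mult cst.fls_sub_Xp)
      have "fls_deriv G = ?e * (fls_deriv ?s * ?y)"
        by (simp only: G fls_deriv_mult_const_left fls_deriv_mult_const_right)
      also have "fls_deriv ?s = f * ?s"
        by (simp only: fls_deriv_mult s b f_def) (simp only: ring_distribs mult_ac add_ac)
      finally show ?thesis unfolding G by (simp only: mult.left_commute[of f] mult.assoc)
    qed
  qed
  moreover have "Y_iter (exp_xi0 m) (exp_xi0 q) (exp_xi0 r) = fls_Xp (2 * m * q) * F"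
    by (rule fls_eqI) (simp add: Y_iter_nth exp_xi0_in_Xi F Y_series_exp_exp mult.assoc)
  ultimately show ?thesis
    by (simp add: G_def mult_ac)
qed

section \<open>The Jacobi identity\<close>

definition Y_jacobi :: "amb \<Rightarrow> amb \<Rightarrow> amb \<Rightarrow> bool" where
  "Y_jacobi u v w \<longleftrightarrow> cst.jacobi_triple (Y_comp u v w) (Y_comp v u w) (Y_iter u v w)"

lemma Y_jacobi_add:
  assumes "u \<in> Xi" "v \<in> Xi" "w \<in> Xi"
  shows "u' \<in> Xi \<Longrightarrow> Y_jacobi u v w \<Longrightarrow> Y_jacobi u' v w \<Longrightarrow> Y_jacobi (u + u') v w"
    and "v' \<in> Xi \<Longrightarrow> Y_jacobi u v w \<Longrightarrow> Y_jacobi u v' w \<Longrightarrow> Y_jacobi u (v + v') w"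
    and "w' \<in> Xi \<Longrightarrow> Y_jacobi u v w \<Longrightarrow> Y_jacobi u v w' \<Longrightarrow> Y_jacobi u v (w + w')"
  using assms by (simp_all add: Y_jacobi_def Y_comp_add Y_iter_add cst.jacobi_triple_add)

lemma Y_jacobi_cst:
  assumes "u \<in> Xi" "v \<in> Xi" "w \<in> Xi" "Y_jacobi u v w"
  shows "Y_jacobi (cst c * u) v w" "Y_jacobi u (cst c * v) w" "Y_jacobi u v (cst c * w)"
  using assms by (simp_all add: Y_jacobi_def Y_comp_cst Y_iter_cst cst.jacobi_triple_const)

text \<open>The delta function identity multiplied by (x - y)^(2mq), a series in y, a series in x
  and a constant. The second product comes with (y - x)^(2mq), and evenness of the exponent
  identifies the two powers.\<close>

lemma Y_jacobi_exp_exp_exp: "Y_jacobi (exp_xi0 m) (exp_xi0 q) (exp_xi0 r)"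
proof -
  have "(-1) powi (2 * m * q) = (1 :: complex)"
    by (simp add: power_int_mult mult.assoc)
  hence sgn: "cst.sgn_pow (2 * m * q) = 1" by (simp add: cst.sgn_pow_def)
  have "2 * q * m = 2 * m * q" by simp
  from cst.jacobi_triple_const[OF cst.jacobi_triple_x[OF cst.jacobi_triple_y[OF
        cst.jacobi_triple_xy[OF cst.jacobi_triple_1, of "2 * m * q"], of "fls_Xp (2 * q * r) * exp_h_series q"],
        of "fls_Xp (2 * m * r) * exp_h_series m"], of "exp_xi0 r"]
  show ?thesis
    unfolding Y_jacobi_def Y_comp_exp_exp_exp Y_iter_exp_exp_exp sgn \<open>2 * q * m = 2 * m * q\<close>
    by (simp only: mult_1_right mult_1_left mult.left_commute[of "fls_const (fls_Xp (2 * q * r) * exp_h_series q)"])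
qed

lemma Y_jacobi_exp_exp: "w \<in> Xi \<Longrightarrow> Y_jacobi (exp_xi0 m) (exp_xi0 q) w"
proof (induction w rule: Xi_induct_gen)
  case (exp r)
  show ?case by (rule Y_jacobi_exp_exp_exp)
next
  case (xi k w)
  let ?r = "fls_Xp (- int k) :: amb fls"
  have J: "cst.jacobi_triple (Y_comp (exp_xi0 m) (exp_xi0 q) w) (Y_comp (exp_xi0 q) (exp_xi0 m) w)
      (Y_iter (exp_xi0 m) (exp_xi0 q) w)"
    using xi by (simp add: Y_jacobi_def)
  show ?case
    unfolding Y_jacobi_def Y_comp_exp_exp_xi[OF xi(1,2)] Y_iter_exp_exp_xi[OF xi(1,2)]
    using cst.jacobi_triple_add[OF cst.jacobi_triple_add[OF cst.jacobi_triple_const[OF J, of "xi k"]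
        cst.jacobi_triple_const[OF cst.jacobi_triple_x[OF J, of ?r], of "cst (- (2 * of_int m / of_nat k))"]]
        cst.jacobi_triple_const[OF cst.jacobi_triple_y[OF J, of ?r], of "cst (- (2 * of_int q / of_nat k))"]]
    by (simp only: add_ac)
qed (auto intro: Y_jacobi_add Y_jacobi_cst exp_xi0_in_Xi)

text \<open>For the two products a factor xi_n of v is treated by the lemmas for the first operator
  with x and y interchanged; of the contractions with e^(m xi_0) only j = 0 survives. The iterate
  has no such symmetry and uses \<open>Y_iter_exp_xi\<close>.\<close>

lemma Y_jacobi_exp: "v \<in> Xi \<Longrightarrow> w \<in> Xi \<Longrightarrow> Y_jacobi (exp_xi0 m) v w"
proof (induction v arbitrary: w rule: Xi_induct_gen)
  case (exp q)
  thus ?case by (intro Y_jacobi_exp_exp)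
next
  case (xi n v)
  let ?e = "exp_xi0 m"
  obtain K where K: "\<forall>k\<ge>K. partial_xi k w = 0" using partial_xi_eventually_0[OF xi.prems] by blast
  have e: "?e \<in> Xi" "\<And>k. k \<ge> 1 \<Longrightarrow> partial_xi k ?e = 0" by (auto simp: exp_xi0_in_Xi partial_xi_exp)
  have J: "cst.jacobi_triple (Y_comp ?e v w') (Y_comp v ?e w') (Y_iter ?e v w')" if "w' \<in> Xi" for w'
    using xi.IH[OF that] by (simp add: Y_jacobi_def)
  let ?b = "cst.binser (-1) (- int n) :: amb fls fls"
  let ?c = "cst2 (- (2 * of_int m / of_nat n))"
  \<comment> \<open>With x and y interchanged, \<open>h_coeff n 0\<close> belongs to (y - x)^(-n);
    the sign rewrites this contraction as -(2/n) (x - y)^(-n).\<close>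
  have num: "h_coeff n 0 = (-1) powi (- int n) * (- (2 / of_nat n))" "(-1) powi (- int n) * h_coeff n 0 = - (2 / of_nat n)"
    using h_coeff_sym[of n 0] h_coeff_sym[of 0 n] h_coeff_0[OF xi(1)] by simp_all
  have comp1: "Y_comp ?e (xi n * v) w = fls_outer (h_series n) * Y_comp ?e v w + ?c * (?b * Y_comp ?e v w)
      + (\<Sum>k<K. cst2 (h_coeff n k) * (fls_outer (fls_Xp (- int n - int k)) * Y_comp ?e v (partial_xi k w)))"
  proof -
    have "Y_comp ?e (xi n * v) w = fls_outer (h_series n) * Y_comp ?e v w
      + (\<Sum>j<1. cst2 (h_coeff n j) *
        (cst.sgn_pow (- int n - int j) * cst.binser (-1) (- int n - int j) * Y_comp (partial_xi j ?e) v w))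
      + (\<Sum>k<K. cst2 (h_coeff n k) * (fls_outer (fls_Xp (- int n - int k)) * Y_comp ?e v (partial_xi k w)))"
      by (rule Y_comp_xi_middle) (use xi K e in auto)
    moreover have "cst2 (h_coeff n 0) * (cst.sgn_pow (- int n) * ?b * (cst2 (of_int m) * X)) = ?c * (?b * X)" for X
    proof -
      have "(-1) powi (- int n) * h_coeff n 0 * of_int m = - (2 * of_int m / of_nat n)"
        unfolding num by simp
      hence "cst.sgn_pow (- int n) * cst2 (h_coeff n 0) * cst2 (of_int m) = ?c"
        by (simp only: cst.sgn_pow_def fls_const_mult_const cst.emb_mult [symmetric])
      moreover have "cst2 (h_coeff n 0) * (cst.sgn_pow (- int n) * ?b * (cst2 (of_int m) * X)) =
          cst.sgn_pow (- int n) * cst2 (h_coeff n 0) * cst2 (of_int m) * (?b * X)"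
        by (simp only: mult_ac)
      ultimately show ?thesis by (simp only:)
    qed
    ultimately show ?thesis using xi e by (simp add: partial_xi_exp Y_comp_cst)
  qed
  have comp2: "Y_comp (xi n * v) ?e w = fls_const (h_series n) * Y_comp v ?e w
      + ?c * (cst.sgn_pow (- int n) * ?b * Y_comp v ?e w)
      + (\<Sum>k<K. cst2 (h_coeff n k) * (fls_const (fls_Xp (- int n - int k)) * Y_comp v ?e (partial_xi k w)))"
  proof -
    have "Y_comp (xi n * v) ?e w = fls_const (h_series n) * Y_comp v ?e w
      + (\<Sum>j<1. cst2 (h_coeff n j) * (cst.binser (-1) (- int n - int j) * Y_comp v (partial_xi j ?e) w))
      + (\<Sum>k<K. cst2 (h_coeff n k) * (fls_const (fls_Xp (- int n - int k)) * Y_comp v ?e (partial_xi k w)))"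
      by (rule Y_comp_xi_left) (use xi K e in auto)
    moreover have "cst2 (h_coeff n 0) * (?b * (cst2 (of_int m) * X)) = ?c * (cst.sgn_pow (- int n) * ?b * X)" for X
    proof -
      have "h_coeff n 0 * of_int m = - (2 * of_int m / of_nat n) * (-1) powi (- int n)"
        unfolding num(1) by simp
      hence "cst2 (h_coeff n 0) * cst2 (of_int m) = ?c * cst.sgn_pow (- int n)"
        by (simp only: cst.sgn_pow_def fls_const_mult_const cst.emb_mult [symmetric])
      moreover have "cst2 (h_coeff n 0) * (?b * (cst2 (of_int m) * X)) = cst2 (h_coeff n 0) * cst2 (of_int m) * (?b * X)"
        by (simp only: mult_ac)
      ultimately show ?thesis by (simp only: mult.assoc)
    qed
    ultimately show ?thesis using xi e by (simp add: partial_xi_exp Y_comp_cst)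
  qed
  have iter: "Y_iter ?e (xi n * v) w = fls_const (h_series n) * Y_iter ?e v w + ?c * (fls_Xp (- int n) * Y_iter ?e v w)
    + (\<Sum>k<K. cst2 (h_coeff n k) * (fls_const (fls_Xp (- int n - int k)) * Y_iter ?e v (partial_xi k w)))"
    by (rule Y_iter_exp_xi) (use xi K in auto)
  show ?case
    unfolding Y_jacobi_def comp1 comp2 iter
    by (intro cst.jacobi_triple_add cst.jacobi_triple_sum cst.jacobi_triple_const cst.jacobi_triple_y
        cst.jacobi_triple_xy J xi.prems partial_xi_in_Xi)
qed (auto intro: Y_jacobi_add Y_jacobi_cst exp_xi0_in_Xi)

text \<open>The vectors v and w vary in the induction, because a new factor xi_n of u brings in
  their partial derivatives.\<close>

lemma Y_jacobi: "u \<in> Xi \<Longrightarrow> v \<in> Xi \<Longrightarrow> w \<in> Xi \<Longrightarrow> Y_jacobi u v w"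
proof (induction u arbitrary: v w rule: Xi_induct_gen)
  case (exp m)
  thus ?case by (intro Y_jacobi_exp)
next
  case (xi n u)
  obtain Kv where Kv: "\<forall>k\<ge>Kv. partial_xi k v = 0" using partial_xi_eventually_0[OF xi.prems(1)] by blast
  obtain Kw where Kw: "\<forall>k\<ge>Kw. partial_xi k w = 0" using partial_xi_eventually_0[OF xi.prems(2)] by blast
  have J: "cst.jacobi_triple (Y_comp u v' w') (Y_comp v' u w') (Y_iter u v' w')" if "v' \<in> Xi" "w' \<in> Xi" for v' w'
    using xi.IH[OF that] by (simp add: Y_jacobi_def)
  have comp1: "Y_comp (xi n * u) v w = fls_const (h_series n) * Y_comp u v w
    + (\<Sum>j<Kv. cst2 (h_coeff n j) * (cst.binser (-1) (- int n - int j) * Y_comp u (partial_xi j v) w))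
    + (\<Sum>k<Kw. cst2 (h_coeff n k) * (fls_const (fls_Xp (- int n - int k)) * Y_comp u v (partial_xi k w)))"
    by (rule Y_comp_xi_left) (use xi Kv Kw in auto)
  have comp2: "Y_comp v (xi n * u) w = fls_outer (h_series n) * Y_comp v u w
    + (\<Sum>j<Kv. cst2 (h_coeff n j) *
        (cst.sgn_pow (- int n - int j) * cst.binser (-1) (- int n - int j) * Y_comp (partial_xi j v) u w))
    + (\<Sum>k<Kw. cst2 (h_coeff n k) * (fls_outer (fls_Xp (- int n - int k)) * Y_comp v u (partial_xi k w)))"
    by (rule Y_comp_xi_middle) (use xi Kv Kw in auto)
  have iter: "Y_iter (xi n * u) v w = cst.fls_sub (h_series n) * Y_iter u v w
    + (\<Sum>j<Kv. cst2 (h_coeff n j) * (fls_Xp (- int n - int j) * Y_iter u (partial_xi j v) w))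
    + (\<Sum>k<Kw. cst2 (h_coeff n k) * (cst.fls_sub (fls_Xp (- int n - int k)) * Y_iter u v (partial_xi k w)))"
    by (rule Y_iter_xi_left) (use xi Kv Kw in auto)
  show ?case
    unfolding Y_jacobi_def comp1 comp2 iter
    by (intro cst.jacobi_triple_add cst.jacobi_triple_sum cst.jacobi_triple_const cst.jacobi_triple_x
        cst.jacobi_triple_xy J xi.prems partial_xi_in_Xi)
qed (auto intro: Y_jacobi_add Y_jacobi_cst)

section \<open>The vertex algebra \<open>\<Xi>\<close>\<close>

lemma Y_Xi_jacobi:
  assumes u: "u \<in> Xi" and v: "v \<in> Xi" and w: "w \<in> Xi"
  shows "Sum_any (\<lambda>(i, j). ascale (delta_xy (a - i) (b - j) c) (Y_Xi u i (Y_Xi v j w)))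
      - Sum_any (\<lambda>(i, j). ascale (delta_yx (a - i) (b - j) c) (Y_Xi v j (Y_Xi u i w)))
      = Sum_any (\<lambda>(j, k). ascale (delta_yz a (b - j) (c - k)) (Y_Xi (Y_Xi u k v) j w))"
proof -
  have comp: "Y_comp u v w $$ j $$ i = Y_Xi u i (Y_Xi v j w)" if "u \<in> Xi" "v \<in> Xi" "w \<in> Xi" for u v w i j
    using that Y_series_nth_in_Xi[of v w j] by (simp add: Y_comp_nth Y_series_nth)
  have iter: "Y_iter u v w $$ k $$ j = Y_Xi (Y_Xi u k v) j w" for k j
    using assms Y_series_nth_in_Xi[of u v k] by (simp add: Y_iter_nth Y_series_nth)
  \<comment> \<open>The factors \<open>cst2 1\<close> give all three terms the shape of
    \<open>binser_times_Sum_any\<close>.\<close>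
  have "(cst2 1 * (cst.binser (-1) (-c-1) * Y_comp u v w)) $$ b $$ a
      - (cst2 ((-1) powi (-c-1)) * (cst.binser (-1) (-c-1) * Y_comp v u w)) $$ a $$ b
      = (cst2 1 * (cst.binser 1 (-a-1) * Y_iter u v w)) $$ c $$ b"
    using Y_jacobi[OF assms] unfolding Y_jacobi_def cst.jacobi_triple_def cst.sgn_pow_def by simp
  thus ?thesis
    unfolding cst.binser_times_Sum_any(1)[of 1] cst.binser_times_Sum_any(2)[of "(-1) powi (-c-1)"]
    by (simp add: comp[OF u v w] comp[OF v u w] iter delta_xy_def delta_yx_def delta_yz_def ascale_cst)
qed

lemma Y_Xi_one_left:
  assumes "v \<in> Xi"
  shows "Y_Xi 1 i v = (if i = 0 then v else 0)"
proof -
  have E0: "exp_h_series 0 = 1"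
  proof (rule fls_ode_unique_amb[of 0])
    show "fls_deriv (exp_h_series 0) = 0 * exp_h_series 0 + 0"
      by (simp add: fls_deriv_exp_h_series)
  qed (simp_all add: exp_h_series_nth)
  have "Y_series (exp_xi0 0) v = fls_const v" using assms
  proof (induction v rule: Xi_induct_gen)
    case (exp m)
    show ?case using Y_series_exp_exp[of 0 m] by (simp add: E0)
  next
    case (xi n v)
    thus ?case using Y_series_exp_xi[of n v 0] by simp
  next
    case (add v w)
    thus ?case using Y_series_add_right[OF exp_xi0_in_Xi[of 0]] by (simp flip: fls_plus_const)
  next
    case (scale c v)
    thus ?case using Y_series_cst_right[OF exp_xi0_in_Xi[of 0]] by simp
  qed
  thus ?thesis using Y_series_nth[OF one_in_Xi assms, of i] by simp
qed

text \<open>All differential operators annihilate 1, so only e^(m h^-(x)) and the h_n^-(x) remain;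
  these are power series with constant terms e^(m xi_0) and xi_n.\<close>

lemma Y_series_one_right:
  assumes "u \<in> Xi"
  shows "(\<forall>i<0. Y_series u 1 $$ i = 0) \<and> Y_series u 1 $$ 0 = u"
  using assms
proof (induction u rule: Xi_induct_gen)
  case (exp m)
  have "Y_series (exp_xi0 m) 1 = exp_h_series m" using Y_series_exp_exp[of m 0] by simp
  thus ?case by (simp add: exp_h_series_nth)
next
  case (xi n u)
  have "Y_series (xi n * u) 1 = h_series n * Y_series u 1"
    using Y_series_xi[of n u 1 0] xi by simp
  moreover have "(h_series n * Y_series u 1) $$ i = 0" if "i < 0" for i
    by (rule fls_times_nth_eq_0[of 0 _ 0]) (use xi that in \<open>auto simp: h_series_nth\<close>)
  moreover have "(h_series n * Y_series u 1) $$ 0 = xi n * u"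
    using fls_times_nth_atMost[of "h_series n" "Y_series u 1" 0] xi by (simp add: h_series_nth)
  ultimately show ?case by simp
next
  case (add v w)
  thus ?case by (simp add: Y_series_add_left)
next
  case (scale c v)
  thus ?case by (simp add: Y_series_cst_left)
qed

theorem theorem6p1:
  shows "vertex_algebra ascale Xi Y_Xi 1"
proof
  show "amb.subspace Xi" unfolding Xi_def by (rule amb.subspace_span)
  show "1 \<in> Xi" by simp
next
  fix u v i assume "u \<in> Xi" "v \<in> Xi"
  thus "Y_Xi u i v \<in> Xi" using Y_series_nth_in_Xi[of u v i] by (simp add: Y_series_nth)
next
  fix u u' v i assume "u \<in> Xi" "u' \<in> Xi" "v \<in> Xi"
  thus "Y_Xi (u + u') i v = Y_Xi u i v + Y_Xi u' i v" by (rule Y_Xi_add_left)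
next
  fix u v c i assume "u \<in> Xi" "v \<in> Xi"
  thus "Y_Xi (ascale c u) i v = ascale c (Y_Xi u i v)" unfolding ascale_cst by (rule Y_Xi_cst_left)
next
  fix u v v' i assume "u \<in> Xi" "v \<in> Xi" "v' \<in> Xi"
  thus "Y_Xi u i (v + v') = Y_Xi u i v + Y_Xi u i v'" by (rule Y_Xi_add_right)
next
  fix u v i c assume "u \<in> Xi" "v \<in> Xi"
  thus "Y_Xi u i (ascale c v) = ascale c (Y_Xi u i v)" unfolding ascale_cst by (rule Y_Xi_cst_right)
next
  fix u v assume "u \<in> Xi" "v \<in> Xi"
  thus "\<exists>N. \<forall>i<N. Y_Xi u i v = 0" by (rule Y_Xi_truncation)
next
  fix v i assume "v \<in> Xi"
  thus "Y_Xi 1 i v = (if i = 0 then v else 0)" by (rule Y_Xi_one_left)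
next
  fix u and i :: int assume "u \<in> Xi" "i < 0"
  thus "Y_Xi u i 1 = 0" using Y_series_one_right[of u] Y_series_nth[of u 1 i] by simp
next
  fix u assume "u \<in> Xi"
  thus "Y_Xi u 0 1 = u" using Y_series_one_right[of u] Y_series_nth[of u 1 0] by simp
next
  fix u v w a b c assume "u \<in> Xi" "v \<in> Xi" "w \<in> Xi"
  thus "Sum_any (\<lambda>(i, j). ascale (delta_xy (a - i) (b - j) c) (Y_Xi u i (Y_Xi v j w)))
      - Sum_any (\<lambda>(i, j). ascale (delta_yx (a - i) (b - j) c) (Y_Xi v j (Y_Xi u i w)))
      = Sum_any (\<lambda>(j, k). ascale (delta_yz a (b - j) (c - k)) (Y_Xi (Y_Xi u k v) j w))"
    by (rule Y_Xi_jacobi)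
qed

end
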